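(* Let $d\ge 1$ and let $\Omega\subset\mathbb{R}^d$ be a bounded open set that satisfies an interior cone condition and has a Lipschitz boundary. Let $\nu$ be a Borel probability measure on $\Omega$ with a bounded density function with respect to the Lebesgue measure. Let $k(x,x')=\Phi(x-x')$, where $\Phi\colon\mathbb{R}^d\to\mathbb{R}$ is a continuous and integrable positive-definite function for which there are constants $r>d/2$ and $c_1,c_2>0$ such that $c_1(1+\|\xi\|^2)^{-r}\le\hat\Phi(\xi)\le c_2(1+\|\xi\|^2)^{-r}$ for all $\xi\in\mathbb{R}^d$. Let $(X_n)_{n\ge2}$ be a sequence of sets $X_n\subset\Omega$ of $n$ distinct points. Then there are constants $C>0$ and $h_0>0$, independent of $n$, such that $$|w_{X_n,i}^{\mathrm{BQ}}|\le C\left(\frac{h_{X_n,\Omega}}{q_{X_n}}\right)^{r-d/2}h_{X_n,\Omega}^{d/2}\quad\text{for all } i=1,\ldots,n$$ whenever $h_{X_n,\Omega}\le h_0$. Moreover, if the sets $X_n$ are quasi-uniform, then there are $C'>0$ and $n_0\in\mathbb{N}$ such that $|w_{X_n,i}^{\mathrm{BQ}}|\le C' n^{-1/2}$ for all $n\ge n_0$ and all $i=1,\ldots,n$.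
   Context: Bayesian quadrature weights: for $X_n=\{x_1,\ldots,x_n\}\subset\Omega$ distinct, $w_{X_n}^{\mathrm{BQ}}=(w_{X_n,i}^{\mathrm{BQ}})_{i=1}^n=K_{X_n}^{-1}k_{\nu,X_n}$, where $[K_{X_n}]_{ij}=k(x_j,x_i)$ (an invertible matrix) and $[k_{\nu,X_n}]_i=k_\nu(x_i)$ with $k_\nu(x)=\int_\Omega k(y,x)\,\mathrm{d}\nu(y)$. Fourier transform: $\hat f(\xi)=(2\pi)^{-d/2}\int_{\mathbb{R}^d}f(x)e^{-\sqrt{-1}\,\xi^{\mathsf T}x}\,\mathrm{d}x$. Fill-distance: $h_{X_n,\Omega}=\sup_{x\in\Omega}\min_{i=1,\ldots,n}\|x-x_i\|$. Separation distance: $q_{X_n}=\frac12\min_{i\ne j}\|x_i-x_j\|$. The sets $X_n$ are quasi-uniform if there are constants $\tilde c_1,\tilde c_2>0$ independent of $n$ with $\tilde c_1 q_{X_n}\le h_{X_n,\Omega}\le\tilde c_2 q_{X_n}$ for all $n$. Interior cone condition: there are an angle $\theta\in(0,\pi/2)$ and a radius $R>0$ such that for each $x\in\Omega$ there is a unit vector $\xi(x)$ such that the cone $\{x+\lambda y : y\in\mathbb{R}^d,\ \|y\|=1,\ y^{\mathsf T}\xi(x)\ge\cos\theta,\ \lambda\in[0,R]\}$ is contained in $\Omega$. Lipschitz boundary has its standard meaning. *)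

theory Defs
  imports
    "HOL-Probability.Probability"
    "Jordan_Normal_Form.Gauss_Jordan_Elimination"
begin

no_notation scalar_prod (infix \<open>\<bullet>\<close> 70)

text \<open>
  The finite point sets are lists of distinct points, so that the points come with a numbering;
  list, vector and matrix indices run over \<open>0, \<dots>, n - 1\<close>.
\<close>

definition gram_mat :: "('a \<Rightarrow> 'a \<Rightarrow> real) \<Rightarrow> 'a list \<Rightarrow> real mat" where
  "gram_mat k xs = mat (length xs) (length xs) (\<lambda>(i, j). k (xs ! j) (xs ! i))"

definition kernel_mean :: "('a \<Rightarrow> 'a \<Rightarrow> real) \<Rightarrow> 'a measure \<Rightarrow> 'a \<Rightarrow> real" where
  "kernel_mean k \<nu> x = (\<integral>y. k y x \<partial>\<nu>)"

definition kernel_mean_vec :: "('a \<Rightarrow> 'a \<Rightarrow> real) \<Rightarrow> 'a measure \<Rightarrow> 'a list \<Rightarrow> real Matrix.vec" where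
  "kernel_mean_vec k \<nu> xs = Matrix.vec (length xs) (\<lambda>i. kernel_mean k \<nu> (xs ! i))"

text \<open>
  \<open>mat_inverse\<close> is \<open>None\<close> exactly for singular square matrices. The Gram matrix of a
  positive-definite kernel at distinct points is invertible, so \<open>the\<close> yields its inverse.
\<close>

definition bq_weights :: "('a \<Rightarrow> 'a \<Rightarrow> real) \<Rightarrow> 'a measure \<Rightarrow> 'a list \<Rightarrow> real Matrix.vec" where
  "bq_weights k \<nu> xs = the (mat_inverse (gram_mat k xs)) *\<^sub>v kernel_mean_vec k \<nu> xs"

definition bq_weight :: "('a \<Rightarrow> 'a \<Rightarrow> real) \<Rightarrow> 'a measure \<Rightarrow> 'a list \<Rightarrow> nat \<Rightarrow> real" where
  "bq_weight k \<nu> xs i = vec_index (bq_weights k \<nu> xs) i"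

definition fourier_transform :: "(real ^ 'd \<Rightarrow> real) \<Rightarrow> real ^ 'd \<Rightarrow> complex" where
  "fourier_transform f \<xi> =
     of_real ((2 * pi) powr (- (real CARD('d) / 2))) *
     (\<integral>x. of_real (f x) * exp (- (\<i> * of_real (\<xi> \<bullet> x))) \<partial>lborel)"

text \<open>
  Positive definite in the sense usual for kernel interpolation: the kernel \<open>\<Phi> (x - y)\<close> is symmetric
  and its Gram matrices at distinct points are positive definite (not merely semidefinite).
\<close>

definition positive_definite_function :: "('a::real_vector \<Rightarrow> real) \<Rightarrow> bool" where
  "positive_definite_function \<Phi> \<longleftrightarrow>
     (\<forall>x. \<Phi> (- x) = \<Phi> x) \<and>
     (\<forall>P c. finite P \<and> (\<exists>x\<in>P. c x \<noteq> 0) \<longrightarrow>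
        (\<Sum>x\<in>P. \<Sum>y\<in>P. c x * c y * \<Phi> (x - y)) > 0)"

definition fill_distance :: "'a::real_normed_vector set \<Rightarrow> 'a set \<Rightarrow> real" where
  "fill_distance P \<Omega> = (SUP x\<in>\<Omega>. Min ((\<lambda>y. norm (x - y)) ` P))"

definition separation_distance :: "'a::real_normed_vector set \<Rightarrow> real" where
  "separation_distance P = Min {norm (x - y) | x y. x \<in> P \<and> y \<in> P \<and> x \<noteq> y} / 2"

definition quasi_uniform :: "(nat \<Rightarrow> 'a::real_normed_vector set) \<Rightarrow> 'a set \<Rightarrow> bool" where
  "quasi_uniform P \<Omega> \<longleftrightarrow>
     (\<exists>c1>0. \<exists>c2>0. \<forall>n\<ge>2.
        c1 * separation_distance (P n) \<le> fill_distance (P n) \<Omega> \<and>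
        fill_distance (P n) \<Omega> \<le> c2 * separation_distance (P n))"

definition interior_cone_condition :: "'a::euclidean_space set \<Rightarrow> bool" where
  "interior_cone_condition \<Omega> \<longleftrightarrow>
     (\<exists>\<theta> R. 0 < \<theta> \<and> \<theta> < pi / 2 \<and> R > 0 \<and>
        (\<forall>x\<in>\<Omega>. \<exists>\<xi>. norm \<xi> = 1 \<and>
           {x + t *\<^sub>R y | y t. norm y = 1 \<and> y \<bullet> \<xi> \<ge> cos \<theta> \<and> 0 \<le> t \<and> t \<le> R} \<subseteq> \<Omega>))"

text \<open>
  Near each boundary point the set is the strict epigraph of a Lipschitz function of \<open>d - 1\<close> variables
  in rotated coordinates. The unit vector \<open>e\<close> is the last axis of these coordinates, and the remaining
  variables are the orthogonal projection of the point onto the hyperplane perpendicular to \<open>e\<close>.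
\<close>

definition lipschitz_boundary :: "'a::euclidean_space set \<Rightarrow> bool" where
  "lipschitz_boundary \<Omega> \<longleftrightarrow>
     (\<forall>p\<in>frontier \<Omega>. \<exists>\<epsilon>>0. \<exists>e \<gamma> L. norm e = 1 \<and> L-lipschitz_on {z. z \<bullet> e = 0} \<gamma> \<and>
        \<Omega> \<inter> ball p \<epsilon> = {x \<in> ball p \<epsilon>. x \<bullet> e > (\<gamma> (x - (x \<bullet> e) *\<^sub>R e) :: real)})"

text \<open>A measure with a density with respect to Lebesgue measure restricted to \<open>\<Omega>\<close> lives on the
  Borel sets of \<open>\<Omega>\<close>; in particular \<open>space \<nu> = \<Omega>\<close>.\<close>

definition has_bounded_density_on :: "'a::euclidean_space measure \<Rightarrow> 'a set \<Rightarrow> bool" where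
  "has_bounded_density_on \<nu> \<Omega> \<longleftrightarrow>
     (\<exists>p B. p \<in> borel_measurable (restrict_space lborel \<Omega>) \<and> (\<forall>x\<in>\<Omega>. 0 \<le> p x \<and> p x \<le> B) \<and>
        \<nu> = density (restrict_space lborel \<Omega>) (\<lambda>x. ennreal (p x)))"

end

theory Submission
  imports Defs "Jordan_Normal_Form.Determinant"
begin

text \<open>
  Write \<open>d\<close> for the dimension, \<open>h\<close> for the fill distance and \<open>q\<close> for the separation distance of the nodes.
  A quadrature rule with weights \<open>w\<close> is compared with \<open>\<nu>\<close> through the signed measure
  \<open>\<mu>\<^sub>w = \<nu> - \<Sum> w\<^sub>x \<delta>\<^sub>x\<close>. Its squared worst-case error in the native space of \<open>\<Phi>\<close> is the double integral
  of \<open>\<Phi> (x - y)\<close> against \<open>\<mu>\<^sub>w\<close>, and Fourier inversion turns it into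
  \<open>\<integral> |transform of \<mu>\<^sub>w|\<^sup>2 \<cdot> (transform of \<Phi>)\<close>, up to a constant (\<open>cos_inversion\<close>, \<open>quad_error_twice\<close>). The
  two-sided bound on the transform of \<open>\<Phi>\<close> allows replacing it by the Sobolev weight \<open>(1 + |\<xi>|\<^sup>2) powr (- r)\<close>.

  The weight at a node \<open>z\<close> is read off from a bump \<open>\<phi> ((x - z) / \<rho>)\<close> with \<open>\<rho>\<close> proportional to \<open>q\<close>: it is \<open>1\<close>
  at \<open>z\<close> and \<open>0\<close> at all other nodes, so \<open>\<mu>\<^sub>w\<close> integrates it to \<open>O(q\<^sup>d) - w\<^sub>z\<close>. Since the Sobolev norm of this
  bump is of order \<open>q powr (d/2 - r)\<close>, duality gives
  \<open>|w\<^sub>z| \<le> C q\<^sup>d + C e q powr (d/2 - r)\<close> with \<open>e\<close> the worst-case error (\<open>weight_le_bump\<close>).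
  The Bayesian quadrature weights minimise the worst-case error, because their linear system says that the error
  functional vanishes on all kernel translates at nodes (\<open>optimal_quad_error_le\<close>). So it suffices to find one
  rule on the same nodes with \<open>e \<le> C h powr r\<close>; then the two terms combine to the asserted bound, as \<open>q \<le> h\<close>.

  Such a rule is built locally. The interior cone condition places in \<open>\<Omega>\<close>, next to any point, a grid
  with spacing a large multiple of \<open>h\<close>. The nodes nearest to the grid points are a small relative perturbation of it, so
  interpolation by tensor polynomials there is still solvable with bounds, and it yields weights that
  integrate such polynomials exactly against the part of \<open>\<nu>\<close> near the point (\<open>local_quadrature\<close>). To
  measure the global error without fractional Sobolev spaces, the Sobolev weight is written as a superposition
  of the Gaussians \<open>exp (- t |\<xi>|\<^sup>2)\<close> with density proportional to \<open>t powr (r - 1) exp (- t)\<close>. For each \<open>t\<close> the energy is again a double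
  integral of a Gaussian of width \<open>\<surd>t\<close> against \<open>\<mu>\<^sub>w\<close>, and a Gaussian is, by the exponential series, a tensor
  polynomial up to an error of order \<open>(h / \<surd>t)\<^sup>M\<close> on balls of radius \<open>O(h)\<close> (\<open>gaussian_tensor_taylor\<close>). For \<open>t \<ge> h\<^sup>2\<close>
  exactness gives the decay \<open>(h\<^sup>2 / t) powr (M/2)\<close>. For \<open>t \<le> h\<^sup>2\<close> the total mass \<open>O(h\<^sup>d)\<close> of the rule and of \<open>\<nu>\<close> near
  any point gives \<open>(h\<^sup>2 / t) powr (d/2)\<close>. As \<open>d/2 < r < M/2\<close> the integral
  over \<open>t\<close> is of order \<open>h powr (2 r)\<close> (\<open>weighted_error_spectrum_le\<close>).

  For quasi-uniform nodes a volume count gives \<open>n q\<^sup>d \<le> C\<close> (\<open>card_separated_le\<close>), so that \<open>h\<close> tends to \<open>0\<close> and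
  \<open>h powr (d/2)\<close> is \<open>O(n powr (- 1/2))\<close>.
\<close>

section \<open>Fourier analysis with cosines\<close>

lemma
  fixes f :: "'a::euclidean_space \<Rightarrow> real \<Rightarrow> 'b::{real_normed_field,banach,second_countable_topology}"
  assumes f: "\<And>b. b \<in> Basis \<Longrightarrow> integrable lborel (f b)"
  shows integrable_prod_Basis: "integrable lborel (\<lambda>x::'a. \<Prod>b\<in>Basis. f b (x \<bullet> b))"
    and integral_prod_Basis:
      "(\<integral>x. (\<Prod>b\<in>Basis. f b (x \<bullet> b)) \<partial>(lborel :: 'a measure)) = (\<Prod>b\<in>Basis. (LBINT u. f b u))"
proof -
  interpret product_sigma_finite "\<lambda>b::'a. lborel :: real measure" ..
  have fm: "f b \<in> borel_measurable borel" if "b \<in> Basis" for b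
    using f[OF that] by auto
  have "(\<lambda>x::'a. f b (x \<bullet> b)) \<in> borel_measurable borel" if "b \<in> Basis" for b
    by (rule measurable_compose[OF _ fm[OF that]]) simp
  then have [measurable]: "(\<lambda>x::'a. \<Prod>b\<in>Basis. f b (x \<bullet> b)) \<in> borel_measurable borel"
    by (rule borel_measurable_prod)
  have m: "(\<lambda>g. \<Sum>b\<in>Basis. g b *\<^sub>R b) \<in> Pi\<^sub>M Basis (\<lambda>b::'a. lborel) \<rightarrow>\<^sub>M borel"
    by measurable
  have eq: "(\<Prod>b\<in>Basis. f b ((\<Sum>b\<in>Basis. g b *\<^sub>R b) \<bullet> b)) = (\<Prod>b\<in>Basis. f b (g b))" for g
    by (intro prod.cong refl) (simp add: inner_sum_left_Basis)
  have D: "(lborel :: 'a measure) = distr (Pi\<^sub>M Basis (\<lambda>b. lborel)) borel (\<lambda>g. \<Sum>b\<in>Basis. g b *\<^sub>R b)"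
    unfolding lborel_eq_real by (rule lborel_def)
  show "integrable lborel (\<lambda>x::'a. \<Prod>b\<in>Basis. f b (x \<bullet> b))"
    unfolding D using product_integrable_prod[OF finite_Basis f]
    by (subst integrable_distr_eq[OF m]) (simp_all add: eq)
  show "(\<integral>x. (\<Prod>b\<in>Basis. f b (x \<bullet> b)) \<partial>(lborel :: 'a measure)) = (\<Prod>b\<in>Basis. (LBINT u. f b u))"
    unfolding D using product_integral_prod[OF finite_Basis f]
    by (subst integral_distr[OF m]) (simp_all add: eq)
qed

lemma
  fixes f :: "'a::euclidean_space \<Rightarrow> 'b::{banach,second_countable_topology}"
  assumes c: "c \<noteq> 0"
  shows integrable_lborel_affine: "integrable lborel f \<Longrightarrow> integrable lborel (\<lambda>x. f (t + c *\<^sub>R x))"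
    and integral_lborel_affine: "f \<in> borel_measurable borel \<Longrightarrow>
      (LBINT x. f x) = \<bar>c\<bar> ^ DIM('a) *\<^sub>R (LBINT x. f (t + c *\<^sub>R x))"
proof -
  have D: "lborel = density (distr lborel borel (\<lambda>x::'a. t + c *\<^sub>R x)) (\<lambda>_. ennreal (\<bar>c\<bar>^DIM('a)))"
    using lborel_affine[OF c, of t] by (simp add: ennreal_power)
  {
    assume f: "integrable lborel f"
    then have [measurable]: "f \<in> borel_measurable borel" by auto
    have "integrable (density (distr lborel borel (\<lambda>x::'a. t + c *\<^sub>R x)) (\<lambda>_. ennreal (\<bar>c\<bar>^DIM('a)))) f"
      using f by (simp only: D[symmetric])
    then have "integrable lborel (\<lambda>x. \<bar>c\<bar> ^ DIM('a) *\<^sub>R f (t + c *\<^sub>R x))"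
      by (simp add: integrable_density integrable_distr_eq)
    from integrable_scaleR_right[OF this, of "1 / \<bar>c\<bar> ^ DIM('a)"]
    show "integrable lborel (\<lambda>x. f (t + c *\<^sub>R x))"
      using c by simp
  next
    assume [measurable]: "f \<in> borel_measurable borel"
    have "(LBINT x. f x) = (\<integral>x. f x \<partial>density (distr lborel borel (\<lambda>x::'a. t + c *\<^sub>R x)) (\<lambda>_. ennreal (\<bar>c\<bar>^DIM('a))))"
      by (simp only: D[symmetric])
    also have "\<dots> = \<bar>c\<bar> ^ DIM('a) *\<^sub>R (LBINT x. f (t + c *\<^sub>R x))"
      by (simp add: integral_density integral_distr)
    finally show "(LBINT x. f x) = \<bar>c\<bar> ^ DIM('a) *\<^sub>R (LBINT x. f (t + c *\<^sub>R x))" .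
  }
qed

text \<open>
  This is the characteristic function of the standard normal distribution, rescaled.
\<close>

lemma
  fixes s t :: real
  assumes t: "t > 0"
  shows integrable_gaussian_cis: "integrable lborel (\<lambda>u. of_real (exp (- t * u\<^sup>2)) * cis (s * u))"
    and integral_gaussian_cis: "(LBINT u. of_real (exp (- t * u\<^sup>2)) * cis (s * u))
           = of_real (sqrt (pi / t) * exp (- s\<^sup>2 / (4 * t)))"
proof -
  define c where "c = sqrt (2 * t)"
  have c: "c > 0" "c\<^sup>2 = 2 * t" using t by (auto simp: c_def)
  have i: "integrable lborel (\<lambda>x. std_normal_density x *\<^sub>R iexp (s / c * x))"
    by (rule Bochner_Integration.integrable_bound[of _ std_normal_density])
       (auto simp: integrable_std_normal_moment)
  have e: "std_normal_density (0 + c * u) *\<^sub>R iexp (s / c * (0 + c * u))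
         = of_real (1 / sqrt (2 * pi)) * (of_real (exp (- t * u\<^sup>2)) * cis (s * u))" for u
    using c t by (simp add: std_normal_density_def power_mult_distrib cis_conv_exp scaleR_conv_of_real field_simps)
  have "integrable lborel (\<lambda>u. of_real (1 / sqrt (2 * pi)) * (of_real (exp (- t * u\<^sup>2)) * cis (s * u)))"
    using lborel_integrable_real_affine[OF i, of c 0] c(1) unfolding e by simp
  then have *: "integrable lborel (\<lambda>u. of_real (sqrt (2 * pi)) * (of_real (1 / sqrt (2 * pi)) *
      (of_real (exp (- t * u\<^sup>2)) * cis (s * u))))"
    by (rule integrable_mult_right)
  have "of_real (sqrt (2 * pi)) * (of_real (1 / sqrt (2 * pi)) * z) = z" for z :: complex
    unfolding mult.assoc[symmetric] of_real_mult[symmetric] by simp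
  then show "integrable lborel (\<lambda>u. of_real (exp (- t * u\<^sup>2)) * cis (s * u))"
    using * by simp
  have "of_real (exp (- ((s / c)\<^sup>2) / 2)) = char std_normal_distribution (s / c)"
    by (simp add: char_std_normal_distribution)
  also have "\<dots> = (LBINT x. std_normal_density x *\<^sub>R iexp (s / c * x))"
    unfolding char_def by (subst integral_density) (auto simp: normal_density_nonneg)
  also have "\<dots> = c *\<^sub>R (LBINT u. std_normal_density (0 + c * u) *\<^sub>R iexp (s / c * (0 + c * u)))"
    using c(1) by (subst lborel_integral_real_affine[of c _ 0]) auto
  also have "\<dots> = of_real (c / sqrt (2 * pi)) * (LBINT u. of_real (exp (- t * u\<^sup>2)) * cis (s * u))"
    unfolding e by (simp add: scaleR_conv_of_real)
  finally have *: "of_real (c / sqrt (2 * pi)) * (LBINT u. of_real (exp (- t * u\<^sup>2)) * cis (s * u))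
     = (of_real (exp (- ((s / c)\<^sup>2) / 2)) :: complex)" ..
  have "c / sqrt (2 * pi) = sqrt (t / pi)"
    by (simp add: c_def real_sqrt_divide real_sqrt_mult)
  then have "of_real (sqrt (pi / t)) * of_real (c / sqrt (2 * pi)) = (1::complex)"
    using t unfolding of_real_mult[symmetric] by (simp add: real_sqrt_divide)
  note one = this
  have "(LBINT u. of_real (exp (- t * u\<^sup>2)) * cis (s * u)) = of_real (sqrt (pi / t)) *
    (of_real (c / sqrt (2 * pi)) * (LBINT u. of_real (exp (- t * u\<^sup>2)) * cis (s * u)))"
    unfolding mult.assoc[symmetric] one by simp
  also have "\<dots> = of_real (sqrt (pi / t) * exp (- ((s / c)\<^sup>2) / 2))" unfolding * by simp
  also have "- ((s / c)\<^sup>2) / 2 = - s\<^sup>2 / (4 * t)" using c by (simp add: power_divide)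
  finally show "(LBINT u. of_real (exp (- t * u\<^sup>2)) * cis (s * u))
           = of_real (sqrt (pi / t) * exp (- s\<^sup>2 / (4 * t)))" .
qed

lemma exp_norm_square_Basis:
  fixes x :: "'a::euclidean_space"
  shows "exp (c * (norm x)\<^sup>2) = (\<Prod>b\<in>Basis. exp (c * (x \<bullet> b)\<^sup>2))"
proof -
  have "(norm x)\<^sup>2 = (\<Sum>b\<in>Basis. (x \<bullet> b)\<^sup>2)"
    unfolding power2_norm_eq_inner using euclidean_inner[of x x] by (simp add: power2_eq_square)
  then show ?thesis by (simp only: exp_sum[OF finite_Basis] sum_distrib_left)
qed

lemma cis_inner_Basis:
  fixes x y :: "'a::euclidean_space"
  shows "cis (x \<bullet> y) = (\<Prod>b\<in>Basis. cis ((x \<bullet> b) * (y \<bullet> b)))"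
  unfolding cis_conv_exp by (simp add: euclidean_inner[of x y] exp_sum sum_distrib_left)

lemma
  fixes z :: "'a::euclidean_space"
  assumes t: "t > 0"
  shows integrable_gaussian_cos: "integrable lborel (\<lambda>x::'a. exp (- t * (norm x)\<^sup>2) * cos (z \<bullet> x))"
    and integral_gaussian_cos: "(\<integral>x. exp (- t * (norm x)\<^sup>2) * cos (z \<bullet> x) \<partial>(lborel :: 'a measure))
       = (pi / t) powr (DIM('a) / 2) * exp (- (norm z)\<^sup>2 / (4 * t))"
proof -
  define g :: "'a \<Rightarrow> complex" where "g = (\<lambda>x. \<Prod>b\<in>Basis. of_real (exp (- t * (x \<bullet> b)\<^sup>2)) * cis ((z \<bullet> b) * (x \<bullet> b)))"
  have g: "g x = of_real (exp (- t * (norm x)\<^sup>2)) * cis (z \<bullet> x)" for x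
    unfolding g_def cis_inner_Basis exp_norm_square_Basis by (simp add: prod.distrib)
  have i: "integrable lborel g"
    unfolding g_def by (rule integrable_prod_Basis[OF integrable_gaussian_cis[OF t]])
  have Re: "Re (g x) = exp (- t * (norm x)\<^sup>2) * cos (z \<bullet> x)" for x
    by (simp add: g)
  show "integrable lborel (\<lambda>x::'a. exp (- t * (norm x)\<^sup>2) * cos (z \<bullet> x))"
    using integrable_Re[OF i] unfolding Re .
  have "(\<integral>x. exp (- t * (norm x)\<^sup>2) * cos (z \<bullet> x) \<partial>(lborel :: 'a measure)) = Re (LBINT x. g x)"
    using integral_Re[OF i] unfolding Re .
  also have "(LBINT x. g x) = (\<Prod>b\<in>(Basis::'a set). of_real (sqrt (pi / t) * exp (- (z \<bullet> b)\<^sup>2 / (4 * t))))"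
    unfolding g_def by (subst integral_prod_Basis[OF integrable_gaussian_cis[OF t]])
      (simp only: integral_gaussian_cis[OF t])
  also have "Re \<dots> = (\<Prod>b\<in>(Basis::'a set). (sqrt (pi / t) * exp ((- 1 / (4 * t)) * (z \<bullet> b)\<^sup>2)))"
    unfolding of_real_prod[symmetric] Re_complex_of_real by simp
  also have "\<dots> = sqrt (pi / t) ^ DIM('a) * exp ((- 1 / (4 * t)) * (norm z)\<^sup>2)"
    unfolding exp_norm_square_Basis by (simp add: prod.distrib)
  also have "sqrt (pi / t) ^ DIM('a) = (pi / t) powr (DIM('a) / 2)"
  proof -
    have "sqrt (pi / t) ^ DIM('a) = sqrt (pi / t) powr real DIM('a)"
      using t by (intro powr_realpow[symmetric]) simp
    also have "\<dots> = ((pi / t) powr (1 / 2)) powr real DIM('a)"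
      using t by (simp add: powr_half_sqrt)
    also have "\<dots> = (pi / t) powr (DIM('a) / 2)"
      by (simp add: powr_powr)
    finally show ?thesis .
  qed
  finally show "(\<integral>x. exp (- t * (norm x)\<^sup>2) * cos (z \<bullet> x) \<partial>(lborel :: 'a measure))
       = (pi / t) powr (DIM('a) / 2) * exp (- (norm z)\<^sup>2 / (4 * t))" by simp
qed

lemma
  assumes t: "t > 0"
  shows integrable_gaussian: "integrable lborel (\<lambda>x::'a::euclidean_space. exp (- t * (norm x)\<^sup>2))"
    and integral_gaussian: "(\<integral>x. exp (- t * (norm x)\<^sup>2) \<partial>(lborel :: 'a::euclidean_space measure)) = (pi / t) powr (DIM('a) / 2)"
  using integrable_gaussian_cos[OF t, of "0::'a"] integral_gaussian_cos[OF t, of "0::'a"]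
  by (simp_all only: inner_zero_left cos_zero norm_zero mult_1_right power_zero_numeral minus_zero div_0 exp_zero)

lemma integrable_pair_mult:
  fixes f :: "'a::euclidean_space \<Rightarrow> real" and g :: "'b::euclidean_space \<Rightarrow> real"
    and H :: "'a \<times> 'b \<Rightarrow> real"
  assumes f: "integrable lborel f" and g: "integrable lborel g"
    and H: "H \<in> borel_measurable (lborel \<Otimes>\<^sub>M lborel)" and le: "\<And>x y. \<bar>H (x, y)\<bar> \<le> \<bar>f x\<bar> * \<bar>g y\<bar>"
  shows "integrable (lborel \<Otimes>\<^sub>M lborel) H"
proof (rule Bochner_Integration.integrable_bound)
  have [measurable]: "f \<in> borel_measurable borel" "g \<in> borel_measurable borel"
    using f g by auto
  show "integrable (lborel \<Otimes>\<^sub>M lborel) (\<lambda>(x, y). \<bar>f x\<bar> * \<bar>g y\<bar>)"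
    using f g by (intro lborel_pair.Fubini_integrable) (auto simp: abs_mult)
qed (use H le in \<open>auto simp: abs_mult\<close>)

lemma integral_even_mult_sin:
  fixes f :: "'a::euclidean_space \<Rightarrow> real"
  assumes f: "integrable lborel f" and even: "\<And>x. f (- x) = f x"
  shows "(LBINT x. f x * sin (\<xi> \<bullet> x)) = 0"
proof -
  have [measurable]: "f \<in> borel_measurable borel" using f by auto
  have "(LBINT x. f x * sin (\<xi> \<bullet> x)) = \<bar>-1\<bar> ^ DIM('a) *\<^sub>R (LBINT x. f (0 + (-1) *\<^sub>R x) * sin (\<xi> \<bullet> (0 + (-1) *\<^sub>R x)))"
    by (rule integral_lborel_affine) auto
  also have "\<dots> = - (LBINT x. f x * sin (\<xi> \<bullet> x))"
    by (simp add: even)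
  finally show ?thesis by simp
qed

lemma integrable_mult_cos_sin:
  fixes f :: "'a::euclidean_space \<Rightarrow> real" and g :: "'a \<Rightarrow> real"
  assumes f: "integrable lborel f" and [measurable]: "g \<in> borel_measurable borel"
  shows "integrable lborel (\<lambda>x. f x * cos (g x))" "integrable lborel (\<lambda>x. f x * sin (g x))"
proof -
  have [measurable]: "f \<in> borel_measurable borel" using f by auto
  show "integrable lborel (\<lambda>x. f x * cos (g x))" "integrable lborel (\<lambda>x. f x * sin (g x))"
    by (rule Bochner_Integration.integrable_bound[OF f];
        auto simp: abs_mult mult_left_le)+
qed

text \<open>
  Fourier inversion for an even function, so that only cosines occur. The double integral on the
  right does not converge absolutely; the factor \<open>exp (- s\<^sup>2 |\<xi>|\<^sup>2)\<close> makes Fubini's theorem applicable and turns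
  the right-hand side into an average of \<open>f (y + 2 s z)\<close> over \<open>z\<close> with Gaussian weight. Both sides
  converge as \<open>s\<close> tends to \<open>0\<close>.
\<close>

lemma cos_inversion:
  fixes f :: "'a::euclidean_space \<Rightarrow> real"
  assumes cont: "continuous_on UNIV f" and int: "integrable lborel f"
    and bdd: "\<And>x. \<bar>f x\<bar> \<le> B" and even: "\<And>x. f (- x) = f x"
    and F: "integrable lborel (\<lambda>\<xi>. LBINT x. f x * cos (\<xi> \<bullet> x))"
  shows "f y = (LBINT \<xi>. (LBINT x. f x * cos (\<xi> \<bullet> x)) * cos (\<xi> \<bullet> y)) / (2 * pi) ^ DIM('a)"
proof -
  define G where "G \<xi> = (LBINT x. f x * cos (\<xi> \<bullet> x)) * cos (\<xi> \<bullet> y)" for \<xi>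
  have [measurable]: "f \<in> borel_measurable borel" using int by auto
  have G_int: "integrable lborel G"
    unfolding G_def by (rule integrable_mult_cos_sin[OF F]) simp
  then have [measurable]: "G \<in> borel_measurable borel" by auto
  \<comment> \<open>The sine terms of the addition theorem integrate to zero because \<open>f\<close> is even.\<close>
  have G_eq: "G \<xi> = (LBINT x. f x * cos (\<xi> \<bullet> (x - y)))" for \<xi>
  proof -
    have "(LBINT x. f x * cos (\<xi> \<bullet> (x - y))) =
        (LBINT x. f x * cos (\<xi> \<bullet> x) * cos (\<xi> \<bullet> y) + f x * sin (\<xi> \<bullet> x) * sin (\<xi> \<bullet> y))"
      by (simp add: inner_diff_right cos_diff algebra_simps)
    also have "\<dots> = G \<xi>"
      unfolding G_def using integrable_mult_cos_sin[OF int, of "\<lambda>x. \<xi> \<bullet> x"]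
      by (subst Bochner_Integration.integral_add) (auto simp: integral_even_mult_sin[OF int even])
    finally show ?thesis ..
  qed
  define J where "J s = (LBINT \<xi>. exp (- s\<^sup>2 * (norm \<xi>)\<^sup>2) * G \<xi>)" for s
  have J: "J s = (4 * pi) powr (DIM('a) / 2) * (LBINT z. f (y + (2 * s) *\<^sub>R z) * exp (- (norm z)\<^sup>2))"
    if s: "s > 0" for s
  proof -
    have s2: "s\<^sup>2 > 0" using s by simp
    have "integrable (lborel \<Otimes>\<^sub>M lborel) (\<lambda>(x, \<xi>). f x * (exp (- s\<^sup>2 * (norm \<xi>)\<^sup>2) * cos (\<xi> \<bullet> (x - y))))"
      by (rule integrable_pair_mult[OF int integrable_gaussian[OF s2]])
         (auto simp: abs_mult mult_left_le mult_left_mono)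
    then have "(LBINT \<xi>. (LBINT x. f x * (exp (- s\<^sup>2 * (norm \<xi>)\<^sup>2) * cos (\<xi> \<bullet> (x - y))))) =
        (LBINT x. (LBINT \<xi>. f x * (exp (- s\<^sup>2 * (norm \<xi>)\<^sup>2) * cos (\<xi> \<bullet> (x - y)))))"
      by (rule lborel_pair.Fubini_integral)
    moreover have "J s = (LBINT \<xi>. (LBINT x. f x * (exp (- s\<^sup>2 * (norm \<xi>)\<^sup>2) * cos (\<xi> \<bullet> (x - y)))))"
      unfolding J_def G_eq integral_mult_right_zero[symmetric] by (simp only: mult_ac)
    ultimately have "J s = (LBINT x. (LBINT \<xi>. f x * (exp (- s\<^sup>2 * (norm \<xi>)\<^sup>2) * cos (\<xi> \<bullet> (x - y)))))"
      by simp
    also have "\<dots> = (LBINT x. f x * (LBINT \<xi>. exp (- s\<^sup>2 * (norm \<xi>)\<^sup>2) * cos ((x - y) \<bullet> \<xi>)))"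
      by (simp add: inner_commute)
    also have "\<dots> = (LBINT x. (pi / s\<^sup>2) powr (DIM('a) / 2) * (f x * exp (- (norm (x - y))\<^sup>2 / (4 * s\<^sup>2))))"
      unfolding integral_gaussian_cos[OF s2] by (simp only: mult_ac)
    also have "\<dots> = (pi / s\<^sup>2) powr (DIM('a) / 2) * (LBINT x. f x * exp (- (norm (x - y))\<^sup>2 / (4 * s\<^sup>2)))"
      by simp
    also have "(LBINT x. f x * exp (- (norm (x - y))\<^sup>2 / (4 * s\<^sup>2))) = \<bar>2 * s\<bar> ^ DIM('a) *\<^sub>R
        (LBINT z. f (y + (2 * s) *\<^sub>R z) * exp (- (norm ((y + (2 * s) *\<^sub>R z) - y))\<^sup>2 / (4 * s\<^sup>2)))"
      using s by (intro integral_lborel_affine) auto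
    also have "(pi / s\<^sup>2) powr (DIM('a) / 2) * \<dots> = ((pi / s\<^sup>2) powr (DIM('a) / 2) * \<bar>2 * s\<bar> ^ DIM('a)) *
        (LBINT z. f (y + (2 * s) *\<^sub>R z) * exp (- (norm z)\<^sup>2))"
      using s by (simp add: power_mult_distrib)
    also have "\<bar>2 * s\<bar> ^ DIM('a) = (4 * s\<^sup>2) powr (DIM('a) / 2)"
    proof -
      have "(4 * s\<^sup>2) powr (DIM('a) / 2) = ((2 * s) powr 2) powr (DIM('a) / 2)"
        using s by (simp add: power_mult_distrib)
      also have "\<dots> = (2 * s) powr DIM('a)" by (simp only: powr_powr) simp
      also have "\<dots> = \<bar>2 * s\<bar> ^ DIM('a)" using s by (simp add: powr_realpow)
      finally show ?thesis ..
    qed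
    also have "(pi / s\<^sup>2) powr (DIM('a) / 2) * (4 * s\<^sup>2) powr (DIM('a) / 2) = (4 * pi) powr (DIM('a) / 2)"
      using s by (subst powr_mult[symmetric]) (auto simp: field_simps)
    finally show ?thesis by simp
  qed
  define \<sigma> :: "nat \<Rightarrow> real" where "\<sigma> n = 1 / real (Suc n)" for n
  have \<sigma>0: "\<sigma> \<longlonglongrightarrow> 0" unfolding \<sigma>_def by (rule LIMSEQ_Suc[OF lim_1_over_n])
  have lim1: "(\<lambda>n. J (\<sigma> n)) \<longlonglongrightarrow> (LBINT \<xi>. G \<xi>)"
    unfolding J_def
  proof (rule integral_dominated_convergence[where w="\<lambda>\<xi>. \<bar>G \<xi>\<bar>"])
    have "(\<lambda>n. exp (- (\<sigma> n)\<^sup>2 * (norm \<xi>)\<^sup>2) * G \<xi>) \<longlonglongrightarrow> exp (- 0\<^sup>2 * (norm \<xi>)\<^sup>2) * G \<xi>" for \<xi>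
      by (intro tendsto_intros \<sigma>0)
    then show "AE \<xi> in lborel. (\<lambda>n. exp (- (\<sigma> n)\<^sup>2 * (norm \<xi>)\<^sup>2) * G \<xi>) \<longlonglongrightarrow> G \<xi>"
      by simp
  qed (use G_int in \<open>auto simp: abs_mult intro!: mult_left_le_one_le\<close>)
  have lim2: "(\<lambda>n. LBINT z. f (y + (2 * \<sigma> n) *\<^sub>R z) * exp (- (norm z)\<^sup>2)) \<longlonglongrightarrow>
      (\<integral>z. f y * exp (- (norm z)\<^sup>2) \<partial>(lborel :: 'a measure))"
  proof (rule integral_dominated_convergence[where w="\<lambda>z. B * exp (- 1 * (norm z)\<^sup>2)"])
    show "integrable lborel (\<lambda>z::'a. B * exp (- 1 * (norm z)\<^sup>2))"
      by (intro integrable_mult_right integrable_gaussian) simp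
    have "(\<lambda>n. f (y + (2 * \<sigma> n) *\<^sub>R z) * exp (- (norm z)\<^sup>2)) \<longlonglongrightarrow> f (y + (2 * 0) *\<^sub>R z) * exp (- (norm z)\<^sup>2)" for z
      by (intro tendsto_intros continuous_on_tendsto_compose[OF cont] \<sigma>0) auto
    then show "AE z in lborel. (\<lambda>n. f (y + (2 * \<sigma> n) *\<^sub>R z) * exp (- (norm z)\<^sup>2)) \<longlonglongrightarrow> f y * exp (- (norm z)\<^sup>2)"
      by simp
    show "AE z in lborel. norm (f (y + (2 * \<sigma> n) *\<^sub>R z) * exp (- (norm z)\<^sup>2)) \<le> B * exp (- 1 * (norm z)\<^sup>2)" for n
      by (simp add: abs_mult bdd)
  qed auto
  have "(\<lambda>n. J (\<sigma> n)) \<longlonglongrightarrow> (4 * pi) powr (DIM('a) / 2) * (\<integral>z. f y * exp (- (norm z)\<^sup>2) \<partial>(lborel :: 'a measure))"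
    using tendsto_mult_left[OF lim2] by (subst J) (auto simp: \<sigma>_def)
  then have "(LBINT \<xi>. G \<xi>) = (4 * pi) powr (DIM('a) / 2) * (\<integral>z. f y * exp (- (norm z)\<^sup>2) \<partial>(lborel::'a measure))"
    using lim1 LIMSEQ_unique by blast
  also have "(\<integral>z. f y * exp (- (norm z)\<^sup>2) \<partial>(lborel::'a measure)) = f y * pi powr (DIM('a) / 2)"
    using integral_gaussian[of 1, where 'a='a] by simp
  also have "(4 * pi) powr (DIM('a) / 2) * (f y * pi powr (DIM('a) / 2)) = f y * (2 * pi) ^ DIM('a)"
  proof -
    have "(4 * pi) powr (DIM('a) / 2) * pi powr (DIM('a) / 2) = ((2 * pi) powr 2) powr (DIM('a) / 2)"
      by (subst powr_mult[symmetric]) (auto simp: power2_eq_square mult.assoc)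
    also have "\<dots> = (2 * pi) ^ DIM('a)"
      by (simp only: powr_powr) (simp add: powr_realpow)
    finally show ?thesis by simp
  qed
  finally show ?thesis by (simp add: G_def)
qed

text \<open>
  Integration against the signed measure that has density \<open>p\<close> and an atom of mass \<open>- w x\<close> at each \<open>x\<close> of \<open>P\<close>.
\<close>

definition quad_error :: "('a::euclidean_space \<Rightarrow> real) \<Rightarrow> 'a set \<Rightarrow> ('a \<Rightarrow> real) \<Rightarrow> ('a \<Rightarrow> real) \<Rightarrow> real" where
  "quad_error p P w f = (LBINT x. p x * f x) - (\<Sum>x\<in>P. w x * f x)"

text \<open>
  The squared modulus of the Fourier transform of that signed measure.
\<close>

definition error_spectrum :: "('a::euclidean_space \<Rightarrow> real) \<Rightarrow> 'a set \<Rightarrow> ('a \<Rightarrow> real) \<Rightarrow> 'a \<Rightarrow> real" where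
  "error_spectrum p P w \<xi> =
    (quad_error p P w (\<lambda>x. cos (\<xi> \<bullet> x)))\<^sup>2 + (quad_error p P w (\<lambda>x. sin (\<xi> \<bullet> x)))\<^sup>2"

lemma abs_quad_error_le:
  assumes p: "integrable lborel p" and p0: "\<And>x. p x \<ge> 0" and S: "\<And>x. \<bar>f x\<bar> \<le> S"
    and f: "f \<in> borel_measurable borel"
  shows "\<bar>quad_error p P w f\<bar> \<le> ((LBINT x. p x) + (\<Sum>x\<in>P. \<bar>w x\<bar>)) * S"
proof -
  have [measurable]: "p \<in> borel_measurable borel" using p by auto
  note f[measurable]
  have pf: "\<bar>p x * f x\<bar> \<le> p x * S" for x
    using S[of x] p0[of x] by (simp add: abs_mult mult_left_mono)
  have pfi: "integrable lborel (\<lambda>x. p x * f x)"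
  proof (rule Bochner_Integration.integrable_bound)
    show "integrable lborel (\<lambda>x. p x * S)" using p by simp
    show "AE x in lborel. norm (p x * f x) \<le> norm (p x * S)"
      using pf by (auto intro: order.trans[OF _ abs_ge_self])
  qed auto
  have "\<bar>LBINT x. p x * f x\<bar> \<le> (LBINT x. p x * S)"
    by (rule integral_abs_bound_integral)
       (use p pf in \<open>auto intro: pfi\<close>)
  moreover have "\<bar>\<Sum>x\<in>P. w x * f x\<bar> \<le> (\<Sum>x\<in>P. \<bar>w x\<bar> * S)"
    by (intro order.trans[OF sum_abs] sum_mono) (simp add: abs_mult mult_left_mono S)
  ultimately show ?thesis
    unfolding quad_error_def distrib_right sum_distrib_right[symmetric] by simp
qed

text \<open>
  Fubini's theorem for the error functional.
\<close>

lemma quad_error_integral: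
  fixes p :: "'a::euclidean_space \<Rightarrow> real" and \<gamma> :: "'a \<Rightarrow> real" and H :: "'a \<Rightarrow> 'a \<Rightarrow> real"
  assumes p: "integrable lborel p" and \<gamma>: "integrable lborel \<gamma>" and P: "finite P"
    and H: "case_prod H \<in> borel_measurable (lborel \<Otimes>\<^sub>M lborel)" and le: "\<And>x \<xi>. \<bar>H x \<xi>\<bar> \<le> \<bar>\<gamma> \<xi>\<bar>"
  shows "quad_error p P w (\<lambda>x. LBINT \<xi>. H x \<xi>) = (LBINT \<xi>. quad_error p P w (\<lambda>x. H x \<xi>))"
    and "integrable lborel (\<lambda>\<xi>. quad_error p P w (\<lambda>x. H x \<xi>))"
proof -
  have [measurable]: "p \<in> borel_measurable borel" using p by auto
  have pH: "integrable (lborel \<Otimes>\<^sub>M lborel) (\<lambda>(x, \<xi>). p x * H x \<xi>)"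
  proof (rule integrable_pair_mult[OF p \<gamma>])
    have "(\<lambda>z. p (fst z) * (case_prod H) z) \<in> borel_measurable (lborel \<Otimes>\<^sub>M lborel)"
      using H by measurable
    then show "(\<lambda>(x, \<xi>). p x * H x \<xi>) \<in> borel_measurable (lborel \<Otimes>\<^sub>M lborel)"
      by (simp add: case_prod_beta')
  qed (auto simp: abs_mult intro!: mult_left_mono le)
  have Hx: "integrable lborel (H x)" for x
    by (rule Bochner_Integration.integrable_bound[OF \<gamma>])
       (use measurable_Pair2[OF H, of x] le in auto)
  have wH: "integrable lborel (\<lambda>\<xi>. \<Sum>x\<in>P. w x * H x \<xi>)"
    by (intro Bochner_Integration.integrable_sum integrable_mult_right Hx)
  have iH: "integrable lborel (\<lambda>\<xi>. LBINT x. p x * H x \<xi>)"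
    using lborel_pair.integrable_snd[OF pH] by simp
  show "integrable lborel (\<lambda>\<xi>. quad_error p P w (\<lambda>x. H x \<xi>))"
    unfolding quad_error_def by (intro Bochner_Integration.integrable_diff iH wH)
  have "(LBINT \<xi>. quad_error p P w (\<lambda>x. H x \<xi>)) =
      (LBINT \<xi>. (LBINT x. p x * H x \<xi>)) - (LBINT \<xi>. (\<Sum>x\<in>P. w x * H x \<xi>))"
    unfolding quad_error_def by (rule Bochner_Integration.integral_diff[OF iH wH])
  also have "(LBINT \<xi>. (LBINT x. p x * H x \<xi>)) = (LBINT x. (LBINT \<xi>. p x * H x \<xi>))"
    by (rule lborel_pair.Fubini_integral[OF pH])
  also have "(LBINT \<xi>. (\<Sum>x\<in>P. w x * H x \<xi>)) = (\<Sum>x\<in>P. w x * (LBINT \<xi>. H x \<xi>))"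
    by (subst Bochner_Integration.integral_sum) (auto intro: Hx)
  finally show "quad_error p P w (\<lambda>x. LBINT \<xi>. H x \<xi>) = (LBINT \<xi>. quad_error p P w (\<lambda>x. H x \<xi>))"
    by (simp add: quad_error_def)
qed

lemma quad_error_lincomb:
  assumes p: "integrable lborel p"
    and f: "integrable lborel (\<lambda>x. p x * f x)" and g: "integrable lborel (\<lambda>x. p x * g x)"
  shows "quad_error p P w (\<lambda>x. a * f x + b * g x) = a * quad_error p P w f + b * quad_error p P w g"
proof -
  have "(LBINT x. p x * (a * f x + b * g x)) = (LBINT x. a * (p x * f x) + b * (p x * g x))"
    by (simp add: algebra_simps)
  also have "\<dots> = a * (LBINT x. p x * f x) + b * (LBINT x. p x * g x)"
    using f g by simp
  finally show ?thesis
    by (simp add: quad_error_def sum.distrib sum_distrib_left algebra_simps)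
qed

text \<open>
  If \<open>g\<close> is a superposition of cosines, then the error functional acts on its translates through its own
  cosine and sine transforms. Applying it in both variables of \<open>g (x - y)\<close> leaves a nonnegative spectral integral;
  with \<open>g = \<Phi>\<close> this is the squared worst-case error.
\<close>

lemma
  fixes p \<psi> g :: "'a::euclidean_space \<Rightarrow> real"
  assumes p: "integrable lborel p" and P: "finite P" and \<psi>: "integrable lborel \<psi>"
    and g: "\<And>z. g z = (LBINT \<xi>. \<psi> \<xi> * cos (\<xi> \<bullet> z))"
  shows quad_error_translate: "quad_error p P w (\<lambda>x. g (x - a)) =
      (\<integral>\<xi>. \<psi> \<xi> * (quad_error p P w (\<lambda>x. cos (\<xi> \<bullet> x)) * cos (\<xi> \<bullet> a)
                 + quad_error p P w (\<lambda>x. sin (\<xi> \<bullet> x)) * sin (\<xi> \<bullet> a)) \<partial>lborel)" (is ?A)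
    and quad_error_twice: "quad_error p P w (\<lambda>x. quad_error p P w (\<lambda>y. g (x - y))) =
      (LBINT \<xi>. \<psi> \<xi> * error_spectrum p P w \<xi>)" (is ?B)
    and integrable_error_spectrum: "integrable lborel (\<lambda>\<xi>. \<psi> \<xi> * error_spectrum p P w \<xi>)" (is ?C)
proof -
  define c s where "c \<xi> = quad_error p P w (\<lambda>x. cos (\<xi> \<bullet> x))" and "s \<xi> = quad_error p P w (\<lambda>x. sin (\<xi> \<bullet> x))" for \<xi>
  have [measurable]: "p \<in> borel_measurable borel" "\<psi> \<in> borel_measurable borel" using p \<psi> by auto
  have [measurable]: "c \<in> borel_measurable borel" "s \<in> borel_measurable borel"
    unfolding c_def s_def quad_error_def by measurable
  note pcs = integrable_mult_cos_sin[OF p]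
  have cos_diff': "cos (\<xi> \<bullet> (x - y)) = cos (\<xi> \<bullet> y) * cos (\<xi> \<bullet> x) + sin (\<xi> \<bullet> y) * sin (\<xi> \<bullet> x)" for \<xi> x y :: 'a
    by (simp add: inner_diff_right cos_diff)
  have A: "quad_error p P w (\<lambda>x. g (x - a)) = (LBINT \<xi>. \<psi> \<xi> * (c \<xi> * cos (\<xi> \<bullet> a) + s \<xi> * sin (\<xi> \<bullet> a)))" for a
  proof -
    have "quad_error p P w (\<lambda>x. g (x - a)) = (LBINT \<xi>. quad_error p P w (\<lambda>x. \<psi> \<xi> * cos (\<xi> \<bullet> (x - a))))"
      unfolding g by (rule quad_error_integral[OF p \<psi> P]) (auto simp: abs_mult mult_left_le)
    also have "\<dots> = (LBINT \<xi>. \<psi> \<xi> * (c \<xi> * cos (\<xi> \<bullet> a) + s \<xi> * sin (\<xi> \<bullet> a)))"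
    proof (rule Bochner_Integration.integral_cong[OF refl])
      fix \<xi>
      have "quad_error p P w (\<lambda>x. \<psi> \<xi> * cos (\<xi> \<bullet> (x - a))) =
          quad_error p P w (\<lambda>x. (\<psi> \<xi> * cos (\<xi> \<bullet> a)) * cos (\<xi> \<bullet> x) + (\<psi> \<xi> * sin (\<xi> \<bullet> a)) * sin (\<xi> \<bullet> x))"
        unfolding cos_diff' by (simp add: algebra_simps)
      also have "\<dots> = (\<psi> \<xi> * cos (\<xi> \<bullet> a)) * c \<xi> + (\<psi> \<xi> * sin (\<xi> \<bullet> a)) * s \<xi>"
        unfolding c_def s_def by (rule quad_error_lincomb[OF p pcs]) simp_all
      finally show "quad_error p P w (\<lambda>x. \<psi> \<xi> * cos (\<xi> \<bullet> (x - a))) = \<psi> \<xi> * (c \<xi> * cos (\<xi> \<bullet> a) + s \<xi> * sin (\<xi> \<bullet> a))"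
        by (simp add: algebra_simps)
    qed
    finally show ?thesis .
  qed
  from A[of a] show ?A by (simp add: c_def s_def)
  define W where "W = (LBINT x. \<bar>p x\<bar>) + (\<Sum>x\<in>P. \<bar>w x\<bar>)"
  have bnd: "\<bar>quad_error p P w (\<lambda>x. u (\<xi> \<bullet> x))\<bar> \<le> W"
    if u: "\<And>x::real. \<bar>u x\<bar> \<le> 1" "u \<in> borel_measurable borel" for u \<xi>
  proof -
    note u(2)[measurable]
    have "\<bar>LBINT x. p x * u (\<xi> \<bullet> x)\<bar> \<le> (LBINT x. \<bar>p x\<bar>)"
      by (rule integral_abs_bound_integral)
         (use p u in \<open>auto intro: Bochner_Integration.integrable_bound[OF p] simp: abs_mult mult_left_le\<close>)
    moreover have "\<bar>\<Sum>x\<in>P. w x * u (\<xi> \<bullet> x)\<bar> \<le> (\<Sum>x\<in>P. \<bar>w x\<bar>)"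
      by (intro order.trans[OF sum_abs] sum_mono) (simp add: abs_mult mult_left_le u)
    ultimately show ?thesis unfolding quad_error_def W_def by linarith
  qed
  have cW: "\<bar>c \<xi>\<bar> \<le> W" and sW: "\<bar>s \<xi>\<bar> \<le> W" for \<xi>
    unfolding c_def s_def by (rule bnd; simp)+
  define H where "H x \<xi> = \<psi> \<xi> * (c \<xi> * cos (\<xi> \<bullet> x) + s \<xi> * sin (\<xi> \<bullet> x))" for x \<xi>
  have H_le: "\<bar>H x \<xi>\<bar> \<le> \<bar>\<psi> \<xi> * (2 * W)\<bar>" for x \<xi>
  proof -
    have "\<bar>c \<xi> * cos (\<xi> \<bullet> x)\<bar> \<le> W * 1" "\<bar>s \<xi> * sin (\<xi> \<bullet> x)\<bar> \<le> W * 1"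
      unfolding abs_mult by (intro mult_mono cW sW order.trans[OF abs_ge_zero cW]; simp)+
    then have "\<bar>c \<xi> * cos (\<xi> \<bullet> x) + s \<xi> * sin (\<xi> \<bullet> x)\<bar> \<le> \<bar>2 * W\<bar>" by linarith
    then show ?thesis unfolding H_def abs_mult by (intro mult_left_mono) auto
  qed
  have g_even: "g (x - y) = g (y - x)" for x y
  proof -
    have "cos (\<xi> \<bullet> (x - y)) = cos (\<xi> \<bullet> (y - x))" for \<xi>
      by (metis cos_minus inner_minus_right minus_diff_eq)
    then show ?thesis unfolding g by simp
  qed
  have \<psi>W: "integrable lborel (\<lambda>\<xi>. \<psi> \<xi> * (2 * W))" using \<psi> by simp
  have Hm: "case_prod H \<in> borel_measurable (lborel \<Otimes>\<^sub>M lborel)"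
    unfolding H_def by measurable
  have E: "quad_error p P w (\<lambda>x. H x \<xi>) = \<psi> \<xi> * error_spectrum p P w \<xi>" for \<xi>
  proof -
    have "quad_error p P w (\<lambda>x. H x \<xi>) =
       quad_error p P w (\<lambda>x. (\<psi> \<xi> * c \<xi>) * cos (\<xi> \<bullet> x) + (\<psi> \<xi> * s \<xi>) * sin (\<xi> \<bullet> x))"
      by (simp add: H_def algebra_simps)
    also have "\<dots> = (\<psi> \<xi> * c \<xi>) * c \<xi> + (\<psi> \<xi> * s \<xi>) * s \<xi>"
      unfolding c_def s_def by (rule quad_error_lincomb[OF p pcs]) simp_all
    finally show ?thesis
      by (simp add: error_spectrum_def c_def s_def power2_eq_square algebra_simps)
  qed
  have "quad_error p P w (\<lambda>x. quad_error p P w (\<lambda>y. g (x - y))) = quad_error p P w (\<lambda>x. LBINT \<xi>. H x \<xi>)"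
    by (subst g_even) (simp add: A H_def[abs_def])
  also have "\<dots> = (LBINT \<xi>. \<psi> \<xi> * error_spectrum p P w \<xi>)"
    unfolding quad_error_integral(1)[OF p \<psi>W P Hm H_le] E ..
  finally show ?B .
  show ?C using quad_error_integral(2)[OF p \<psi>W P Hm H_le, of w] unfolding E .
qed

section \<open>A compactly supported bump with a decaying transform\<close>

lemma integrable_compact_support_bounded:
  fixes f :: "real \<Rightarrow> real"
  assumes [measurable]: "f \<in> borel_measurable borel" and le: "\<And>x. \<bar>f x\<bar> \<le> B" and supp: "\<And>x. \<bar>x\<bar> > L \<Longrightarrow> f x = 0"
  shows "integrable lborel f"
proof (rule Bochner_Integration.integrable_bound)
  show "integrable lborel (\<lambda>x. B * indicator {- L..L} x)"
    by (intro integrable_mult_right integrable_real_indicator) (auto simp: emeasure_lborel_Icc_eq)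
  have "\<bar>f x\<bar> \<le> \<bar>B * indicator {- L..L} x\<bar>" for x
    using le[of x] supp[of x] by (cases "\<bar>x\<bar> > L") (auto simp: indicator_def abs_le_iff)
  then show "AE x in lborel. norm (f x) \<le> norm (B * indicator {- L..L} x)" by simp
qed auto

lemma abs_integral_interval_cos_le:
  "\<bar>LBINT u. indicator {-1..1} u * cos (s * u)\<bar> \<le> 4 / (1 + \<bar>s::real\<bar>)"
proof -
  have i: "integrable lborel (indicator {-1..1::real} :: real \<Rightarrow> real)"
    by (intro integrable_real_indicator) auto
  have two: "\<bar>LBINT u. indicator {-1..1} u * cos (s * u)\<bar> \<le> 2"
  proof -
    have "\<bar>LBINT u. indicator {-1..1} u * cos (s * u)\<bar> \<le> (LBINT u. indicator {-1..1::real} u)"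
      by (rule integral_abs_bound_integral[OF integrable_mult_cos_sin(1)[OF i] i])
         (auto simp: indicator_def)
    then show ?thesis by simp
  qed
  show ?thesis
  proof (cases "\<bar>s\<bar> \<le> 1")
    case True
    then have "2 \<le> 4 / (1 + \<bar>s\<bar>)" by (simp add: field_simps)
    with two show ?thesis by linarith
  next
    case False
    then have s: "s \<noteq> 0" by auto
    have "(LBINT u. cos (s * u) * indicator {-1..1} u) = sin (s * 1) / s - sin (s * (-1)) / s"
      using s by (intro integral_FTC_Icc_real) (auto intro!: derivative_eq_intros continuous_intros)
    then have "\<bar>LBINT u. indicator {-1..1} u * cos (s * u)\<bar> = 2 * \<bar>sin s\<bar> / \<bar>s\<bar>"
      by (simp add: mult.commute abs_divide[symmetric] abs_mult)
    also have "\<dots> \<le> 2 / \<bar>s\<bar>" by (intro divide_right_mono) auto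
    also have "\<dots> \<le> 4 / (1 + \<bar>s\<bar>)" using False by (simp add: field_simps)
    finally show ?thesis .
  qed
qed

text \<open>
  Averaging over \<open>[-1, 1]\<close> multiplies the transform by that of the interval, which decays like \<open>1 / |s|\<close>.
  The lower bound near \<open>0\<close> survives because an interval of length \<open>1\<close> around any point of \<open>[-1/2, 1/2]\<close> lies in \<open>[-1, 1]\<close>.
\<close>

lemma smoothed_bump:
  fixes f :: "real \<Rightarrow> real"
  assumes cont: "continuous_on UNIV f" and f: "\<And>x. 0 \<le> f x" "\<And>x. f x \<le> B"
    and even: "\<And>x. f (- x) = f x" and supp: "\<And>x. \<bar>x\<bar> > L \<Longrightarrow> f x = 0"
    and low: "\<And>x. \<bar>x\<bar> \<le> 1/2 \<Longrightarrow> a \<le> f x"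
    and g_def: "\<And>x. g x = (LBINT u. indicator {-1..1} u * f (x - u))"
  shows "continuous_on UNIV g" "\<And>x. 0 \<le> g x" "\<And>x. g x \<le> 2 * B" "\<And>x. g (- x) = g x"
    and "\<And>x. \<bar>x\<bar> > L + 1 \<Longrightarrow> g x = 0" "\<And>x. \<bar>x\<bar> \<le> 1/2 \<Longrightarrow> a \<le> g x"
    and "\<And>s. (LBINT x. g x * cos (s * x)) =
           (LBINT u. indicator {-1..1} u * cos (s * u)) * (LBINT x. f x * cos (s * x))"
proof -
  have [measurable]: "f \<in> borel_measurable borel" using cont by (rule borel_measurable_continuous_onI)
  have ind: "integrable lborel (\<lambda>u. indicator {-1..1::real} u * c)" for c :: real
    by (intro integrable_mult_left integrable_real_indicator) auto
  have int: "integrable lborel (\<lambda>u. indicator {-1..1} u * f (x - u))" for x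
  proof (rule Bochner_Integration.integrable_bound[OF ind[of B]])
    show "AE u in lborel. norm (indicator {-1..1} u * f (x - u)) \<le> norm (indicator {-1..1} u * B)"
      using f order.trans[OF f] by (auto simp: indicator_def)
  qed simp
  show "continuous_on UNIV g"
    unfolding continuous_on_sequentially comp_def g_def
  proof (intro ballI allI impI, elim conjE)
    fix x :: real and X assume X: "X \<longlonglongrightarrow> x"
    show "(\<lambda>n. LBINT u. indicator {-1..1} u * f (X n - u)) \<longlonglongrightarrow> (LBINT u. indicator {-1..1} u * f (x - u))"
    proof (rule integral_dominated_convergence[where w="\<lambda>u. indicator {-1..1} u * B"])
      show "AE u in lborel. (\<lambda>n. indicator {-1..1} u * f (X n - u)) \<longlonglongrightarrow> indicator {-1..1} u * f (x - u)"
        by (intro AE_I2 tendsto_intros continuous_on_tendsto_compose[OF cont] X) auto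
    next
      show "AE u in lborel. norm (indicator {-1..1} u * f (X n - u)) \<le> indicator {-1..1} u * B" for n
        using f by (auto simp: indicator_def)
    qed (use ind in auto)
  qed
  show "0 \<le> g x" for x
    unfolding g_def by (intro integral_nonneg_AE) (auto simp: f)
  show "g x \<le> 2 * B" for x
  proof -
    have "g x \<le> (LBINT u. indicator {-1..1::real} u * B)"
      unfolding g_def by (rule integral_mono[OF int ind]) (auto simp: indicator_def f)
    then show ?thesis by simp
  qed
  show "g (- x) = g x" for x
  proof -
    have "g (- x) = \<bar>-1\<bar> *\<^sub>R (LBINT u. indicator {-1..1} (0 + (-1) * u) * f (- x - (0 + (-1) * u)))"
      unfolding g_def by (rule lborel_integral_real_affine) simp
    also have "\<dots> = (LBINT u. indicator {-1..1} u * f (x - u))"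
    proof -
      have "indicator {-1..1} (- u) = (indicator {-1..1} u :: real)" "f (u - x) = f (x - u)" for u
        using even[of "x - u"] by (auto simp: indicator_def)
      then show ?thesis by simp
    qed
    finally show ?thesis by (simp add: g_def)
  qed
  show "g x = 0" if "\<bar>x\<bar> > L + 1" for x
  proof -
    have "indicator {-1..1} u * f (x - u) = 0" for u
      using that by (cases "\<bar>u\<bar> \<le> 1") (auto simp: indicator_def intro!: supp)
    then show ?thesis unfolding g_def by (simp only: integral_zero)
  qed
  show "a \<le> g x" if "\<bar>x\<bar> \<le> 1/2" for x
  proof -
    have "integrable lborel (\<lambda>u. indicator {x - 1/2..x + 1/2} u * a)"
      by (intro integrable_mult_left integrable_real_indicator) auto
    then have "(LBINT u. indicator {x - 1/2..x + 1/2} u * a) \<le> g x"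
      unfolding g_def
    proof (rule integral_mono[OF _ int])
      fix u
      show "indicator {x - 1/2..x + 1/2} u * a \<le> indicator {-1..1} u * f (x - u)"
      proof (cases "u \<in> {x - 1/2..x + 1/2}")
        case True
        then have "\<bar>x - u\<bar> \<le> 1/2" by (intro abs_leI) auto
        moreover have "u \<in> {-1..1}" using that True by (auto simp: abs_le_iff)
        ultimately show ?thesis using True low[of "x - u"] by (simp add: indicator_def)
      qed (auto simp: indicator_def f)
    qed
    then show ?thesis by simp
  qed
  show "(LBINT x. g x * cos (s * x)) =
           (LBINT u. indicator {-1..1} u * cos (s * u)) * (LBINT x. f x * cos (s * x))" for s
  proof -
    have f_int: "integrable lborel f"
      by (rule integrable_compact_support_bounded[of _ B L]) (use f supp in auto)
    have "integrable (lborel \<Otimes>\<^sub>M lborel) (\<lambda>(u, x). indicator {-1..1} u * f (x - u) * cos (s * x))"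
    proof (rule integrable_pair_mult[where f="indicator {-1..1::real}" and g="\<lambda>x. B * indicator {- (L + 1)..L + 1} x"])
      show "integrable lborel (\<lambda>x. B * indicator {- (L + 1)..L + 1} x)"
        by (intro integrable_mult_right integrable_real_indicator) (auto simp: emeasure_lborel_Icc_eq)
      have "B \<ge> 0" using f order.trans by blast
      show "\<bar>case (u, x) of (u, x) \<Rightarrow> indicator {-1..1} u * f (x - u) * cos (s * x)\<bar>
           \<le> \<bar>indicator {-1..1} u\<bar> * \<bar>B * indicator {- (L + 1)..L + 1} x\<bar>" for u x
      proof (cases "\<bar>x - u\<bar> > L \<or> \<bar>u\<bar> > 1")
        case True
        then show ?thesis using supp[of "x - u"] by (auto simp: indicator_def)
      next
        case False
        then have "x \<in> {- (L + 1)..L + 1}" by auto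
        moreover have "\<bar>f (x - u) * cos (s * x)\<bar> \<le> B * 1"
          unfolding abs_mult using f \<open>B \<ge> 0\<close> by (intro mult_mono) auto
        ultimately show ?thesis using \<open>B \<ge> 0\<close> by (auto simp: indicator_def)
      qed
    qed (auto intro: integrable_real_indicator)
    note Fub = lborel_pair.Fubini_integral[OF this]
    have "(LBINT x. g x * cos (s * x)) = (LBINT x. (LBINT u. indicator {-1..1} u * f (x - u) * cos (s * x)))"
      by (simp add: g_def)
    also have "\<dots> = (LBINT u. (LBINT x. indicator {-1..1} u * f (x - u) * cos (s * x)))"
      by (rule Fub)
    also have "\<dots> = (LBINT u. indicator {-1..1} u * cos (s * u) * (LBINT x. f x * cos (s * x)))"
    proof (rule Bochner_Integration.integral_cong[OF refl])
      fix u :: real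
      have "(LBINT x. f (x - u) * cos (s * x)) = \<bar>1\<bar> *\<^sub>R (LBINT x. f (u + 1 * x - u) * cos (s * (u + 1 * x)))"
        by (rule lborel_integral_real_affine) simp
      also have "\<dots> = (LBINT x. cos (s * u) * (f x * cos (s * x)) - sin (s * u) * (f x * sin (s * x)))"
        by (simp add: algebra_simps cos_add)
      also have "\<dots> = cos (s * u) * (LBINT x. f x * cos (s * x)) - sin (s * u) * (LBINT x. f x * sin (s * x))"
        using integrable_mult_cos_sin[OF f_int, of "\<lambda>x. s * x"] by simp
      also have "(LBINT x. f x * sin (s * x)) = 0"
        using integral_even_mult_sin[OF f_int even, of s] by simp
      finally show "(LBINT x. indicator {-1..1} u * f (x - u) * cos (s * x)) =
          indicator {-1..1} u * cos (s * u) * (LBINT x. f x * cos (s * x))"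
        by (simp add: mult.assoc)
    qed
    finally show ?thesis by simp
  qed
qed

text \<open>
  Each averaging step of the previous lemma, applied to a hat function, gains one power of decay.
\<close>

lemma ex_bump_real:
  "\<exists>f B C. continuous_on UNIV f \<and> (\<forall>x. 0 \<le> f x \<and> f x \<le> (B::real)) \<and> (\<forall>x. f (- x) = f x) \<and>
     (\<forall>x. \<bar>x\<bar> > real n + 1 \<longrightarrow> f x = 0) \<and> (\<forall>x. \<bar>x\<bar> \<le> 1/2 \<longrightarrow> 1/2 \<le> f x) \<and>
     (\<forall>s::real. \<bar>LBINT x. f x * cos (s * x)\<bar> \<le> C / (1 + \<bar>s\<bar>) ^ n)"
proof (induction n)
  case 0
  let ?f = "\<lambda>x::real. max 0 (1 - \<bar>x\<bar>)"
  have i: "integrable lborel ?f"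
    by (rule integrable_compact_support_bounded[of _ 1 1]) auto
  have "\<bar>LBINT x. ?f x * cos (s * x)\<bar> \<le> (LBINT x. ?f x)" for s
    by (rule integral_abs_bound_integral[OF integrable_mult_cos_sin(1)[OF i] i])
       (auto simp: abs_mult mult_left_le)
  moreover have "continuous_on UNIV ?f" by (intro continuous_intros)
  ultimately show ?case
    by (intro exI[of _ ?f] exI[of _ 1] exI[of _ "LBINT x. ?f x"]) auto
next
  case (Suc n)
  then obtain f B C where f: "continuous_on UNIV f" "\<And>x. 0 \<le> f x" "\<And>x. f x \<le> (B::real)"
      "\<And>x. f (- x) = f x" "\<And>x. \<bar>x\<bar> > real n + 1 \<Longrightarrow> f x = 0" "\<And>x. \<bar>x\<bar> \<le> 1/2 \<Longrightarrow> 1/2 \<le> f x"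
      and C: "\<And>s::real. \<bar>LBINT x. f x * cos (s * x)\<bar> \<le> C / (1 + \<bar>s\<bar>) ^ n"
    by auto
  let ?g = "\<lambda>x. LBINT u. indicator {-1..1} u * f (x - u)"
  note g = smoothed_bump[where g = ?g, OF f refl]
  have FT: "(LBINT x. ?g x * cos (s * x)) =
      (LBINT u. indicator {-1..1} u * cos (s * u)) * (LBINT x. f x * cos (s * x))" for s
    by (rule g(7))
  have "\<bar>LBINT x. ?g x * cos (s * x)\<bar> \<le> (4 * C) / (1 + \<bar>s\<bar>) ^ Suc n" for s
  proof -
    have "\<bar>LBINT x. ?g x * cos (s * x)\<bar> \<le> (4 / (1 + \<bar>s\<bar>)) * (C / (1 + \<bar>s\<bar>) ^ n)"
      unfolding FT abs_mult by (intro mult_mono abs_integral_interval_cos_le C) auto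
    then show ?thesis by simp
  qed
  with g(1-6) show ?case
    by (intro exI[of _ ?g] exI[of _ "2 * B"] exI[of _ "4 * C"]) (auto simp: add_ac)
qed

lemma integrable_inverse_one_plus_square: "integrable lborel (\<lambda>s::real. 1 / (1 + s\<^sup>2))"
  using integrable_inverse_1_plus_square by (simp add: set_integrable_def inverse_eq_divide)

text \<open>
  This splits the Sobolev weight into coordinates, so that products of functions of one variable can be handled.
\<close>

lemma one_plus_norm_square_powr_le_prod:
  fixes x :: "'a::euclidean_space"
  assumes "r \<ge> 0"
  shows "(1 + (norm x)\<^sup>2) powr r \<le> (\<Prod>b\<in>Basis. (1 + (x \<bullet> b)\<^sup>2) powr r)"
proof -
  have "1 + (\<Sum>b\<in>B. (x \<bullet> b)\<^sup>2) \<le> (\<Prod>b\<in>B. (1 + (x \<bullet> b)\<^sup>2))" if "finite B" for B :: "'a set"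
    using that
  proof induction
    case (insert b B)
    have "1 + ((x \<bullet> b)\<^sup>2 + (\<Sum>b\<in>B. (x \<bullet> b)\<^sup>2)) \<le> (1 + (x \<bullet> b)\<^sup>2) * (1 + (\<Sum>b\<in>B. (x \<bullet> b)\<^sup>2))"
      by (simp add: algebra_simps sum_nonneg)
    also have "\<dots> \<le> (1 + (x \<bullet> b)\<^sup>2) * (\<Prod>b\<in>B. (1 + (x \<bullet> b)\<^sup>2))"
      by (intro mult_left_mono insert.IH) auto
    finally show ?case using insert by simp
  qed simp
  moreover have "(norm x)\<^sup>2 = (\<Sum>b\<in>Basis. (x \<bullet> b)\<^sup>2)"
    unfolding power2_norm_eq_inner using euclidean_inner[of x x] by (simp add: power2_eq_square)
  ultimately have "(1 + (norm x)\<^sup>2) powr r \<le> (\<Prod>b\<in>Basis. (1 + (x \<bullet> b)\<^sup>2)) powr r"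
    using assms by (intro powr_mono2) (auto simp: sum_nonneg)
  also have "\<dots> = (\<Prod>b\<in>Basis. (1 + (x \<bullet> b)\<^sup>2) powr r)"
    by (rule prod_powr_distrib)
  finally show ?thesis .
qed

text \<open>
  The product of one-dimensional bumps. Its transform is the product of the one-dimensional transforms, and
  \<open>n \<ge> r + 1\<close> averaging steps make the square of each factor, times \<open>(1 + s\<^sup>2) powr r\<close>, bounded by a multiple of \<open>1 / (1 + s\<^sup>2)\<close>.
\<close>

lemma ex_bump:
  fixes r :: real
  assumes r: "r \<ge> 0"
  shows "\<exists>(\<phi> :: 'a::euclidean_space \<Rightarrow> real) B L. continuous_on UNIV \<phi> \<and> integrable lborel \<phi> \<and>
    (\<forall>x. \<bar>\<phi> x\<bar> \<le> B) \<and> (\<forall>x. \<phi> (- x) = \<phi> x) \<and> \<phi> 0 = 1 \<and> L > 0 \<and> (\<forall>x. norm x \<ge> L \<longrightarrow> \<phi> x = 0) \<and>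
    integrable lborel (\<lambda>\<xi>. LBINT x. \<phi> x * cos (\<xi> \<bullet> x)) \<and>
    integrable lborel (\<lambda>\<xi>. (LBINT x. \<phi> x * cos (\<xi> \<bullet> x))\<^sup>2 * (1 + (norm \<xi>)\<^sup>2) powr r)"
proof -
  define n where "n = nat \<lceil>r\<rceil> + 2"
  have n: "r + 1 \<le> real n" "n \<ge> 2" using r by (auto simp: n_def) linarith
  obtain f B C where f: "continuous_on UNIV f" "\<And>x. 0 \<le> f x" "\<And>x. f x \<le> (B::real)"
      "\<And>x. f (- x) = f x" "\<And>x. \<bar>x\<bar> > real n + 1 \<Longrightarrow> f x = 0" "\<And>x. \<bar>x\<bar> \<le> 1/2 \<Longrightarrow> 1/2 \<le> f x"
      and C: "\<And>s::real. \<bar>LBINT x. f x * cos (s * x)\<bar> \<le> C / (1 + \<bar>s\<bar>) ^ n"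
    using ex_bump_real[of n] by auto
  have f0: "f 0 \<ge> 1/2" using f(6)[of 0] by simp
  define f1 where "f1 x = f x / f 0" for x
  have f1_cont: "continuous_on UNIV f1" unfolding f1_def using f(1) f0 by (intro continuous_intros) auto
  then have [measurable]: "f1 \<in> borel_measurable borel" by (rule borel_measurable_continuous_onI)
  have f1_even: "f1 (- x) = f1 x" for x by (simp add: f1_def f)
  have f1_le: "\<bar>f1 x\<bar> \<le> B / f 0" for x
    using f0 f(2,3)[of x] by (simp add: f1_def divide_right_mono)
  have f1_supp: "f1 x = 0" if "\<bar>x\<bar> > real n + 1" for x using f(5)[OF that] by (simp add: f1_def)
  have f1_int: "integrable lborel f1"
    by (rule integrable_compact_support_bounded[OF _ f1_le f1_supp]) auto
  define \<kappa> where "\<kappa> s = (LBINT u. f1 u * cos (s * u))" for s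
  define K where "K = C / f 0"
  have [measurable]: "\<kappa> \<in> borel_measurable borel" unfolding \<kappa>_def by measurable
  have \<kappa>_le: "\<bar>\<kappa> s\<bar> \<le> K / (1 + \<bar>s\<bar>) ^ n" for s
    using C[of s] f0 by (simp add: \<kappa>_def f1_def K_def abs_divide field_simps)
  have K0: "K \<ge> 0" using order.trans[OF abs_ge_zero \<kappa>_le[of 0]] by simp
  define \<phi> :: "'a \<Rightarrow> real" where "\<phi> = (\<lambda>x. \<Prod>b\<in>Basis. f1 (x \<bullet> b))"
  define L where "L = real DIM('a) * (real n + 1) + 1"
  have \<phi>_cont: "continuous_on UNIV \<phi>"
    unfolding \<phi>_def by (intro continuous_intros continuous_on_compose2[OF f1_cont]) auto
  have \<phi>_int: "integrable lborel \<phi>"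
    unfolding \<phi>_def by (rule integrable_prod_Basis[OF f1_int])
  have \<phi>_le: "\<bar>\<phi> x\<bar> \<le> (B / f 0) ^ DIM('a)" for x
  proof -
    have "(\<Prod>b\<in>Basis. \<bar>f1 (x \<bullet> b)\<bar>) \<le> (\<Prod>b\<in>(Basis::'a set). B / f 0)"
      by (intro prod_mono conjI f1_le abs_ge_zero)
    then show ?thesis by (simp add: \<phi>_def abs_prod)
  qed
  have \<phi>_even: "\<phi> (- x) = \<phi> x" for x by (simp add: \<phi>_def f1_even)
  have \<phi>_0: "\<phi> 0 = 1" using f0 by (auto simp: \<phi>_def f1_def)
  have \<phi>_supp: "\<phi> x = 0" if "norm x \<ge> L" for x
  proof -
    have "\<exists>b\<in>Basis. \<bar>x \<bullet> b\<bar> > real n + 1"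
    proof (rule ccontr)
      assume "\<not> (\<exists>b\<in>Basis. \<bar>x \<bullet> b\<bar> > real n + 1)"
      then have "(\<Sum>b\<in>Basis. \<bar>x \<bullet> b\<bar>) \<le> (\<Sum>b\<in>(Basis::'a set). real n + 1)"
        by (intro sum_mono) auto
      then show False using norm_le_l1[of x] that by (simp add: L_def)
    qed
    then show ?thesis unfolding \<phi>_def using f1_supp by (auto intro!: prod_zero)
  qed
  have \<phi>_hat: "(LBINT x. \<phi> x * cos (\<xi> \<bullet> x)) = (\<Prod>b\<in>Basis. \<kappa> (\<xi> \<bullet> b))" for \<xi>
  proof -
    have [measurable]: "(\<lambda>u. cis (s * u)) \<in> borel_measurable borel" for s :: real
      by (intro borel_measurable_continuous_onI continuous_intros)
    have i1: "integrable lborel (\<lambda>u. of_real (f1 u) * cis (s * u))" for s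
      by (rule Bochner_Integration.integrable_bound[OF f1_int]) (auto simp: norm_mult)
    have c1: "(LBINT u. of_real (f1 u) * cis (s * u)) = of_real (\<kappa> s)" for s
    proof (rule complex_eqI)
      show "Re (LBINT u. of_real (f1 u) * cis (s * u)) = Re (of_real (\<kappa> s))"
        by (subst integral_Re[OF i1, symmetric]) (simp add: \<kappa>_def)
      show "Im (LBINT u. of_real (f1 u) * cis (s * u)) = Im (of_real (\<kappa> s))"
        using integral_even_mult_sin[OF f1_int f1_even, of s]
        by (subst integral_Im[OF i1, symmetric]) simp
    qed
    have e: "of_real (\<phi> x) * cis (\<xi> \<bullet> x) = (\<Prod>b\<in>Basis. of_real (f1 (x \<bullet> b)) * cis ((\<xi> \<bullet> b) * (x \<bullet> b)))" for x
      unfolding \<phi>_def cis_inner_Basis by (simp add: prod.distrib)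
    have i: "integrable lborel (\<lambda>x. of_real (\<phi> x) * cis (\<xi> \<bullet> x))"
      unfolding e by (rule integrable_prod_Basis[OF i1])
    have "(LBINT x. \<phi> x * cos (\<xi> \<bullet> x)) = (LBINT x. Re (of_real (\<phi> x) * cis (\<xi> \<bullet> x)))"
      by simp
    also have "\<dots> = Re (LBINT x. of_real (\<phi> x) * cis (\<xi> \<bullet> x))"
      by (rule integral_Re[OF i])
    also have "(LBINT x. of_real (\<phi> x) * cis (\<xi> \<bullet> x)) = (\<Prod>b\<in>Basis. of_real (\<kappa> (\<xi> \<bullet> b)))"
      unfolding e by (subst integral_prod_Basis[OF i1]) (simp only: c1)
    also have "Re \<dots> = (\<Prod>b\<in>Basis. \<kappa> (\<xi> \<bullet> b))"
      unfolding of_real_prod[symmetric] by (rule Re_complex_of_real)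
    finally show ?thesis .
  qed
  have sq: "1 + s\<^sup>2 \<le> (1 + \<bar>s\<bar>)\<^sup>2" for s :: real by (simp add: power2_eq_square algebra_simps)
  have \<kappa>_le1: "\<bar>\<kappa> s\<bar> \<le> K * (1 / (1 + s\<^sup>2))" for s
  proof -
    have "1 + s\<^sup>2 \<le> (1 + \<bar>s\<bar>) ^ n"
      using sq[of s] n(2) by (intro order.trans[OF sq] power_increasing) auto
    then have "K / (1 + \<bar>s\<bar>) ^ n \<le> K / (1 + s\<^sup>2)"
      using K0 by (intro divide_left_mono) (auto simp: add_pos_nonneg intro!: mult_pos_pos)
    with \<kappa>_le[of s] show ?thesis by simp
  qed
  have \<kappa>_le2: "(\<kappa> s)\<^sup>2 * (1 + s\<^sup>2) powr r \<le> K\<^sup>2 * (1 / (1 + s\<^sup>2))" for s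
  proof -
    have p: "1 + s\<^sup>2 > 0" "1 + s\<^sup>2 \<ge> 1" by (auto simp: add_pos_nonneg)
    have "\<bar>\<kappa> s\<bar>\<^sup>2 \<le> (K / (1 + \<bar>s\<bar>) ^ n)\<^sup>2" by (intro power_mono \<kappa>_le) auto
    also have "\<dots> = K\<^sup>2 / ((1 + \<bar>s\<bar>)\<^sup>2) ^ n" by (simp add: power_divide power_mult[symmetric] mult.commute)
    also have "\<dots> \<le> K\<^sup>2 / (1 + s\<^sup>2) ^ n"
      using p by (intro divide_left_mono power_mono sq) (auto intro!: mult_pos_pos zero_less_power simp: add_pos_nonneg)
    also have "(1 + s\<^sup>2) ^ n = (1 + s\<^sup>2) powr n" by (rule powr_realpow[OF p(1), symmetric])
    also have "K\<^sup>2 / (1 + s\<^sup>2) powr n \<le> K\<^sup>2 / (1 + s\<^sup>2) powr (r + 1)"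
      using p n by (intro divide_left_mono powr_mono) (auto intro!: mult_pos_pos simp: add_nonneg_eq_0_iff)
    finally have "(\<kappa> s)\<^sup>2 * (1 + s\<^sup>2) powr r \<le> K\<^sup>2 / (1 + s\<^sup>2) powr (r + 1) * (1 + s\<^sup>2) powr r"
      by (intro mult_right_mono) auto
    also have "\<dots> = K\<^sup>2 * (1 / (1 + s\<^sup>2))"
      using p by (simp add: powr_add)
    finally show ?thesis .
  qed
  have int1: "integrable lborel (\<lambda>\<xi>::'a. \<Prod>b\<in>Basis. \<kappa> (\<xi> \<bullet> b))"
  proof (rule Bochner_Integration.integrable_bound)
    show "integrable lborel (\<lambda>\<xi>::'a. \<Prod>b\<in>Basis. K * (1 / (1 + (\<xi> \<bullet> b)\<^sup>2)))"
      by (intro integrable_prod_Basis[where f="\<lambda>b s. K * (1 / (1 + s\<^sup>2))"] integrable_mult_right integrable_inverse_one_plus_square)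
    show "AE \<xi> in lborel. norm (\<Prod>b\<in>Basis. \<kappa> (\<xi> \<bullet> b)) \<le> norm (\<Prod>b\<in>(Basis::'a set). K * (1 / (1 + (\<xi> \<bullet> b)\<^sup>2)))"
      unfolding real_norm_def abs_prod
      by (intro AE_I2 prod_mono conjI order.trans[OF \<kappa>_le1 abs_ge_self]) auto
  qed auto
  have int2: "integrable lborel (\<lambda>\<xi>::'a. (\<Prod>b\<in>Basis. \<kappa> (\<xi> \<bullet> b))\<^sup>2 * (1 + (norm \<xi>)\<^sup>2) powr r)"
  proof (rule Bochner_Integration.integrable_bound)
    show "integrable lborel (\<lambda>\<xi>::'a. \<Prod>b\<in>Basis. K\<^sup>2 * (1 / (1 + (\<xi> \<bullet> b)\<^sup>2)))"
      by (intro integrable_prod_Basis[where f="\<lambda>b s. K\<^sup>2 * (1 / (1 + s\<^sup>2))"] integrable_mult_right integrable_inverse_one_plus_square)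
    have "(\<Prod>b\<in>Basis. \<kappa> (\<xi> \<bullet> b))\<^sup>2 * (1 + (norm \<xi>)\<^sup>2) powr r \<le> (\<Prod>b\<in>(Basis::'a set). K\<^sup>2 * (1 / (1 + (\<xi> \<bullet> b)\<^sup>2)))" for \<xi>
    proof -
      have "(\<Prod>b\<in>Basis. \<kappa> (\<xi> \<bullet> b))\<^sup>2 * (1 + (norm \<xi>)\<^sup>2) powr r \<le>
         (\<Prod>b\<in>Basis. \<kappa> (\<xi> \<bullet> b))\<^sup>2 * (\<Prod>b\<in>Basis. (1 + (\<xi> \<bullet> b)\<^sup>2) powr r)"
        by (intro mult_left_mono one_plus_norm_square_powr_le_prod r) auto
      also have "\<dots> = (\<Prod>b\<in>Basis. (\<kappa> (\<xi> \<bullet> b))\<^sup>2 * (1 + (\<xi> \<bullet> b)\<^sup>2) powr r)"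
        by (simp only: prod.distrib prod_power_distrib)
      also have "\<dots> \<le> (\<Prod>b\<in>(Basis::'a set). K\<^sup>2 * (1 / (1 + (\<xi> \<bullet> b)\<^sup>2)))"
        by (intro prod_mono conjI \<kappa>_le2) auto
      finally show ?thesis .
    qed
    then show "AE \<xi> in lborel. norm ((\<Prod>b\<in>Basis. \<kappa> (\<xi> \<bullet> b))\<^sup>2 * (1 + (norm \<xi>)\<^sup>2) powr r)
        \<le> norm (\<Prod>b\<in>(Basis::'a set). K\<^sup>2 * (1 / (1 + (\<xi> \<bullet> b)\<^sup>2)))"
      by (auto intro!: order.trans[OF _ abs_ge_self])
  qed auto
  have "L > 0" by (simp add: L_def add_nonneg_pos)
  then show ?thesis
    using \<phi>_cont \<phi>_int \<phi>_le \<phi>_even \<phi>_0 \<phi>_supp int1 int2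
    by (intro exI[of _ \<phi>] exI[of _ "(B / f 0) ^ DIM('a)"] exI[of _ L]) (auto simp: \<phi>_hat)
qed

section \<open>Local quadrature with polynomial exactness\<close>

text \<open>
  Neumann series: with \<open>R = 1 - A\<close> of row-sum norm at most \<open>1/2\<close>, the solution is \<open>\<Sum> R\<^sup>k b\<close>.
\<close>

lemma solve_near_identity:
  fixes A :: "'g \<Rightarrow> 'g \<Rightarrow> real"
  assumes G: "finite G"
    and A: "\<And>\<beta>. \<beta> \<in> G \<Longrightarrow> (\<Sum>\<gamma>\<in>G. \<bar>(if \<beta> = \<gamma> then 1 else 0) - A \<beta> \<gamma>\<bar>) \<le> 1 / 2"
    and b: "\<And>\<beta>. \<beta> \<in> G \<Longrightarrow> \<bar>b \<beta>\<bar> \<le> m"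
  shows "\<exists>a. (\<forall>\<gamma>\<in>G. \<bar>a \<gamma>\<bar> \<le> 2 * m) \<and> (\<forall>\<beta>\<in>G. (\<Sum>\<gamma>\<in>G. A \<beta> \<gamma> * a \<gamma>) = b \<beta>)"
proof -
  define R where "R \<beta> \<gamma> = (if \<beta> = \<gamma> then 1 else 0) - A \<beta> \<gamma>" for \<beta> \<gamma>
  define v where "v k = ((\<lambda>u \<beta>. \<Sum>\<gamma>\<in>G. R \<beta> \<gamma> * u \<gamma>) ^^ k) b" for k
  have v_Suc: "v (Suc k) \<beta> = (\<Sum>\<gamma>\<in>G. R \<beta> \<gamma> * v k \<gamma>)" for k \<beta>
    by (simp add: v_def)
  have v_le: "\<bar>v k \<beta>\<bar> \<le> m * (1 / 2) ^ k" if "\<beta> \<in> G" for k \<beta>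
    using that
  proof (induction k arbitrary: \<beta>)
    case 0
    then show ?case using b by (simp add: v_def)
  next
    case (Suc k)
    have m: "0 \<le> m * (1 / 2) ^ k" using Suc.IH[OF Suc.prems] by (rule order.trans[OF abs_ge_zero])
    have "\<bar>v (Suc k) \<beta>\<bar> \<le> (\<Sum>\<gamma>\<in>G. \<bar>R \<beta> \<gamma>\<bar> * (m * (1 / 2) ^ k))"
      unfolding v_Suc by (intro order.trans[OF sum_abs] sum_mono) (simp add: abs_mult mult_left_mono Suc.IH)
    also have "\<dots> = (\<Sum>\<gamma>\<in>G. \<bar>R \<beta> \<gamma>\<bar>) * (m * (1 / 2) ^ k)" by (simp add: sum_distrib_right)
    also have "\<dots> \<le> 1 / 2 * (m * (1 / 2) ^ k)"
      using A[OF Suc.prems] m unfolding R_def by (intro mult_right_mono)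
    finally show ?case by simp
  qed
  have geo: "(\<lambda>k. m * (1 / 2) ^ k) sums (m * 2)"
    using geometric_sums[of "1 / 2 :: real"] by (intro sums_mult) simp
  have sm: "summable (\<lambda>k. v k \<gamma>)" if "\<gamma> \<in> G" for \<gamma>
    by (rule summable_comparison_test'[OF sums_summable[OF geo], of 0]) (use v_le[OF that] in auto)
  define a where "a \<gamma> = (\<Sum>k. v k \<gamma>)" for \<gamma>
  have "\<bar>a \<gamma>\<bar> \<le> 2 * m" if "\<gamma> \<in> G" for \<gamma>
  proof -
    have s1: "summable (\<lambda>k. \<bar>v k \<gamma>\<bar>)"
      by (rule summable_comparison_test'[OF sums_summable[OF geo], of 0]) (use v_le[OF that] in auto)
    have "\<bar>a \<gamma>\<bar> \<le> (\<Sum>k. \<bar>v k \<gamma>\<bar>)" unfolding a_def by (rule summable_rabs[OF s1])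
    also have "\<dots> \<le> (\<Sum>k. m * (1 / 2) ^ k)"
      by (rule suminf_le[OF v_le[OF that] s1 sums_summable[OF geo]])
    also have "\<dots> = 2 * m" using sums_unique[OF geo] by simp
    finally show ?thesis .
  qed
  moreover have "(\<Sum>\<gamma>\<in>G. A \<beta> \<gamma> * a \<gamma>) = b \<beta>" if \<beta>: "\<beta> \<in> G" for \<beta>
  proof -
    have "(\<Sum>\<gamma>\<in>G. R \<beta> \<gamma> * a \<gamma>) = (\<Sum>\<gamma>\<in>G. \<Sum>k. R \<beta> \<gamma> * v k \<gamma>)"
      unfolding a_def by (intro sum.cong refl suminf_mult[symmetric] sm)
    also have "\<dots> = (\<Sum>k. \<Sum>\<gamma>\<in>G. R \<beta> \<gamma> * v k \<gamma>)"
      by (rule suminf_sum[symmetric]) (intro summable_mult sm)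
    also have "\<dots> = (\<Sum>k. v (Suc k) \<beta>)" by (simp add: v_Suc)
    also have "\<dots> = a \<beta> - b \<beta>"
      using suminf_split_head[OF sm[OF \<beta>]] by (simp add: a_def v_def)
    finally have "(\<Sum>\<gamma>\<in>G. R \<beta> \<gamma> * a \<gamma>) = a \<beta> - b \<beta>" .
    moreover have "(\<Sum>\<gamma>\<in>G. R \<beta> \<gamma> * a \<gamma>) = a \<beta> - (\<Sum>\<gamma>\<in>G. A \<beta> \<gamma> * a \<gamma>)"
      unfolding R_def using \<beta> G by (simp add: left_diff_distrib sum_subtractf if_distrib[of "\<lambda>x. x * _"] sum.delta cong: if_cong)
    ultimately show ?thesis by simp
  qed
  ultimately show ?thesis by blast
qed

text \<open>
  The Lagrange polynomial for the node \<open>i\<close> among the nodes \<open>0, \<dots>, N\<close>.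
\<close>

definition lagrange_basis :: "nat \<Rightarrow> nat \<Rightarrow> real \<Rightarrow> real" where
  "lagrange_basis N i u = (\<Prod>j\<in>{..N} - {i}. (u - real j) / (real i - real j))"

lemma lagrange_basis_node:
  assumes "k \<le> N"
  shows "lagrange_basis N i (real k) = (if i = k then 1 else 0)"
proof (cases "i = k")
  case True
  then show ?thesis by (auto simp: lagrange_basis_def intro!: prod.neutral)
next
  case False
  then have "k \<in> {..N} - {i}" using assms by auto
  then show ?thesis using False by (auto simp: lagrange_basis_def intro!: prod_zero)
qed

lemma lagrange_interpolation_exact:
  assumes q: "degree q \<le> N"
  shows "poly q u = (\<Sum>i\<le>N. poly q (real i) * lagrange_basis N i u)"
proof -
  define l :: "nat \<Rightarrow> real poly" where
    "l i = (\<Prod>j\<in>{..N} - {i}. Polynomial.smult (1 / (real i - real j)) [:- real j, 1:])" for i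
  have l: "poly (l i) u = lagrange_basis N i u" for i u
    unfolding l_def lagrange_basis_def poly_prod by (intro prod.cong) (auto simp: diff_divide_distrib)
  have "degree (l i) \<le> N" if "i \<le> N" for i
  proof -
    have "degree (l i) \<le> (\<Sum>j\<in>{..N} - {i}. degree (Polynomial.smult (1 / (real i - real j)) [:- real j, 1:]))"
      unfolding l_def by (rule order.trans[OF degree_prod_sum_le]) (simp_all add: comp_def)
    also have "\<dots> \<le> (\<Sum>j\<in>{..N} - {i}. 1)" by (intro sum_mono) simp
    also have "\<dots> = N" using that by simp
    finally show ?thesis .
  qed
  then have deg: "degree (\<Sum>i\<le>N. Polynomial.smult (poly q (real i)) (l i)) \<le> N"
    by (intro degree_sum_le) (auto intro: order.trans[OF degree_smult_le])
  have "q = (\<Sum>i\<le>N. Polynomial.smult (poly q (real i)) (l i))"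
  proof (rule poly_eqI_degree[where A = "real ` {..N}"])
    have c: "card (real ` {..N}) = N + 1" by (subst card_image) (auto simp: inj_on_def)
    show "degree q < card (real ` {..N})" "degree (\<Sum>i\<le>N. Polynomial.smult (poly q (real i)) (l i)) < card (real ` {..N})"
      using q deg c by auto
    fix x assume "x \<in> real ` {..N}"
    then obtain k where "k \<le> N" "x = real k" by auto
    then show "poly q x = poly (\<Sum>i\<le>N. Polynomial.smult (poly q (real i)) (l i)) x"
      by (simp add: poly_sum l lagrange_basis_node if_distrib sum.delta cong: if_cong)
  qed
  then have "poly q u = poly (\<Sum>i\<le>N. Polynomial.smult (poly q (real i)) (l i)) u" by simp
  then show ?thesis by (simp add: poly_sum l)
qed

text \<open>
  Products of polynomials in the separate coordinates. Gaussians factor over the coordinates, so these products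
  approximate them well, and general multivariate polynomials are avoided.
\<close>

definition tensor_poly :: "('a::euclidean_space \<Rightarrow> real poly) \<Rightarrow> 'a \<Rightarrow> real" where
  "tensor_poly \<pi> x = (\<Prod>b\<in>Basis. poly (\<pi> b) (x \<bullet> b))"

definition grid :: "nat \<Rightarrow> ('a::euclidean_space \<Rightarrow> nat) set" where
  "grid N = Pi\<^sub>E Basis (\<lambda>_. {..N})"

definition grid_point :: "('a::euclidean_space \<Rightarrow> nat) \<Rightarrow> 'a" where
  "grid_point \<gamma> = (\<Sum>b\<in>Basis. real (\<gamma> b) *\<^sub>R b)"

definition tensor_lagrange :: "nat \<Rightarrow> ('a::euclidean_space \<Rightarrow> nat) \<Rightarrow> 'a \<Rightarrow> real" where
  "tensor_lagrange N \<beta> x = (\<Prod>b\<in>Basis. lagrange_basis N (\<beta> b) (x \<bullet> b))"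

lemma finite_grid [simp]: "finite (grid N)"
  by (simp add: grid_def finite_PiE)

lemma grid_point_inner: "b \<in> Basis \<Longrightarrow> grid_point \<gamma> \<bullet> b = real (\<gamma> b)"
  by (simp add: grid_point_def inner_sum_left_Basis)

lemma norm_grid_point_le: "\<gamma> \<in> grid N \<Longrightarrow> norm (grid_point \<gamma> :: 'a::euclidean_space) \<le> real N * DIM('a)"
proof -
  assume \<gamma>: "\<gamma> \<in> grid N"
  have "norm (grid_point \<gamma> :: 'a) \<le> (\<Sum>b\<in>(Basis::'a set). real N)"
    unfolding grid_point_def
  proof (rule order.trans[OF norm_sum sum_mono])
    fix b :: 'a assume "b \<in> Basis"
    then show "norm (real (\<gamma> b) *\<^sub>R b) \<le> real N" using \<gamma> by (auto simp: grid_def)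
  qed
  then show ?thesis by (simp add: mult.commute)
qed

lemma tensor_lagrange_node:
  assumes "\<beta> \<in> grid N" "\<gamma> \<in> grid N"
  shows "tensor_lagrange N \<beta> (grid_point \<gamma> :: 'a::euclidean_space) = (if \<beta> = \<gamma> then 1 else 0)"
proof -
  have *: "tensor_lagrange N \<beta> (grid_point \<gamma> :: 'a) = (\<Prod>b\<in>Basis. if \<beta> b = \<gamma> b then 1 else 0)"
    unfolding tensor_lagrange_def
    by (intro prod.cong refl) (use assms in \<open>auto simp: grid_point_inner lagrange_basis_node grid_def PiE_iff\<close>)
  show ?thesis
  proof (cases "\<beta> = \<gamma>")
    case True
    then show ?thesis using * by simp
  next
    case False
    then have "\<exists>b\<in>Basis. \<beta> b \<noteq> \<gamma> b"
      using assms unfolding grid_def by (metis PiE_ext)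
    then show ?thesis using False * by (auto intro!: prod_zero)
  qed
qed

lemma continuous_on_tensor_lagrange: "continuous_on S (tensor_lagrange N \<beta>)"
  unfolding tensor_lagrange_def[abs_def] lagrange_basis_def by (intro continuous_intros) auto

lemma tensor_interpolation_exact:
  fixes x :: "'a::euclidean_space"
  assumes "\<And>b. b \<in> Basis \<Longrightarrow> degree (\<pi> b) \<le> N"
  shows "tensor_poly \<pi> x = (\<Sum>\<beta>\<in>grid N. tensor_poly \<pi> (grid_point \<beta>) * tensor_lagrange N \<beta> x)"
proof -
  have "tensor_poly \<pi> x = (\<Prod>b\<in>Basis. \<Sum>i\<in>{..N}. poly (\<pi> b) (real i) * lagrange_basis N i (x \<bullet> b))"
    unfolding tensor_poly_def using assms by (intro prod.cong refl lagrange_interpolation_exact)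
  also have "\<dots> = (\<Sum>\<beta>\<in>grid N. \<Prod>b\<in>Basis. poly (\<pi> b) (real (\<beta> b)) * lagrange_basis N (\<beta> b) (x \<bullet> b))"
    unfolding grid_def by (rule prod_sum_PiE) auto
  also have "\<dots> = (\<Sum>\<beta>\<in>grid N. tensor_poly \<pi> (grid_point \<beta>) * tensor_lagrange N \<beta> x)"
    by (simp add: tensor_poly_def tensor_lagrange_def prod.distrib grid_point_inner)
  finally show ?thesis .
qed

text \<open>
  At the grid points themselves the matrix of the Lagrange functions is the identity; continuity keeps it near the
  identity at perturbed nodes.
\<close>

lemma tensor_lagrange_perturbed_nodes:
  "\<exists>\<delta>>0. \<forall>z. (\<forall>\<gamma>\<in>grid N. norm (z \<gamma> - (grid_point \<gamma> :: 'a::euclidean_space)) \<le> \<delta>) \<longrightarrow>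
     (\<forall>\<beta>\<in>grid N. (\<Sum>\<gamma>\<in>grid N. \<bar>(if \<beta> = \<gamma> then 1 else 0) - tensor_lagrange N \<beta> (z \<gamma>)\<bar>) \<le> 1 / 2)"
proof -
  let ?G = "grid N :: ('a \<Rightarrow> nat) set"
  define e where "e = 1 / (2 * (real (card ?G) + 1))"
  have e: "e > 0" "real (card ?G) * e \<le> 1 / 2" by (auto simp: e_def field_simps)
  let ?ok = "\<lambda>\<beta> \<gamma> d. \<forall>y. norm (y - (grid_point \<gamma> :: 'a)) \<le> d \<longrightarrow> \<bar>(if \<beta> = \<gamma> then 1 else 0) - tensor_lagrange N \<beta> y\<bar> \<le> e"
  have "eventually (?ok \<beta> \<gamma>) (at_right 0)" if "\<beta> \<in> ?G" "\<gamma> \<in> ?G" for \<beta> \<gamma>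
  proof -
    have "isCont (tensor_lagrange N \<beta>) (grid_point \<gamma> :: 'a)"
      using continuous_on_tensor_lagrange[of UNIV N \<beta>] by (simp add: continuous_on_eq_continuous_at)
    then obtain d where d: "d > 0" "\<And>y. dist y (grid_point \<gamma>) < d \<Longrightarrow>
        dist (tensor_lagrange N \<beta> y) (tensor_lagrange N \<beta> (grid_point \<gamma> :: 'a)) < e"
      using e(1) unfolding continuous_at_eps_delta by blast
    show ?thesis
      unfolding eventually_at_right_field
    proof (intro exI[of _ d] conjI allI impI d)
      fix t y assume "0 < t" "t < d" "norm (y - (grid_point \<gamma> :: 'a)) \<le> t"
      then show "\<bar>(if \<beta> = \<gamma> then 1 else 0) - tensor_lagrange N \<beta> y\<bar> \<le> e"
        using d(2)[of y] tensor_lagrange_node[OF that] by (simp add: dist_norm abs_minus_commute)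
    qed
  qed
  then have "eventually (\<lambda>d. \<forall>\<beta>\<in>?G. \<forall>\<gamma>\<in>?G. ?ok \<beta> \<gamma> d) (at_right 0)"
    by (intro eventually_ball_finite ballI) auto
  then have "eventually (\<lambda>d. d > 0 \<and> (\<forall>\<beta>\<in>?G. \<forall>\<gamma>\<in>?G. ?ok \<beta> \<gamma> d)) (at_right 0)"
    by (intro eventually_conj eventually_at_right_less)
  then obtain d where d: "d > 0" "\<And>\<beta> \<gamma>. \<beta> \<in> ?G \<Longrightarrow> \<gamma> \<in> ?G \<Longrightarrow> ?ok \<beta> \<gamma> d"
    using eventually_happens'[OF trivial_limit_at_right_real] by blast
  show ?thesis
  proof (intro exI[of _ d] conjI allI impI ballI d(1))
    fix z \<beta> assume z: "\<forall>\<gamma>\<in>?G. norm (z \<gamma> - grid_point \<gamma>) \<le> d" and \<beta>: "\<beta> \<in> ?G"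
    have "(\<Sum>\<gamma>\<in>?G. \<bar>(if \<beta> = \<gamma> then 1 else 0) - tensor_lagrange N \<beta> (z \<gamma>)\<bar>) \<le> (\<Sum>\<gamma>\<in>?G. e)"
      using z d(2)[OF \<beta>] by (intro sum_mono) blast
    then show "(\<Sum>\<gamma>\<in>?G. \<bar>(if \<beta> = \<gamma> then 1 else 0) - tensor_lagrange N \<beta> (z \<gamma>)\<bar>) \<le> 1 / 2"
      using e(2) by simp
  qed
qed

lemma tensor_lagrange_bounded:
  "\<exists>C>0. \<forall>\<beta>\<in>grid N. \<forall>y::'a::euclidean_space. norm y \<le> D \<longrightarrow> \<bar>tensor_lagrange N \<beta> y\<bar> \<le> C"
proof -
  have "bounded (\<Union>\<beta>\<in>grid N. tensor_lagrange N \<beta> ` cball (0::'a) D)"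
    by (intro bounded_UN finite_grid ballI compact_imp_bounded compact_continuous_image
        continuous_on_tensor_lagrange compact_cball)
  then obtain C where "C > 0" "\<forall>v\<in>(\<Union>\<beta>\<in>grid N. tensor_lagrange N \<beta> ` cball (0::'a) D). norm v \<le> C"
    using bounded_pos by blast
  then show ?thesis by (intro exI[of _ C]) auto
qed

text \<open>
  Around the axis of a cone with half-angle \<open>\<theta>\<close>, at distance \<open>T\<close> from the apex, there is room for a ball of radius
  proportional to \<open>T\<close>. Balls are more convenient than cones since axis-parallel grids fit in them, whatever the
  direction of the cone.
\<close>

lemma cone_contains_balls:
  fixes \<Omega> :: "'a::euclidean_space set"
  assumes \<theta>: "0 < \<theta>" "\<theta> < pi / 2" and R: "R > 0"
    and cone: "\<forall>x\<in>\<Omega>. \<exists>\<xi>. norm \<xi> = 1 \<and>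
           {x + t *\<^sub>R y | y t. norm y = 1 \<and> y \<bullet> \<xi> \<ge> cos \<theta> \<and> 0 \<le> t \<and> t \<le> R} \<subseteq> \<Omega>"
  shows "\<exists>\<kappa> T0. 0 < \<kappa> \<and> \<kappa> < 1 \<and> T0 > 0 \<and>
     (\<forall>x\<in>\<Omega>. \<forall>T. 0 < T \<and> T \<le> T0 \<longrightarrow> (\<exists>y. norm (y - x) = T \<and> cball y (\<kappa> * T) \<subseteq> \<Omega>))"
proof -
  \<comment> \<open>A perturbation of relative size \<open>\<kappa>\<close> keeps the cosine at or above \<open>(1 - \<kappa>) / (1 + \<kappa>)\<close>, which equals \<open>cos \<theta>\<close>.\<close>
  define \<kappa> where "\<kappa> = (1 - cos \<theta>) / (1 + cos \<theta>)"
  have c: "cos \<theta> > 0" using \<theta> by (intro cos_gt_zero_pi) auto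
  have "cos \<theta> < cos 0" using \<theta> by (intro cos_monotone_0_pi) auto
  then have c1: "cos \<theta> < 1" by simp
  have \<kappa>: "0 < \<kappa>" "\<kappa> < 1" "cos \<theta> * (1 + \<kappa>) = 1 - \<kappa>"
    using c c1 by (auto simp: \<kappa>_def field_simps)
  have "\<exists>y. norm (y - x) = T \<and> cball y (\<kappa> * T) \<subseteq> \<Omega>" if x: "x \<in> \<Omega>" and T: "0 < T" "T \<le> R / 2" for x T
  proof -
    obtain \<xi> where \<xi>: "norm \<xi> = 1"
        "{x + t *\<^sub>R y | y t. norm y = 1 \<and> y \<bullet> \<xi> \<ge> cos \<theta> \<and> 0 \<le> t \<and> t \<le> R} \<subseteq> \<Omega>"
      using bspec[OF cone x] by blast
    have "u \<in> \<Omega>" if u: "u \<in> cball (x + T *\<^sub>R \<xi>) (\<kappa> * T)" for u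
    proof -
      define e where "e = u - (x + T *\<^sub>R \<xi>)"
      define v where "v = u - x"
      have v: "v = T *\<^sub>R \<xi> + e" by (simp add: v_def e_def)
      have e: "norm e \<le> \<kappa> * T" using u by (simp add: e_def dist_norm norm_minus_commute)
      have nv: "norm v \<le> T * (1 + \<kappa>)"
        unfolding v using norm_triangle_ineq[of "T *\<^sub>R \<xi>" e] e \<xi>(1) T by (simp add: algebra_simps)
      have "\<bar>e \<bullet> \<xi>\<bar> \<le> \<kappa> * T"
        using Cauchy_Schwarz_ineq2[of e \<xi>] e \<xi>(1) by simp
      moreover have "v \<bullet> \<xi> = T + e \<bullet> \<xi>"
        using \<xi>(1) by (simp add: v inner_add_left power2_norm_eq_inner[symmetric])
      ultimately have "v \<bullet> \<xi> \<ge> T * (1 - \<kappa>)" by (simp add: algebra_simps)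
      moreover have "T * (1 - \<kappa>) = cos \<theta> * (T * (1 + \<kappa>))" using \<kappa>(3) by (simp add: mult_ac)
      moreover have "cos \<theta> * (T * (1 + \<kappa>)) \<ge> cos \<theta> * norm v" using nv c by (intro mult_left_mono) auto
      moreover have "T * (1 - \<kappa>) > 0" using T \<kappa> by simp
      ultimately have vv: "v \<bullet> \<xi> \<ge> cos \<theta> * norm v" "v \<bullet> \<xi> > 0" by linarith+
      then have "v \<noteq> 0" by auto
      then have nv0: "norm v > 0" by simp
      have "T * (1 + \<kappa>) \<le> R" using T \<kappa> mult_mono[of T "R / 2" "1 + \<kappa>" 2] by simp
      then have vR: "norm v \<le> R" using nv by linarith
      have w1: "cos \<theta> \<le> ((1 / norm v) *\<^sub>R v) \<bullet> \<xi>" using vv nv0 by (simp add: field_simps)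
      have w2: "norm ((1 / norm v) *\<^sub>R v) = 1" using nv0 by simp
      have w3: "u = x + norm v *\<^sub>R ((1 / norm v) *\<^sub>R v)" using nv0 by (simp add: v_def)
      have "u \<in> {x + t *\<^sub>R y | y t. norm y = 1 \<and> y \<bullet> \<xi> \<ge> cos \<theta> \<and> 0 \<le> t \<and> t \<le> R}"
        using w1 w2 w3 vR norm_ge_zero[of v] by blast
      then show ?thesis using \<xi>(2) by blast
    qed
    then have "cball (x + T *\<^sub>R \<xi>) (\<kappa> * T) \<subseteq> \<Omega>" by blast
    moreover have "norm (x + T *\<^sub>R \<xi> - x) = T" using \<xi>(1) T by simp
    ultimately show ?thesis by blast
  qed
  then show ?thesis using \<kappa> R by (intro exI[of _ \<kappa>] exI[of _ "R / 2"]) auto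
qed

abbreviation local_rule ::
  "'a::euclidean_space set \<Rightarrow> nat \<Rightarrow> real \<Rightarrow> real \<Rightarrow> 'a \<Rightarrow> ('a \<Rightarrow> real) \<Rightarrow> ('a \<Rightarrow> real) \<Rightarrow> bool" where
  "local_rule P N C s x0 \<rho> A \<equiv> (\<forall>x. A x \<noteq> 0 \<longrightarrow> norm (x - x0) \<le> s) \<and>
     (\<Sum>x\<in>P. \<bar>A x\<bar>) \<le> C * (LBINT x. \<rho> x) \<and>
     (\<forall>\<pi>. (\<forall>b\<in>Basis. degree (\<pi> b) \<le> N) \<longrightarrow>
        (\<Sum>x\<in>P. A x * tensor_poly \<pi> x) = (LBINT x. \<rho> x * tensor_poly \<pi> x))"

text \<open>
  For a mass distribution \<open>\<rho>\<close> in the ball of radius \<open>h\<close> around \<open>x0\<close>, weights on nearby nodes that integrate all tensor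
  polynomials of bounded degree exactly, with total variation bounded by the mass. All constants are independent
  of \<open>h\<close>: after scaling by the grid spacing \<open>s = h / \<delta>\<close> the nodes are within \<open>\<delta>\<close> of an integer grid, and the mass
  lies within a fixed distance \<open>D\<close> of its origin.
\<close>

lemma local_quadrature:
  fixes \<Omega> :: "'a::euclidean_space set"
  assumes \<kappa>: "0 < \<kappa>" "\<kappa> < 1" and T0: "T0 > 0"
    and balls: "\<forall>x\<in>\<Omega>. \<forall>T. 0 < T \<and> T \<le> T0 \<longrightarrow> (\<exists>y. norm (y - x) = T \<and> cball y (\<kappa> * T) \<subseteq> \<Omega>)"
    and N: "N \<ge> 1"
  shows "\<exists>C c h0. C > 0 \<and> c \<ge> 1 \<and> h0 > 0 \<and> (\<forall>P h x0 \<rho>. finite P \<longrightarrow> 0 < h \<longrightarrow> h \<le> h0 \<longrightarrow>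
     (\<forall>x\<in>\<Omega>. \<exists>y\<in>P. norm (x - y) \<le> h) \<longrightarrow> x0 \<in> \<Omega> \<longrightarrow>
     integrable lborel \<rho> \<longrightarrow> (\<forall>x. 0 \<le> \<rho> x) \<longrightarrow> (\<forall>x. norm (x - x0) > h \<longrightarrow> \<rho> x = 0) \<longrightarrow>
     (\<exists>A. local_rule P N C (c * h) x0 \<rho> A))"
proof -
  let ?G = "grid N :: ('a \<Rightarrow> nat) set"
  define d where "d = real DIM('a)"
  have d: "d > 0" by (simp add: d_def)
  have Nd: "real N * d > 0" using N d by simp
  obtain \<delta> where \<delta>: "\<delta> > 0" and near: "\<And>z \<beta>. (\<And>\<gamma>. \<gamma> \<in> ?G \<Longrightarrow> norm (z \<gamma> - (grid_point \<gamma> :: 'a)) \<le> \<delta>) \<Longrightarrow> \<beta> \<in> ?G \<Longrightarrow>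
     (\<Sum>\<gamma>\<in>?G. \<bar>(if \<beta> = \<gamma> then 1 else 0) - tensor_lagrange N \<beta> (z \<gamma>)\<bar>) \<le> 1 / 2"
    using tensor_lagrange_perturbed_nodes[of N, where 'a='a] by blast
  define D where "D = \<delta> + real N * d / \<kappa>"
  obtain M where M: "M > 0" "\<And>\<beta> y. \<beta> \<in> ?G \<Longrightarrow> norm (y :: 'a) \<le> D \<Longrightarrow> \<bar>tensor_lagrange N \<beta> y\<bar> \<le> M"
    using tensor_lagrange_bounded[of N D, where 'a='a] by blast
  define C where "C = real (card ?G) * (2 * M) + 1"
  define c where "c = 1 + 2 * (real N * d / (\<kappa> * \<delta>))"
  define h0 where "h0 = T0 * (\<kappa> * \<delta>) / (real N * d)"
  have pos: "C > 0" "c \<ge> 1" "h0 > 0"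
    using M(1) Nd \<kappa> \<delta> T0 by (auto simp: C_def c_def h0_def intro!: add_nonneg_pos divide_nonneg_pos)
  have main: "\<exists>A. local_rule P N C (c * h) x0 \<rho> A"
    if P: "finite P" and h: "0 < h" "h \<le> h0" and fill: "\<And>x. x \<in> \<Omega> \<Longrightarrow> \<exists>y\<in>P. norm (x - y) \<le> h"
      and x0: "x0 \<in> \<Omega>" and \<rho>: "integrable lborel \<rho>" "\<And>x. 0 \<le> \<rho> x" "\<And>x. norm (x - x0) > h \<Longrightarrow> \<rho> x = 0"
    for P h x0 and \<rho> :: "'a \<Rightarrow> real"
  proof -
    \<comment> \<open>At distance \<open>T\<close> from \<open>x0\<close> the ball contained in \<open>\<Omega>\<close> has radius \<open>\<kappa> T = s N d\<close>, just enough for the grid.\<close>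
    define s where "s = h / \<delta>"
    define T where "T = s * (real N * d) / \<kappa>"
    have s: "s > 0" "h = \<delta> * s" using h \<delta> by (auto simp: s_def)
    have T: "T > 0" using s Nd \<kappa> by (simp add: T_def)
    have "T = h * (real N * d) / (\<kappa> * \<delta>)" by (simp add: T_def s_def)
    also have "\<dots> \<le> h0 * (real N * d) / (\<kappa> * \<delta>)"
      using h Nd \<kappa> \<delta> by (intro divide_right_mono mult_right_mono) auto
    also have "\<dots> = T0" using N d \<kappa> \<delta> by (simp add: h0_def)
    finally have TT0: "T \<le> T0" .
    obtain y0 where y0: "norm (y0 - x0) = T" "cball y0 (\<kappa> * T) \<subseteq> \<Omega>"
      using balls x0 T TT0 by blast
    have \<kappa>T: "\<kappa> * T = s * (real N * d)" using \<kappa> by (simp add: T_def)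
    define g where "g \<gamma> = y0 + s *\<^sub>R grid_point \<gamma>" for \<gamma> :: "'a \<Rightarrow> nat"
    have gd: "norm (g \<gamma> - y0) \<le> \<kappa> * T" if "\<gamma> \<in> ?G" for \<gamma>
      using norm_grid_point_le[OF that] s by (simp add: g_def \<kappa>T d_def)
    then have g\<Omega>: "g \<gamma> \<in> \<Omega>" if "\<gamma> \<in> ?G" for \<gamma>
      using y0(2) that by (auto simp: subset_iff dist_norm norm_minus_commute)
    then have "\<forall>\<gamma>\<in>?G. \<exists>y\<in>P. norm (g \<gamma> - y) \<le> h" using fill by blast
    then obtain z where z: "\<And>\<gamma>. \<gamma> \<in> ?G \<Longrightarrow> z \<gamma> \<in> P" "\<And>\<gamma>. \<gamma> \<in> ?G \<Longrightarrow> norm (g \<gamma> - z \<gamma>) \<le> h"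
      by metis
    define z' where "z' \<gamma> = (1 / s) *\<^sub>R (z \<gamma> - y0)" for \<gamma>
    have z': "norm (z' \<gamma> - grid_point \<gamma>) \<le> \<delta>" if "\<gamma> \<in> ?G" for \<gamma>
    proof -
      have "z' \<gamma> - grid_point \<gamma> = (1 / s) *\<^sub>R (z \<gamma> - g \<gamma>)"
        using s by (simp add: z'_def g_def algebra_simps)
      also have "norm \<dots> = norm (g \<gamma> - z \<gamma>) / s" using s by (simp add: norm_minus_commute)
      also have "\<dots> \<le> h / s" using z(2)[OF that] s by (intro divide_right_mono) auto
      also have "\<dots> = \<delta>" using s by simp
      finally show ?thesis .
    qed
    have zx0: "norm (z \<gamma> - x0) \<le> c * h" if "\<gamma> \<in> ?G" for \<gamma>
    proof -
      have "norm (z \<gamma> - x0) \<le> norm (g \<gamma> - z \<gamma>) + norm (g \<gamma> - y0) + norm (y0 - x0)"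
        by norm
      also have "\<dots> \<le> h + \<kappa> * T + T" using z(2)[OF that] gd[OF that] y0(1) by simp
      also have "\<dots> \<le> h + 2 * T" using \<kappa> T by simp
      also have "\<dots> = c * h" by (simp add: c_def T_def s_def algebra_simps)
      finally show ?thesis .
    qed
    define m where "m = (LBINT x. \<rho> x)"
    have m: "m \<ge> 0" unfolding m_def using \<rho> by (intro integral_nonneg_AE) auto
    \<comment> \<open>Exactness is required for the Lagrange functions only: they span the tensor polynomials.\<close>
    define \<Lambda> where "\<Lambda> \<beta> x = tensor_lagrange N \<beta> ((1 / s) *\<^sub>R (x - y0))" for \<beta> and x :: 'a
    have [measurable]: "\<rho> \<in> borel_measurable borel" using \<rho> by auto
    have [measurable]: "\<Lambda> \<beta> \<in> borel_measurable borel" for \<beta>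
      unfolding \<Lambda>_def[abs_def]
      by (intro borel_measurable_continuous_onI continuous_on_compose2[OF continuous_on_tensor_lagrange[of UNIV]] continuous_intros) auto
    have \<rho>\<Lambda>: "\<bar>\<rho> x * \<Lambda> \<beta> x\<bar> \<le> \<rho> x * M" if "\<beta> \<in> ?G" for \<beta> x
    proof (cases "norm (x - x0) > h")
      case False
      have "norm (x - y0) \<le> h + T" using False y0(1) norm_triangle_ineq4[of "x - x0" "y0 - x0"] by simp
      then have "norm ((1 / s) *\<^sub>R (x - y0)) \<le> (h + T) / s" using s by (simp add: divide_right_mono)
      also have "(h + T) / s = D" using s by (simp add: D_def T_def add_divide_distrib)
      finally show ?thesis
        using M(2)[OF that] \<rho>(2)[of x] by (simp add: abs_mult \<Lambda>_def mult_left_mono)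
    qed (simp add: \<rho>)
    have \<rho>\<Lambda>_int: "integrable lborel (\<lambda>x. \<rho> x * \<Lambda> \<beta> x)" if "\<beta> \<in> ?G" for \<beta>
    proof (rule Bochner_Integration.integrable_bound)
      show "integrable lborel (\<lambda>x. \<rho> x * M)" using \<rho> by simp
      show "AE x in lborel. norm (\<rho> x * \<Lambda> \<beta> x) \<le> norm (\<rho> x * M)"
        using \<rho>\<Lambda>[OF that] by (auto intro: order.trans[OF _ abs_ge_self])
    qed auto
    define b where "b \<beta> = (LBINT x. \<rho> x * \<Lambda> \<beta> x)" for \<beta>
    have b: "\<bar>b \<beta>\<bar> \<le> M * m" if "\<beta> \<in> ?G" for \<beta>
    proof -
      have "\<bar>b \<beta>\<bar> \<le> (LBINT x. \<rho> x * M)"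
        unfolding b_def using \<rho> \<rho>\<Lambda>[OF that] \<rho>\<Lambda>_int[OF that] by (intro integral_abs_bound_integral) auto
      then show ?thesis by (simp add: m_def mult.commute)
    qed
    have near': "(\<Sum>\<gamma>\<in>?G. \<bar>(if \<beta> = \<gamma> then 1 else 0) - tensor_lagrange N \<beta> (z' \<gamma>)\<bar>) \<le> 1 / 2"
      if "\<beta> \<in> ?G" for \<beta>
      by (rule near[OF z' that])
    obtain a where a: "\<And>\<gamma>. \<gamma> \<in> ?G \<Longrightarrow> \<bar>a \<gamma>\<bar> \<le> 2 * (M * m)"
       "\<And>\<beta>. \<beta> \<in> ?G \<Longrightarrow> (\<Sum>\<gamma>\<in>?G. tensor_lagrange N \<beta> (z' \<gamma>) * a \<gamma>) = b \<beta>"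
      proof -
      have "\<exists>a. (\<forall>\<gamma>\<in>?G. \<bar>a \<gamma>\<bar> \<le> 2 * (M * m)) \<and>
          (\<forall>\<beta>\<in>?G. (\<Sum>\<gamma>\<in>?G. tensor_lagrange N \<beta> (z' \<gamma>) * a \<gamma>) = b \<beta>)"
        by (rule solve_near_identity[OF finite_grid]) (erule near', erule b)
      then show ?thesis using that by blast
    qed
    define A where "A x = (\<Sum>\<gamma> | \<gamma> \<in> ?G \<and> z \<gamma> = x. a \<gamma>)" for x
    have zP: "z ` ?G \<subseteq> P" using z by auto
    have sumA: "(\<Sum>x\<in>P. A x * f x) = (\<Sum>\<gamma>\<in>?G. a \<gamma> * f (z \<gamma>))" for f
    proof -
      have "(\<Sum>x\<in>P. A x * f x) = (\<Sum>x\<in>P. \<Sum>\<gamma> | \<gamma> \<in> ?G \<and> z \<gamma> = x. a \<gamma> * f (z \<gamma>))"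
        unfolding A_def sum_distrib_right by (intro sum.cong) auto
      also have "\<dots> = (\<Sum>\<gamma>\<in>?G. a \<gamma> * f (z \<gamma>))"
        by (rule sum.group[OF finite_grid P zP])
      finally show ?thesis .
    qed
    show ?thesis
    proof (intro exI[of _ A] conjI allI impI)
      fix x assume "A x \<noteq> 0"
      then obtain \<gamma> where "\<gamma> \<in> ?G" "z \<gamma> = x"
        unfolding A_def by (auto elim: sum.not_neutral_contains_not_neutral)
      then show "norm (x - x0) \<le> c * h" using zx0 by auto
    next
      have "(\<Sum>x\<in>P. \<bar>A x\<bar>) \<le> (\<Sum>x\<in>P. \<Sum>\<gamma> | \<gamma> \<in> ?G \<and> z \<gamma> = x. \<bar>a \<gamma>\<bar>)"
        unfolding A_def by (intro sum_mono sum_abs)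
      also have "\<dots> = (\<Sum>\<gamma>\<in>?G. \<bar>a \<gamma>\<bar>)" by (rule sum.group[OF finite_grid P zP])
      also have "\<dots> \<le> (\<Sum>\<gamma>\<in>?G. 2 * (M * m))" by (intro sum_mono a)
      also have "\<dots> \<le> C * m" using m by (simp add: C_def algebra_simps)
      finally show "(\<Sum>x\<in>P. \<bar>A x\<bar>) \<le> C * (LBINT x. \<rho> x)" by (simp add: m_def)
    next
      fix \<pi> :: "'a \<Rightarrow> real poly" assume \<pi>: "\<forall>b\<in>Basis. degree (\<pi> b) \<le> N"
      define \<pi>' where "\<pi>' b = pcompose (\<pi> b) [: y0 \<bullet> b, s :]" for b
      have deg: "degree (\<pi>' b) \<le> N" if "b \<in> Basis" for b
        using \<pi> that s(1) by (simp add: \<pi>'_def degree_pcompose)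
      have scale: "tensor_poly \<pi> (y0 + s *\<^sub>R u) = tensor_poly \<pi>' u" for u
        by (simp add: tensor_poly_def \<pi>'_def poly_pcompose inner_add_left algebra_simps)
      have exact: "tensor_poly \<pi> x = (\<Sum>\<beta>\<in>?G. tensor_poly \<pi>' (grid_point \<beta>) * \<Lambda> \<beta> x)" for x
      proof -
        have "x = y0 + s *\<^sub>R ((1 / s) *\<^sub>R (x - y0))" using s by simp
        then have "tensor_poly \<pi> x = tensor_poly \<pi>' ((1 / s) *\<^sub>R (x - y0))" using scale by metis
        also have "\<dots> = (\<Sum>\<beta>\<in>?G. tensor_poly \<pi>' (grid_point \<beta>) * \<Lambda> \<beta> x)"
          unfolding \<Lambda>_def by (rule tensor_interpolation_exact[OF deg])
        finally show ?thesis .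
      qed
      have "(\<Sum>x\<in>P. A x * tensor_poly \<pi> x) = (\<Sum>\<gamma>\<in>?G. a \<gamma> * tensor_poly \<pi> (z \<gamma>))"
        by (rule sumA)
      also have "\<dots> = (\<Sum>\<gamma>\<in>?G. \<Sum>\<beta>\<in>?G. tensor_poly \<pi>' (grid_point \<beta>) * (tensor_lagrange N \<beta> (z' \<gamma>) * a \<gamma>))"
        unfolding exact sum_distrib_left by (intro sum.cong) (auto simp: \<Lambda>_def z'_def)
      also have "\<dots> = (\<Sum>\<beta>\<in>?G. tensor_poly \<pi>' (grid_point \<beta>) * b \<beta>)"
        by (subst sum.swap) (simp add: sum_distrib_left[symmetric] a(2))
      also have "\<dots> = (\<Sum>\<beta>\<in>?G. LBINT x. tensor_poly \<pi>' (grid_point \<beta>) * (\<rho> x * \<Lambda> \<beta> x))"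
        by (simp add: b_def)
      also have "\<dots> = (LBINT x. (\<Sum>\<beta>\<in>?G. tensor_poly \<pi>' (grid_point \<beta>) * (\<rho> x * \<Lambda> \<beta> x)))"
        by (rule Bochner_Integration.integral_sum[symmetric]) (intro integrable_mult_right \<rho>\<Lambda>_int)
      also have "\<dots> = (LBINT x. \<rho> x * tensor_poly \<pi> x)"
        unfolding exact sum_distrib_left by (simp add: mult_ac)
      finally show "(\<Sum>x\<in>P. A x * tensor_poly \<pi> x) = (LBINT x. \<rho> x * tensor_poly \<pi> x)" .
    qed
  qed
  show ?thesis
  proof (rule exI[of _ C], rule exI[of _ c], rule exI[of _ h0], intro conjI allI impI pos)
    fix P h x0 and \<rho> :: "'a \<Rightarrow> real"
    assume "finite P" "0 < h" "h \<le> h0" "\<forall>x\<in>\<Omega>. \<exists>y\<in>P. norm (x - y) \<le> h" "x0 \<in> \<Omega>"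
      "integrable lborel \<rho>" "\<forall>x. 0 \<le> \<rho> x" "\<forall>x. norm (x - x0) > h \<longrightarrow> \<rho> x = 0"
    then show "\<exists>A. local_rule P N C (c * h) x0 \<rho> A"
      by (intro main) simp_all
  qed
qed

section \<open>Quadrature rules for Gaussians\<close>

abbreviation gauss :: "real \<Rightarrow> 'a::real_normed_vector \<Rightarrow> real" where
  "gauss s x \<equiv> exp (- (norm x)\<^sup>2 / s)"

lemma power_le_fact_exp:
  fixes x :: real
  assumes "x \<ge> 0"
  shows "x ^ n \<le> fact n * exp x"
proof -
  obtain t where t: "exp x = (\<Sum>m<Suc n. x ^ m / fact m) + exp t / fact (Suc n) * x ^ Suc n"
    using Maclaurin_exp_le[of x "Suc n"] by blast
  have "x ^ n / fact n \<le> (\<Sum>m<Suc n. x ^ m / fact m)"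
    using assms by (intro member_le_sum[of n "{..<Suc n}" "\<lambda>m. x ^ m / fact m"]) auto
  also have "\<dots> \<le> exp x" unfolding t using assms by simp
  finally show ?thesis by (simp add: field_simps)
qed

definition exp_taylor :: "nat \<Rightarrow> real poly" where
  "exp_taylor n = (\<Sum>k<n. monom (1 / fact k) k)"

lemma degree_exp_taylor_le: "degree (exp_taylor n) \<le> n"
  unfolding exp_taylor_def
  by (intro degree_sum_le) (auto intro: order.trans[OF degree_monom_le])

lemma poly_exp_taylor: "poly (exp_taylor n) x = (\<Sum>k<n. x ^ k / fact k)"
  by (simp add: exp_taylor_def poly_sum poly_monom)

lemma exp_taylor_error: "\<bar>exp x - poly (exp_taylor n) x\<bar> \<le> \<bar>x\<bar> ^ n * exp \<bar>x\<bar>"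
proof -
  obtain t where t: "\<bar>t\<bar> \<le> \<bar>x\<bar>" "exp x = (\<Sum>m<n. x ^ m / fact m) + exp t / fact n * x ^ n"
    using Maclaurin_exp_le[of x n] by blast
  have "\<bar>exp x - poly (exp_taylor n) x\<bar> = \<bar>x\<bar> ^ n * (exp t / fact n)"
    using t(2) by (simp add: poly_exp_taylor abs_mult power_abs)
  also have "exp t / fact n \<le> exp \<bar>x\<bar> / 1"
    using t(1) by (intro frac_le) (auto simp: fact_ge_1)
  finally show ?thesis by (simp add: mult_left_mono)
qed

lemma abs_poly_exp_taylor_le: "\<bar>poly (exp_taylor n) x\<bar> \<le> exp \<bar>x\<bar>"
proof -
  obtain t where t: "exp \<bar>x\<bar> = (\<Sum>m<n. \<bar>x\<bar> ^ m / fact m) + exp t / fact n * \<bar>x\<bar> ^ n"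
    using Maclaurin_exp_le[of "\<bar>x\<bar>" n] by blast
  have "\<bar>poly (exp_taylor n) x\<bar> \<le> (\<Sum>m<n. \<bar>x\<bar> ^ m / fact m)"
    unfolding poly_exp_taylor by (rule order.trans[OF sum_abs]) (simp add: power_abs)
  also have "\<dots> \<le> exp \<bar>x\<bar>" unfolding t by simp
  finally show ?thesis .
qed

text \<open>
  Telescoping: factors are exchanged one at a time, the others being bounded by \<open>A\<close>.
\<close>

lemma abs_prod_diff_le:
  fixes a b A D :: "'i \<Rightarrow> real"
  assumes "finite I" and "\<And>i. i \<in> I \<Longrightarrow> \<bar>a i\<bar> \<le> A i" "\<And>i. i \<in> I \<Longrightarrow> \<bar>b i\<bar> \<le> A i"
    and "\<And>i. i \<in> I \<Longrightarrow> \<bar>a i - b i\<bar> \<le> D i * A i"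
  shows "\<bar>(\<Prod>i\<in>I. a i) - (\<Prod>i\<in>I. b i)\<bar> \<le> (\<Sum>i\<in>I. D i) * (\<Prod>i\<in>I. A i)"
  using assms
proof (induction I)
  case (insert j I)
  have A0: "0 \<le> A i" if "i \<in> insert j I" for i using insert.prems(1)[OF that] by linarith
  have IH: "\<bar>(\<Prod>i\<in>I. a i) - (\<Prod>i\<in>I. b i)\<bar> \<le> (\<Sum>i\<in>I. D i) * (\<Prod>i\<in>I. A i)"
    using insert by auto
  have pa: "\<bar>\<Prod>i\<in>I. a i\<bar> \<le> (\<Prod>i\<in>I. A i)"
    unfolding abs_prod using insert.prems(1) by (intro prod_mono) auto
  have "a j * (\<Prod>i\<in>I. a i) - b j * (\<Prod>i\<in>I. b i) =
      (a j - b j) * (\<Prod>i\<in>I. a i) + b j * ((\<Prod>i\<in>I. a i) - (\<Prod>i\<in>I. b i))"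
    by (simp add: algebra_simps)
  also have "\<bar>\<dots>\<bar> \<le> (D j * A j) * (\<Prod>i\<in>I. A i) + A j * ((\<Sum>i\<in>I. D i) * (\<Prod>i\<in>I. A i))"
    using insert.prems IH pa A0
    by (intro order.trans[OF abs_triangle_ineq] add_mono)
       (auto simp: abs_mult intro!: mult_mono intro: order.trans[OF abs_ge_zero])
  finally show ?case using insert.hyps by (simp add: algebra_simps)
qed simp

text \<open>
  With \<open>x = x0 + v\<close>, the Gaussian centred at \<open>x'\<close> is its value at \<open>x0\<close> times a product over the coordinates of
  \<open>exp u\<close>, where \<open>u\<close> is quadratic in the coordinate of \<open>v\<close>. Truncating each exponential series at \<open>M\<close> terms gives a
  tensor polynomial of degree at most \<open>2 M\<close>. Here \<open>|u|\<close> is at most a multiple of \<open>(h / \<tau>) (1 + |x0 - x'| / \<tau>)\<close>, and the growth in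
  \<open>|x0 - x'| / \<tau>\<close> is absorbed by half of the Gaussian exponent.
\<close>

lemma gaussian_tensor_taylor:
  fixes c :: real
  assumes c: "c \<ge> 0"
  shows "\<exists>C>0. \<forall>\<tau> h (x0::'a::euclidean_space) x'. 0 < h \<longrightarrow> h \<le> \<tau> \<longrightarrow>
    (\<exists>\<pi>. (\<forall>b. degree (\<pi> b) \<le> 2 * M) \<and> (\<forall>x. norm (x - x0) \<le> c * h \<longrightarrow>
       \<bar>gauss (4 * \<tau>\<^sup>2) (x - x') - tensor_poly \<pi> x\<bar>
         \<le> C * (h / \<tau>) ^ M * gauss (8 * \<tau>\<^sup>2) (x0 - x')))"
proof -
  define K where "K = c + c\<^sup>2"
  define d where "d = real DIM('a)"
  define a where "a = (d + 1) * K"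
  \<comment> \<open>With \<open>\<zeta> = |x0 - x'| / \<tau>\<close>, the exponent \<open>2 * a\<^sup>2\<close> comes from \<open>a * \<zeta> \<le> \<zeta>\<^sup>2 / 8 + 2 * a\<^sup>2\<close>.\<close>
  define C where "C = d * fact M * exp (a + 2 * a\<^sup>2)"
  have d: "d > 0" by (simp add: d_def)
  have K: "K \<ge> 0" using c by (simp add: K_def)
  have C: "C > 0" using d by (simp add: C_def)
  have "\<exists>\<pi>. (\<forall>b. degree (\<pi> b) \<le> 2 * M) \<and> (\<forall>x. norm (x - x0) \<le> c * h \<longrightarrow>
       \<bar>gauss (4 * \<tau>\<^sup>2) (x - x') - tensor_poly \<pi> x\<bar>
         \<le> C * (h / \<tau>) ^ M * gauss (8 * \<tau>\<^sup>2) (x0 - x'))"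
    if h: "0 < h" "h \<le> \<tau>" for \<tau> h and x0 x' :: 'a
  proof -
    define \<eta> where "\<eta> = h / \<tau>"
    define \<zeta> where "\<zeta> = norm (x0 - x') / \<tau>"
    have \<tau>: "\<tau> > 0" and \<eta>: "0 < \<eta>" "\<eta> \<le> 1" and \<zeta>: "\<zeta> \<ge> 0" using h by (auto simp: \<eta>_def \<zeta>_def)
    define z where "z b = ((x0 - x') \<bullet> b) / \<tau>" for b
    define Y where "Y b = [: - (x0 \<bullet> b) / \<tau>, 1 / \<tau> :]" for b
    define U where "U b = Polynomial.smult (- 1 / 4) (Polynomial.smult (2 * z b) (Y b) + Y b * Y b)" for b
    define \<pi> where "\<pi> b = Polynomial.smult (exp (- (z b)\<^sup>2 / 4)) (pcompose (exp_taylor M) (U b))" for b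
    define u where "u b x = poly (U b) (x \<bullet> b)" for b x
    have degU: "degree (U b) \<le> 2" for b
      unfolding U_def Y_def by (simp add: degree_add_le)
    have "degree (\<pi> b) \<le> 2 * M" for b
    proof -
      have "degree (\<pi> b) \<le> degree (exp_taylor M) * degree (U b)"
        unfolding \<pi>_def by (intro order.trans[OF degree_smult_le] degree_pcompose_le)
      also have "\<dots> \<le> M * 2" by (intro mult_le_mono degree_exp_taylor_le degU)
      finally show ?thesis by simp
    qed
    moreover have "\<bar>gauss (4 * \<tau>\<^sup>2) (x - x') - tensor_poly \<pi> x\<bar>
         \<le> C * (h / \<tau>) ^ M * gauss (8 * \<tau>\<^sup>2) (x0 - x')" if x: "norm (x - x0) \<le> c * h" for x
    proof -
      define y where "y b = ((x - x0) \<bullet> b) / \<tau>" for b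
      have u: "u b x = - (2 * z b * y b + (y b)\<^sup>2) / 4" for b
        using \<tau> by (simp add: u_def U_def Y_def y_def inner_diff_left power2_eq_square field_simps)
      have g0: "gauss (4 * \<tau>\<^sup>2) (x0 - x') = (\<Prod>b\<in>Basis. exp (- (z b)\<^sup>2 / 4))"
        using exp_norm_square_Basis[of "- 1 / (4 * \<tau>\<^sup>2)" "x0 - x'"] by (simp add: z_def power_divide mult.commute)
      have gx: "gauss (4 * \<tau>\<^sup>2) (x - x') = (\<Prod>b\<in>Basis. exp (- (z b)\<^sup>2 / 4) * exp (u b x))"
      proof -
        have "exp (- 1 / (4 * \<tau>\<^sup>2) * ((x - x') \<bullet> b)\<^sup>2) = exp (- (z b)\<^sup>2 / 4) * exp (u b x)" for b
        proof -
          have "(x - x') \<bullet> b = \<tau> * (z b + y b)"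
            using \<tau> by (simp add: z_def y_def inner_diff_left field_simps)
          then have "- 1 / (4 * \<tau>\<^sup>2) * ((x - x') \<bullet> b)\<^sup>2 = - (z b + y b)\<^sup>2 / 4"
            using \<tau> by (simp add: power_mult_distrib)
          also have "\<dots> = - (z b)\<^sup>2 / 4 + u b x"
            by (simp add: u power2_eq_square field_simps)
          finally show ?thesis by (simp only: exp_add)
        qed
        then show ?thesis
          using exp_norm_square_Basis[of "- 1 / (4 * \<tau>\<^sup>2)" "x - x'"] by simp
      qed
      have tp: "tensor_poly \<pi> x = (\<Prod>b\<in>Basis. exp (- (z b)\<^sup>2 / 4) * poly (exp_taylor M) (u b x))"
        by (simp add: tensor_poly_def \<pi>_def poly_pcompose u_def)
      define W where "W = \<eta> * (K * (1 + \<zeta>))"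
      have W0: "W \<ge> 0" using \<eta> K \<zeta> by (simp add: W_def)
      have uW: "\<bar>u b x\<bar> \<le> W" if b: "b \<in> Basis" for b
      proof -
        have zb: "\<bar>z b\<bar> \<le> \<zeta>" using Basis_le_norm[OF b, of "x0 - x'"] \<tau> by (simp add: z_def \<zeta>_def divide_right_mono)
        have yb: "\<bar>y b\<bar> \<le> c * \<eta>"
          using order.trans[OF Basis_le_norm[OF b, of "x - x0"] x] \<tau> by (simp add: y_def \<eta>_def divide_right_mono)
        have 1: "\<bar>z b\<bar> * \<bar>y b\<bar> \<le> \<zeta> * (c * \<eta>)"
          by (rule mult_mono[OF zb yb \<zeta> abs_ge_zero])
        have 2: "\<bar>y b\<bar> * \<bar>y b\<bar> \<le> (c * \<eta>) * (c * \<eta>)"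
          by (rule mult_mono[OF yb yb order.trans[OF abs_ge_zero yb] abs_ge_zero])
        have 3: "(c * \<eta>) * (c * \<eta>) \<le> c\<^sup>2 * \<eta>"
          using \<eta> c mult_left_mono[of "\<eta> * \<eta>" \<eta> "c * c"] by (simp add: power2_eq_square mult_ac mult_left_le)
        have "\<bar>u b x\<bar> \<le> (2 * (\<bar>z b\<bar> * \<bar>y b\<bar>) + \<bar>y b\<bar> * \<bar>y b\<bar>) / 4"
          unfolding u using abs_triangle_ineq[of "2 * z b * y b" "(y b)\<^sup>2"]
          by (simp add: abs_mult power2_eq_square)
        also have "\<dots> \<le> \<zeta> * (c * \<eta>) + c\<^sup>2 * \<eta>"
        proof -
          have nn: "0 \<le> \<zeta> * (c * \<eta>)" "0 \<le> c\<^sup>2 * \<eta>" using \<zeta> c \<eta> by auto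
          have "2 * (\<bar>z b\<bar> * \<bar>y b\<bar>) + \<bar>y b\<bar> * \<bar>y b\<bar> \<le> 2 * (\<zeta> * (c * \<eta>)) + c\<^sup>2 * \<eta>"
            by (intro add_mono mult_left_mono 1 order.trans[OF 2 3]) simp
          then have le4: "(2 * (\<bar>z b\<bar> * \<bar>y b\<bar>) + \<bar>y b\<bar> * \<bar>y b\<bar>) / 4 \<le> (2 * (\<zeta> * (c * \<eta>)) + c\<^sup>2 * \<eta>) / 4"
            by (rule divide_right_mono) simp
          have "(2 * X + Z) / 4 \<le> X + Z" if "0 \<le> X" "0 \<le> Z" for X Z :: real
            using that by (simp add: field_simps)
          from order.trans[OF le4 this[OF nn]] show ?thesis .
        qed
        also have "\<dots> \<le> W"
          using \<eta> c \<zeta> by (simp add: W_def K_def algebra_simps)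
        finally show ?thesis .
      qed
      have "\<bar>(\<Prod>b\<in>Basis. exp (u b x)) - (\<Prod>b\<in>(Basis::'a set). poly (exp_taylor M) (u b x))\<bar>
          \<le> (\<Sum>b\<in>(Basis::'a set). \<bar>u b x\<bar> ^ M) * (\<Prod>b\<in>(Basis::'a set). exp \<bar>u b x\<bar>)"
        by (rule abs_prod_diff_le) (auto intro: abs_poly_exp_taylor_le exp_taylor_error)
      also have "\<dots> \<le> (\<Sum>b\<in>(Basis::'a set). W ^ M) * (\<Prod>b\<in>(Basis::'a set). exp W)"
        using W0 by (intro mult_mono sum_mono prod_mono power_mono) (auto simp: uW intro!: prod_nonneg sum_nonneg)
      also have "\<dots> = d * W ^ M * exp (d * W)"
        by (simp add: d_def exp_of_nat_mult)
      also have "\<dots> \<le> d * (\<eta> ^ M * (fact M * exp (K * (1 + \<zeta>)))) * exp (d * (K * (1 + \<zeta>)))"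
      proof (intro mult_mono)
        show "W ^ M \<le> \<eta> ^ M * (fact M * exp (K * (1 + \<zeta>)))"
        proof -
          have "W ^ M = \<eta> ^ M * (K * (1 + \<zeta>)) ^ M"
            unfolding W_def by (rule power_mult_distrib)
          also have "\<dots> \<le> \<eta> ^ M * (fact M * exp (K * (1 + \<zeta>)))"
            using \<eta> K \<zeta> by (intro mult_left_mono power_le_fact_exp) auto
          finally show ?thesis .
        qed
        have "W \<le> K * (1 + \<zeta>)" unfolding W_def using \<eta> K \<zeta> by (intro mult_left_le_one_le) auto
        then show "exp (d * W) \<le> exp (d * (K * (1 + \<zeta>)))" using d by simp
      qed (use d \<eta> W0 in auto)
      also have "\<dots> = d * fact M * \<eta> ^ M * exp (a + a * \<zeta>)"
        by (simp add: a_def exp_add[symmetric] algebra_simps)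
      also have "exp (a + a * \<zeta>) \<le> exp (a + 2 * a\<^sup>2 + \<zeta>\<^sup>2 / 8)"
        using zero_le_power2[of "\<zeta> - 4 * a"] by (simp add: power2_eq_square field_simps)
      also have "d * fact M * \<eta> ^ M * exp (a + 2 * a\<^sup>2 + \<zeta>\<^sup>2 / 8) = C * \<eta> ^ M * exp (\<zeta>\<^sup>2 / 8)"
        by (simp add: C_def exp_add)
      finally have main: "\<bar>(\<Prod>b\<in>Basis. exp (u b x)) - (\<Prod>b\<in>(Basis::'a set). poly (exp_taylor M) (u b x))\<bar>
          \<le> C * \<eta> ^ M * exp (\<zeta>\<^sup>2 / 8)"
        using d \<eta> by (simp add: mult_left_mono)
      have "gauss (4 * \<tau>\<^sup>2) (x - x') - tensor_poly \<pi> x =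
         gauss (4 * \<tau>\<^sup>2) (x0 - x') * ((\<Prod>b\<in>Basis. exp (u b x)) - (\<Prod>b\<in>(Basis::'a set). poly (exp_taylor M) (u b x)))"
        unfolding gx tp g0 by (simp add: prod.distrib algebra_simps)
      also have "\<bar>\<dots>\<bar> \<le> gauss (4 * \<tau>\<^sup>2) (x0 - x') * (C * \<eta> ^ M * exp (\<zeta>\<^sup>2 / 8))"
        unfolding abs_mult using main by (intro mult_mono) auto
      also have "\<dots> = C * \<eta> ^ M * (exp (- \<zeta>\<^sup>2 / 4) * exp (\<zeta>\<^sup>2 / 8))"
        by (simp add: \<zeta>_def power_divide)
      also have "exp (- \<zeta>\<^sup>2 / 4) * exp (\<zeta>\<^sup>2 / 8) = gauss (8 * \<tau>\<^sup>2) (x0 - x')"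
        by (simp add: exp_add[symmetric] \<zeta>_def power_divide)
      finally show ?thesis by (simp add: \<eta>_def)
    qed
    ultimately show ?thesis by blast
  qed
  then show ?thesis using C by blast
qed

text \<open>
  Moving the argument by a bounded multiple of the width costs a constant factor, provided that the squared width is doubled.
\<close>

lemma gaussian_shift:
  fixes x y :: "'a::real_normed_vector"
  assumes le: "norm (x - y) \<le> c * h" and h: "0 < h" "h \<le> \<tau>" and \<sigma>: "\<sigma> > 0"
  shows "gauss (\<sigma> * \<tau>\<^sup>2) x \<le> exp (c\<^sup>2 / \<sigma>) * gauss (2 * \<sigma> * \<tau>\<^sup>2) y"
proof -
  have \<tau>: "\<tau> > 0" using h by simp
  have ch: "0 \<le> c * h" using le norm_ge_zero order.trans by blast
  have "norm y \<le> norm x + c * h"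
    using norm_triangle_ineq2[of y x] le by (simp add: norm_minus_commute)
  then have "(norm y)\<^sup>2 \<le> (norm x + c * h)\<^sup>2" by (intro power_mono) auto
  also have "\<dots> \<le> 2 * (norm x)\<^sup>2 + 2 * (c * h)\<^sup>2"
    using zero_le_power2[of "norm x - c * h"] by (simp add: power2_eq_square algebra_simps)
  also have "(c * h)\<^sup>2 \<le> c\<^sup>2 * \<tau>\<^sup>2"
    unfolding power_mult_distrib using h by (intro mult_left_mono power_mono) auto
  finally have "(norm y)\<^sup>2 \<le> 2 * (norm x)\<^sup>2 + 2 * (c\<^sup>2 * \<tau>\<^sup>2)" by simp
  then have "- (norm x)\<^sup>2 / (\<sigma> * \<tau>\<^sup>2) \<le> c\<^sup>2 / \<sigma> + - (norm y)\<^sup>2 / (2 * \<sigma> * \<tau>\<^sup>2)"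
    using \<sigma> \<tau> by (simp add: field_simps)
  then show ?thesis by (simp add: exp_add[symmetric])
qed

lemma
  fixes x' :: "'a::euclidean_space"
  assumes \<tau>: "\<tau> > 0" and \<sigma>: "\<sigma> > 0"
  shows integrable_scaled_gaussian: "integrable lborel (\<lambda>x. gauss (\<sigma> * \<tau>\<^sup>2) (x - x'))"
    and integral_scaled_gaussian:
      "(LBINT x. gauss (\<sigma> * \<tau>\<^sup>2) (x - x')) = (pi * \<sigma>) powr (DIM('a) / 2) * \<tau> ^ DIM('a)"
proof -
  define t where "t = 1 / (\<sigma> * \<tau>\<^sup>2)"
  have t: "t > 0" using \<tau> \<sigma> by (simp add: t_def)
  have e: "gauss (\<sigma> * \<tau>\<^sup>2) (x - x') = exp (- t * (norm (- x' + 1 *\<^sub>R x))\<^sup>2)" for x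
    by (simp add: t_def)
  show "integrable lborel (\<lambda>x. gauss (\<sigma> * \<tau>\<^sup>2) (x - x'))"
    unfolding e by (rule integrable_lborel_affine[OF _ integrable_gaussian[OF t]]) simp
  have "(\<integral>x. exp (- t * (norm x)\<^sup>2) \<partial>(lborel::'a measure)) =
      \<bar>1\<bar> ^ DIM('a) *\<^sub>R (LBINT x. exp (- t * (norm (- x' + 1 *\<^sub>R x))\<^sup>2))"
    by (rule integral_lborel_affine) auto
  then have "(LBINT x. gauss (\<sigma> * \<tau>\<^sup>2) (x - x')) = (pi / t) powr (DIM('a) / 2)"
    using integral_gaussian[OF t, where 'a='a] unfolding e by simp
  also have "pi / t = (pi * \<sigma>) * \<tau> powr 2" using \<tau> by (simp add: t_def)
  also have "\<dots> powr (DIM('a) / 2) = (pi * \<sigma>) powr (DIM('a) / 2) * (\<tau> powr 2) powr (DIM('a) / 2)"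
    by (rule powr_mult)
  also have "(\<tau> powr 2) powr (DIM('a) / 2) = \<tau> ^ DIM('a)"
    unfolding powr_powr using \<tau> by (simp add: powr_realpow)
  finally show "(LBINT x. gauss (\<sigma> * \<tau>\<^sup>2) (x - x')) = (pi * \<sigma>) powr (DIM('a) / 2) * \<tau> ^ DIM('a)" .
qed

lemma integral_mult_scaled_gaussian_le:
  fixes p :: "'a::euclidean_space \<Rightarrow> real"
  assumes p: "p \<in> borel_measurable borel" "\<And>x. 0 \<le> p x" "\<And>x. p x \<le> B" and \<tau>: "\<tau> > 0" and \<sigma>: "\<sigma> > 0"
  shows "(LBINT x. p x * gauss (\<sigma> * \<tau>\<^sup>2) (x - x')) \<le> B * (pi * \<sigma>) powr (DIM('a) / 2) * \<tau> ^ DIM('a)"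
proof -
  note [measurable] = p(1)
  have i: "integrable lborel (\<lambda>x. B * gauss (\<sigma> * \<tau>\<^sup>2) (x - x'))"
    by (intro integrable_mult_right integrable_scaled_gaussian \<tau> \<sigma>)
  have *: "integrable lborel (\<lambda>x. p x * gauss (\<sigma> * \<tau>\<^sup>2) (x - x'))"
    by (rule Bochner_Integration.integrable_bound[OF i])
       (auto simp: abs_mult p intro!: mult_right_mono order.trans[OF p(3) abs_ge_self])
  have "(LBINT x. p x * gauss (\<sigma> * \<tau>\<^sup>2) (x - x')) \<le> (LBINT x. B * gauss (\<sigma> * \<tau>\<^sup>2) (x - x'))"
    by (intro integral_mono * i mult_right_mono p) auto
  also have "\<dots> = B * (pi * \<sigma>) powr (DIM('a) / 2) * \<tau> ^ DIM('a)"
    by (simp only: integral_mult_right_zero integral_scaled_gaussian[OF \<tau> \<sigma>] mult.assoc)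
  finally show "(LBINT x. p x * gauss (\<sigma> * \<tau>\<^sup>2) (x - x')) \<le> B * (pi * \<sigma>) powr (DIM('a) / 2) * \<tau> ^ DIM('a)" .
qed

text \<open>
  The density is shared equally among all nodes within distance \<open>h\<close>; this needs no choice of a nearest node.
\<close>

lemma density_partition:
  fixes p :: "'a::euclidean_space \<Rightarrow> real"
  assumes p: "integrable lborel p" "\<And>x. 0 \<le> p x" and supp: "\<forall>x. x \<notin> \<Omega> \<longrightarrow> p x = 0"
    and P: "finite P" and fill: "\<forall>x\<in>\<Omega>. \<exists>y\<in>P. norm (x - y) \<le> h"
  shows "\<exists>\<rho>. (\<forall>x\<in>P. integrable lborel (\<rho> x) \<and> (\<forall>y. 0 \<le> \<rho> x y) \<and> (\<forall>y. norm (y - x) > h \<longrightarrow> \<rho> x y = 0)) \<and>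
     (\<forall>y. p y = (\<Sum>x\<in>P. \<rho> x y))"
proof -
  define n :: "'a \<Rightarrow> real" where "n y = (\<Sum>z\<in>P. indicator (cball z h) y)" for y
  define \<rho> where "\<rho> x y = p y * (indicator (cball x h) y / n y)" for x y
  have [measurable]: "p \<in> borel_measurable borel" using p by auto
  have [measurable]: "n \<in> borel_measurable borel" unfolding n_def by (intro borel_measurable_sum borel_measurable_indicator) auto
  have n0: "n y \<ge> 0" for y unfolding n_def by (intro sum_nonneg) auto
  have ind_le: "indicator (cball x h) y \<le> n y" if "x \<in> P" for x y
    unfolding n_def using P that by (intro member_le_sum) auto
  have "integrable lborel (\<rho> x)" if "x \<in> P" for x
    unfolding \<rho>_def
  proof (rule Bochner_Integration.integrable_bound[OF p(1)])
    have "indicator (cball x h) y / n y \<le> 1" for y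
      using ind_le[OF that, of y] n0[of y] by (cases "n y = 0") (auto simp: divide_le_eq)
    then have "p y * (indicator (cball x h) y / n y) \<le> p y * 1" for y
      by (intro mult_left_mono p)
    then show "AE y in lborel. norm (p y * (indicator (cball x h) y / n y)) \<le> norm (p y)"
      using p n0 by (intro AE_I2) (simp add: abs_mult)
    have [measurable]: "indicator (cball x h) \<in> borel_measurable (borel :: 'a measure)"
      by (intro borel_measurable_indicator) auto
    show "(\<lambda>y. p y * (indicator (cball x h) y / n y)) \<in> borel_measurable lborel"
      unfolding measurable_lborel1 by (intro borel_measurable_times borel_measurable_divide) measurable
  qed
  moreover have "0 \<le> \<rho> x y" for x y using p n0 by (simp add: \<rho>_def)
  moreover have "\<rho> x y = 0" if "norm (y - x) > h" for x y
    using that by (simp add: \<rho>_def indicator_def dist_norm norm_minus_commute)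
  moreover have "p y = (\<Sum>x\<in>P. \<rho> x y)" for y
  proof (cases "y \<in> \<Omega>")
    case True
    then obtain x where x: "x \<in> P" "norm (y - x) \<le> h" using fill by blast
    then have "n y \<noteq> 0"
      using ind_le[OF x(1), of y] by (auto simp: indicator_def dist_norm norm_minus_commute)
    moreover have "(\<Sum>x\<in>P. \<rho> x y) = p y * (n y / n y)"
      unfolding \<rho>_def sum_distrib_left[symmetric] sum_divide_distrib[symmetric] n_def ..
    ultimately show ?thesis by simp
  qed (simp add: \<rho>_def supp)
  ultimately show ?thesis by (intro exI[of _ \<rho>]) blast
qed


text \<open>
  Gaussians of width at least \<open>h\<close> are controlled by exactness. For narrower ones only the mass near a point matters,
  which the last condition bounds through the Gaussian of width \<open>h\<close>.
\<close>

abbreviation gauss_rule ::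
  "('a::euclidean_space \<Rightarrow> real) \<Rightarrow> 'a set \<Rightarrow> nat \<Rightarrow> real \<Rightarrow> real \<Rightarrow> ('a \<Rightarrow> real) \<Rightarrow> bool" where
  "gauss_rule p P M C h w \<equiv> (\<Sum>x\<in>P. \<bar>w x\<bar>) \<le> C \<and>
     (\<forall>\<tau> x'. h \<le> \<tau> \<longrightarrow> \<bar>quad_error p P w (\<lambda>x. gauss (4 * \<tau>\<^sup>2) (x - x'))\<bar>
        \<le> C * (h / \<tau>) ^ M * \<tau> ^ DIM('a)) \<and>
     (\<forall>x'. (LBINT x. p x * gauss (4 * h\<^sup>2) (x - x'))
        + (\<Sum>x\<in>P. \<bar>w x\<bar> * gauss (4 * h\<^sup>2) (x - x')) \<le> C * h ^ DIM('a))"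

text \<open>
  Adding up local rules for the shares of the density. The error on a wide Gaussian is estimated cell by cell and the
  sum over the cells is compared with an integral over the whole space, which gives the factor \<open>\<tau> ^ d\<close>. The last
  estimate says that the rule and the density put mass \<open>O(h ^ d)\<close> on balls of radius \<open>h\<close>.
\<close>

lemma quadrature_for_gaussians:
  fixes \<Omega> :: "'a::euclidean_space set" and p :: "'a \<Rightarrow> real"
  assumes \<kappa>: "0 < \<kappa>" "\<kappa> < 1" and T0: "T0 > 0"
    and balls: "\<forall>x\<in>\<Omega>. \<forall>T. 0 < T \<and> T \<le> T0 \<longrightarrow> (\<exists>y. norm (y - x) = T \<and> cball y (\<kappa> * T) \<subseteq> \<Omega>)"
    and p: "integrable lborel p" "\<And>x. 0 \<le> p x" "\<And>x. p x \<le> B" and supp: "\<forall>x. x \<notin> \<Omega> \<longrightarrow> p x = 0"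
  shows "\<exists>C h0. C > 0 \<and> h0 > 0 \<and> (\<forall>P h. finite P \<longrightarrow> P \<subseteq> \<Omega> \<longrightarrow> 0 < h \<longrightarrow> h \<le> h0 \<longrightarrow>
     (\<forall>x\<in>\<Omega>. \<exists>y\<in>P. norm (x - y) \<le> h) \<longrightarrow>
     (\<exists>w. gauss_rule p P M C h w))"
proof -
  obtain C1 c h0 where C1: "C1 > 0" and c: "c \<ge> 1" and h0: "h0 > 0" and
    local0: "\<forall>P h x0 \<rho>. finite P \<longrightarrow> 0 < h \<longrightarrow> h \<le> h0 \<longrightarrow>
     (\<forall>x\<in>\<Omega>. \<exists>y\<in>P. norm (x - y) \<le> h) \<longrightarrow> x0 \<in> \<Omega> \<longrightarrow>
     integrable lborel \<rho> \<longrightarrow> (\<forall>x. 0 \<le> \<rho> x) \<longrightarrow> (\<forall>x. norm (x - x0) > h \<longrightarrow> \<rho> x = 0) \<longrightarrow>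
     (\<exists>A. local_rule P (2 * M + 1) C1 (c * h) x0 \<rho> A)"
    using local_quadrature[OF \<kappa> T0 balls le_add2[of 1 "2 * M"]] by (elim exE conjE) (erule (3) that)
  note local_rules = local0[THEN spec, THEN spec, THEN spec, THEN spec, THEN mp, THEN mp, THEN mp, THEN mp,
      THEN mp, THEN mp, THEN mp, THEN mp]
  obtain C2 where C2: "C2 > 0" and taylor0: "\<forall>\<tau> h (x0::'a) x'. 0 < h \<longrightarrow> h \<le> \<tau> \<longrightarrow>
    (\<exists>\<pi>. (\<forall>b. degree (\<pi> b) \<le> 2 * M) \<and> (\<forall>x. norm (x - x0) \<le> c * h \<longrightarrow>
       \<bar>gauss (4 * \<tau>\<^sup>2) (x - x') - tensor_poly \<pi> x\<bar>
         \<le> C2 * (h / \<tau>) ^ M * gauss (8 * \<tau>\<^sup>2) (x0 - x')))"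
    using gaussian_tensor_taylor[OF order.trans[OF zero_le_one c], of M, where 'a='a] by (elim exE conjE) (erule (1) that)
  note taylor = taylor0[THEN spec, THEN spec, THEN spec, THEN spec, THEN mp, THEN mp]
  have [measurable]: "p \<in> borel_measurable borel" using p by auto
  have B: "B \<ge> 0" using p order.trans by blast
  define I where "I = (LBINT x. p x)"
  have I: "I \<ge> 0" unfolding I_def using p by (intro integral_nonneg_AE) auto
  define G where "G = exp (c\<^sup>2 / 8) * (B * (pi * 16) powr (DIM('a) / 2)) + 1"
  define G4 where "G4 = B * (pi * 4) powr (DIM('a) / 2)"
  define C where "C = C1 * I + (1 + C1) * C2 * G + (G4 + C1 * (exp (c\<^sup>2 / 4) * G))"
  have G: "G > 0" using B by (simp add: G_def add_nonneg_pos)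
  have G4: "G4 \<ge> 0" using B by (simp add: G4_def)
  have parts: "C1 * I \<ge> 0" "(1 + C1) * C2 * G > 0" "G4 + C1 * (exp (c\<^sup>2 / 4) * G) \<ge> 0"
    using C1 C2 G G4 I by auto
  have C: "C > 0" "C1 * I \<le> C" "(1 + C1) * C2 * G \<le> C" "G4 + C1 * (exp (c\<^sup>2 / 4) * G) \<le> C"
    using parts unfolding C_def by linarith+
  have main: "\<exists>w. gauss_rule p P M C h w"
    if P: "finite P" "P \<subseteq> \<Omega>" and h: "0 < h" "h \<le> h0" and fill: "\<forall>x\<in>\<Omega>. \<exists>y\<in>P. norm (x - y) \<le> h" for P h
  proof -
    obtain \<rho> where \<rho>: "\<And>x. x \<in> P \<Longrightarrow> integrable lborel (\<rho> x)" "\<And>x y. x \<in> P \<Longrightarrow> 0 \<le> \<rho> x y"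
        "\<And>x y. x \<in> P \<Longrightarrow> norm (y - x) > h \<Longrightarrow> \<rho> x y = 0" and p_eq: "\<And>y. p y = (\<Sum>x\<in>P. \<rho> x y)"
      proof -
      obtain \<rho> where "(\<forall>x\<in>P. integrable lborel (\<rho> x) \<and> (\<forall>y. 0 \<le> \<rho> x y) \<and> (\<forall>y. norm (y - x) > h \<longrightarrow> \<rho> x y = 0)) \<and>
          (\<forall>y. p y = (\<Sum>x\<in>P. \<rho> x y))"
        using density_partition[OF p(1,2) supp P(1) fill] by (elim exE)
      then show ?thesis by (intro that[of \<rho>]) simp_all
    qed
    have \<rho>m: "\<rho> x \<in> borel_measurable borel" if "x \<in> P" for x using \<rho>(1)[OF that] by auto
    have "\<forall>x\<in>P. \<exists>A. local_rule P (2 * M + 1) C1 (c * h) x (\<rho> x) A"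
    proof
      fix x assume x: "x \<in> P"
      show "\<exists>A. local_rule P (2 * M + 1) C1 (c * h) x (\<rho> x) A"
        by (rule local_rules[OF P(1) h(1) h(2) fill subsetD[OF P(2) x] \<rho>(1)[OF x]]) (use \<rho> x in auto)
    qed
    from bchoice[OF this] obtain A where A0: "\<forall>x\<in>P. local_rule P (2 * M + 1) C1 (c * h) x (\<rho> x) (A x)"
      by (elim exE) (erule that)
    have A1: "norm (y - x) \<le> c * h" if "x \<in> P" "A x y \<noteq> 0" for x y
      using bspec[OF A0 that(1)] that(2) by blast
    have A2: "(\<Sum>y\<in>P. \<bar>A x y\<bar>) \<le> C1 * (LBINT y. \<rho> x y)" if "x \<in> P" for x
      using bspec[OF A0 that(1)] by blast
    have A3: "(\<Sum>y\<in>P. A x y * tensor_poly \<pi> y) = (LBINT y. \<rho> x y * tensor_poly \<pi> y)"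
      if "x \<in> P" "\<And>b. degree (\<pi> b) \<le> 2 * M" for x \<pi>
    proof -
      have "\<forall>b\<in>Basis. degree (\<pi> b) \<le> 2 * M + 1" using that(2) by (simp add: le_SucI)
      then show ?thesis using bspec[OF A0 that(1)] by blast
    qed
    define w where "w y = (\<Sum>x\<in>P. A x y)" for y
    define m where "m x = (LBINT y. \<rho> x y)" for x
    have m0: "m x \<ge> 0" if "x \<in> P" for x
      unfolding m_def using \<rho>(2)[OF that] by (intro integral_nonneg_AE) auto
    have m_sum: "(\<Sum>x\<in>P. m x) = I"
      unfolding m_def I_def p_eq by (rule Bochner_Integration.integral_sum[symmetric]) (rule \<rho>)
    have abs_w: "(\<Sum>y\<in>P. \<bar>w y\<bar> * f y) \<le> (\<Sum>x\<in>P. \<Sum>y\<in>P. \<bar>A x y\<bar> * f y)" if f: "\<And>y. f y \<ge> 0" for f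
    proof -
      have "(\<Sum>y\<in>P. \<bar>w y\<bar> * f y) \<le> (\<Sum>y\<in>P. \<Sum>x\<in>P. \<bar>A x y\<bar> * f y)"
        unfolding w_def sum_distrib_right[symmetric] by (intro sum_mono mult_right_mono sum_abs f)
      also have "\<dots> = (\<Sum>x\<in>P. \<Sum>y\<in>P. \<bar>A x y\<bar> * f y)" by (rule sum.swap)
      finally show ?thesis .
    qed
    \<comment> \<open>Gaussians centred at the nodes, weighted with the masses of the cells, compare with an integral.\<close>
    have cells: "(\<Sum>x\<in>P. m x * gauss (8 * \<tau>\<^sup>2) (x - x')) \<le> G * \<tau> ^ DIM('a)" if \<tau>: "h \<le> \<tau>" for \<tau> x'
    proof -
      have \<tau>0: "\<tau> > 0" using h \<tau> by simp
      have each: "m x * gauss (8 * \<tau>\<^sup>2) (x - x') \<le>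
          exp (c\<^sup>2 / 8) * (LBINT y. \<rho> x y * gauss (16 * \<tau>\<^sup>2) (y - x'))"
        and int: "integrable lborel (\<lambda>y. \<rho> x y * gauss (16 * \<tau>\<^sup>2) (y - x'))" if x: "x \<in> P" for x
      proof -
        note [measurable] = \<rho>m[OF x]
        show int: "integrable lborel (\<lambda>y. \<rho> x y * gauss (16 * \<tau>\<^sup>2) (y - x'))"
          by (rule Bochner_Integration.integrable_bound[OF \<rho>(1)[OF x]]) (auto simp: abs_mult mult_left_le)
        have "m x * gauss (8 * \<tau>\<^sup>2) (x - x') = (LBINT y. \<rho> x y * gauss (8 * \<tau>\<^sup>2) (x - x'))"
          by (simp add: m_def)
        also have "\<dots> \<le> (LBINT y. exp (c\<^sup>2 / 8) * (\<rho> x y * gauss (16 * \<tau>\<^sup>2) (y - x')))"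
        proof (intro integral_mono integrable_mult_right integrable_mult_left int \<rho>(1)[OF x])
          fix y
          show "\<rho> x y * gauss (8 * \<tau>\<^sup>2) (x - x') \<le>
              exp (c\<^sup>2 / 8) * (\<rho> x y * gauss (16 * \<tau>\<^sup>2) (y - x'))"
          proof (cases "norm (y - x) > h")
            case False
            have "1 * h \<le> c * h" using c h by (intro mult_right_mono) auto
            then have "norm ((x - x') - (y - x')) \<le> c * h" using False by (simp add: norm_minus_commute)
            from gaussian_shift[OF this h(1) \<tau>, of 8]
            have "gauss (8 * \<tau>\<^sup>2) (x - x') \<le> exp (c\<^sup>2 / 8) * gauss (16 * \<tau>\<^sup>2) (y - x')" by simp
            from mult_left_mono[OF this \<rho>(2)[OF x, of y]] show ?thesis by (simp add: mult_ac)
          qed (simp add: \<rho>(3)[OF x])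
        qed
        finally show "m x * gauss (8 * \<tau>\<^sup>2) (x - x') \<le>
          exp (c\<^sup>2 / 8) * (LBINT y. \<rho> x y * gauss (16 * \<tau>\<^sup>2) (y - x'))"
          by simp
      qed
      have "(\<Sum>x\<in>P. m x * gauss (8 * \<tau>\<^sup>2) (x - x')) \<le>
          (\<Sum>x\<in>P. exp (c\<^sup>2 / 8) * (LBINT y. \<rho> x y * gauss (16 * \<tau>\<^sup>2) (y - x')))"
        by (intro sum_mono each)
      also have "\<dots> = exp (c\<^sup>2 / 8) * (LBINT y. p y * gauss (16 * \<tau>\<^sup>2) (y - x'))"
        unfolding p_eq sum_distrib_left[symmetric] sum_distrib_right
        by (subst Bochner_Integration.integral_sum[OF int]) simp_all
      also have "\<dots> \<le> exp (c\<^sup>2 / 8) * (B * (pi * 16) powr (DIM('a) / 2) * \<tau> ^ DIM('a))"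
        by (intro mult_left_mono integral_mult_scaled_gaussian_le p \<tau>0) auto
      also have "\<dots> \<le> G * \<tau> ^ DIM('a)"
        using \<tau>0 by (simp add: G_def algebra_simps)
      finally show ?thesis .
    qed
    have err_split: "quad_error p P w f = (\<Sum>x\<in>P. (LBINT y. \<rho> x y * f y) - (\<Sum>y\<in>P. A x y * f y))"
      if f: "\<And>x. x \<in> P \<Longrightarrow> integrable lborel (\<lambda>y. \<rho> x y * f y)" for f
    proof -
      have "(LBINT y. p y * f y) = (\<Sum>x\<in>P. (LBINT y. \<rho> x y * f y))"
        unfolding p_eq sum_distrib_right by (rule Bochner_Integration.integral_sum) (rule f)
      moreover have "(\<Sum>y\<in>P. w y * f y) = (\<Sum>x\<in>P. \<Sum>y\<in>P. A x y * f y)"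
        unfolding w_def sum_distrib_right by (rule sum.swap)
      ultimately show ?thesis by (simp add: quad_error_def sum_subtractf)
    qed
    have 1: "(\<Sum>x\<in>P. \<bar>w x\<bar>) \<le> C"
    proof -
      have "(\<Sum>x\<in>P. \<bar>w x\<bar>) \<le> (\<Sum>x\<in>P. \<Sum>y\<in>P. \<bar>A x y\<bar>)" using abs_w[of "\<lambda>_. 1"] by simp
      also have "\<dots> \<le> (\<Sum>x\<in>P. C1 * m x)" unfolding m_def by (intro sum_mono A2)
      also have "\<dots> = C1 * I" by (simp add: sum_distrib_left[symmetric] m_sum)
      finally show ?thesis using C by simp
    qed
    have 2: "\<bar>quad_error p P w (\<lambda>x. gauss (4 * \<tau>\<^sup>2) (x - x'))\<bar> \<le> C * (h / \<tau>) ^ M * \<tau> ^ DIM('a)"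
      if \<tau>: "h \<le> \<tau>" for \<tau> x'
    proof -
      define F where "F x = gauss (4 * \<tau>\<^sup>2) (x - x')" for x
      have [measurable]: "F \<in> borel_measurable borel" unfolding F_def by measurable
      define \<epsilon> where "\<epsilon> x = C2 * (h / \<tau>) ^ M * gauss (8 * \<tau>\<^sup>2) (x - x')" for x
      have \<rho>F: "integrable lborel (\<lambda>y. \<rho> x y * F y)" if x: "x \<in> P" for x
      proof -
        note [measurable] = \<rho>m[OF x]
        show ?thesis
          by (rule Bochner_Integration.integrable_bound[OF \<rho>(1)[OF x]]) (auto simp: F_def abs_mult mult_left_le)
      qed
      have each: "\<bar>(LBINT y. \<rho> x y * F y) - (\<Sum>y\<in>P. A x y * F y)\<bar> \<le> (1 + C1) * m x * \<epsilon> x" if x: "x \<in> P" for x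
      proof -
        note [measurable] = \<rho>m[OF x]
        obtain \<pi> where \<pi>: "\<And>b. degree (\<pi> b) \<le> 2 * M"
          "\<And>y. norm (y - x) \<le> c * h \<Longrightarrow> \<bar>F y - tensor_poly \<pi> y\<bar> \<le> \<epsilon> x"
          unfolding F_def \<epsilon>_def using taylor[OF h(1) \<tau>, of x x'] by blast
        have [measurable]: "tensor_poly \<pi> \<in> borel_measurable borel"
          unfolding tensor_poly_def by (intro borel_measurable_continuous_onI continuous_intros)
        have \<epsilon>0: "\<epsilon> x \<ge> 0" using order.trans[OF abs_ge_zero \<pi>(2)[of x]] c h by simp
        have le: "\<bar>\<rho> x y * (F y - tensor_poly \<pi> y)\<bar> \<le> \<rho> x y * \<epsilon> x" for y
        proof (cases "norm (y - x) > h")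
          case False
          have "1 * h \<le> c * h" using c h by (intro mult_right_mono) auto
          then have "\<bar>F y - tensor_poly \<pi> y\<bar> \<le> \<epsilon> x" using False by (intro \<pi>) auto
          then show ?thesis using \<rho>(2)[OF x, of y] by (simp add: abs_mult mult_left_mono)
        qed (simp add: \<rho>(3)[OF x])
        have \<rho>\<epsilon>: "integrable lborel (\<lambda>y. \<rho> x y * \<epsilon> x)" using \<rho>(1)[OF x] by simp
        have i: "integrable lborel (\<lambda>y. \<rho> x y * (F y - tensor_poly \<pi> y))"
          by (rule Bochner_Integration.integrable_bound[OF \<rho>\<epsilon>])
             (auto intro!: order.trans[OF le abs_ge_self])
        have "integrable lborel (\<lambda>y. \<rho> x y * F y - \<rho> x y * (F y - tensor_poly \<pi> y))"
          using \<rho>F[OF x] i by (rule Bochner_Integration.integrable_diff)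
        then have i2: "integrable lborel (\<lambda>y. \<rho> x y * tensor_poly \<pi> y)" by (simp add: algebra_simps)
        have e1: "(LBINT y. \<rho> x y * F y) - (LBINT y. \<rho> x y * tensor_poly \<pi> y) =
            (LBINT y. \<rho> x y * (F y - tensor_poly \<pi> y))"
          using \<rho>F[OF x] i2 by (subst Bochner_Integration.integral_diff[symmetric]) (auto simp: algebra_simps)
        have b1: "\<bar>LBINT y. \<rho> x y * (F y - tensor_poly \<pi> y)\<bar> \<le> m x * \<epsilon> x"
        proof -
          have "\<bar>LBINT y. \<rho> x y * (F y - tensor_poly \<pi> y)\<bar> \<le> (LBINT y. \<rho> x y * \<epsilon> x)"
            by (rule integral_abs_bound_integral[OF i \<rho>\<epsilon> le])
          then show ?thesis by (simp add: m_def)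
        qed
        have e2: "(LBINT y. \<rho> x y * tensor_poly \<pi> y) = (\<Sum>y\<in>P. A x y * tensor_poly \<pi> y)"
          by (rule A3[OF x \<pi>(1), symmetric])
        have "\<bar>\<Sum>y\<in>P. A x y * (F y - tensor_poly \<pi> y)\<bar> \<le> (\<Sum>y\<in>P. \<bar>A x y\<bar> * \<epsilon> x)"
        proof (intro order.trans[OF sum_abs] sum_mono)
          fix y
          show "\<bar>A x y * (F y - tensor_poly \<pi> y)\<bar> \<le> \<bar>A x y\<bar> * \<epsilon> x"
            using \<pi>(2)[OF A1[OF x]] by (cases "A x y = 0") (auto simp: abs_mult intro!: mult_left_mono)
        qed
        also have "\<dots> = (\<Sum>y\<in>P. \<bar>A x y\<bar>) * \<epsilon> x" by (simp add: sum_distrib_right)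
        also have "\<dots> \<le> C1 * m x * \<epsilon> x"
          using A2[OF x] \<epsilon>0 unfolding m_def by (intro mult_right_mono)
        finally have b2: "\<bar>\<Sum>y\<in>P. A x y * (F y - tensor_poly \<pi> y)\<bar> \<le> C1 * m x * \<epsilon> x" .
        have "(LBINT y. \<rho> x y * F y) - (\<Sum>y\<in>P. A x y * F y) =
           (LBINT y. \<rho> x y * (F y - tensor_poly \<pi> y)) - (\<Sum>y\<in>P. A x y * (F y - tensor_poly \<pi> y))"
          using e1 e2 by (simp add: right_diff_distrib sum_subtractf)
        then have "\<bar>(LBINT y. \<rho> x y * F y) - (\<Sum>y\<in>P. A x y * F y)\<bar> \<le> m x * \<epsilon> x + C1 * m x * \<epsilon> x"
          using b1 b2 by linarith
        then show ?thesis by (simp add: algebra_simps)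
      qed
      have "\<bar>quad_error p P w F\<bar> \<le> (\<Sum>x\<in>P. (1 + C1) * m x * \<epsilon> x)"
      proof -
        have "quad_error p P w F = (\<Sum>x\<in>P. (LBINT y. \<rho> x y * F y) - (\<Sum>y\<in>P. A x y * F y))"
          by (rule err_split) (rule \<rho>F)
        then show ?thesis by (simp only:) (intro order.trans[OF sum_abs] sum_mono each)
      qed
      also have "\<dots> = (1 + C1) * C2 * (h / \<tau>) ^ M * (\<Sum>x\<in>P. m x * gauss (8 * \<tau>\<^sup>2) (x - x'))"
        unfolding \<epsilon>_def sum_distrib_left by (simp add: mult_ac)
      also have "\<dots> \<le> (1 + C1) * C2 * (h / \<tau>) ^ M * (G * \<tau> ^ DIM('a))"
        using C1 C2 h \<tau> by (intro mult_left_mono cells) auto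
      also have "\<dots> = ((1 + C1) * C2 * G) * ((h / \<tau>) ^ M * \<tau> ^ DIM('a))" by simp
      also have "\<dots> \<le> C * ((h / \<tau>) ^ M * \<tau> ^ DIM('a))"
        using C h \<tau> by (intro mult_right_mono) auto
      finally show ?thesis by (simp add: F_def[abs_def])
    qed
    have 3: "(LBINT x. p x * gauss (4 * h\<^sup>2) (x - x'))
            + (\<Sum>x\<in>P. \<bar>w x\<bar> * gauss (4 * h\<^sup>2) (x - x')) \<le> C * h ^ DIM('a)" for x'
    proof -
      have "(\<Sum>x\<in>P. \<bar>w x\<bar> * gauss (4 * h\<^sup>2) (x - x')) \<le>
          (\<Sum>x\<in>P. \<Sum>y\<in>P. \<bar>A x y\<bar> * gauss (4 * h\<^sup>2) (y - x'))"
        by (rule abs_w) simp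
      also have "\<dots> \<le> (\<Sum>x\<in>P. \<Sum>y\<in>P. \<bar>A x y\<bar> * (exp (c\<^sup>2 / 4) * gauss (8 * h\<^sup>2) (x - x')))"
      proof (intro sum_mono)
        fix x y assume x: "x \<in> P"
        show "\<bar>A x y\<bar> * gauss (4 * h\<^sup>2) (y - x') \<le>
            \<bar>A x y\<bar> * (exp (c\<^sup>2 / 4) * gauss (8 * h\<^sup>2) (x - x'))"
        proof (cases "A x y = 0")
          case False
          then have "norm ((y - x') - (x - x')) \<le> c * h" using A1[OF x] by simp
          from gaussian_shift[OF this h(1) order.refl, of 4] show ?thesis by (intro mult_left_mono) auto
        qed simp
      qed
      also have "\<dots> \<le> (\<Sum>x\<in>P. (C1 * m x) * (exp (c\<^sup>2 / 4) * gauss (8 * h\<^sup>2) (x - x')))"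
        unfolding sum_distrib_right[symmetric] m_def by (intro sum_mono mult_right_mono A2) auto
      also have "\<dots> = C1 * exp (c\<^sup>2 / 4) * (\<Sum>x\<in>P. m x * gauss (8 * h\<^sup>2) (x - x'))"
        unfolding sum_distrib_left by (simp add: mult_ac)
      also have "\<dots> \<le> C1 * exp (c\<^sup>2 / 4) * (G * h ^ DIM('a))"
        using C1 by (intro mult_left_mono cells) auto
      finally have "(\<Sum>x\<in>P. \<bar>w x\<bar> * gauss (4 * h\<^sup>2) (x - x')) \<le> C1 * (exp (c\<^sup>2 / 4) * G) * h ^ DIM('a)"
        by (simp add: mult_ac)
      moreover have "(LBINT x. p x * gauss (4 * h\<^sup>2) (x - x')) \<le> G4 * h ^ DIM('a)"
        unfolding G4_def by (intro integral_mult_scaled_gaussian_le p h) auto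
      ultimately have "(LBINT x. p x * gauss (4 * h\<^sup>2) (x - x'))
            + (\<Sum>x\<in>P. \<bar>w x\<bar> * gauss (4 * h\<^sup>2) (x - x')) \<le> (G4 + C1 * (exp (c\<^sup>2 / 4) * G)) * h ^ DIM('a)"
        by (simp add: distrib_right)
      also have "\<dots> \<le> C * h ^ DIM('a)" using C h by (intro mult_right_mono) auto
      finally show ?thesis .
    qed
    show ?thesis by (intro exI[of _ w] conjI allI impI 1 2 3)
  qed
  show ?thesis
  proof (rule exI[of _ C], rule exI[of _ h0], intro conjI allI impI C(1) h0)
    fix P h assume "finite P" "P \<subseteq> \<Omega>" "0 < h" "h \<le> h0" "\<forall>x\<in>\<Omega>. \<exists>y\<in>P. norm (x - y) \<le> h"
    then show "\<exists>w. gauss_rule p P M C h w"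
      by (rule main)
  qed
qed

section \<open>From Gaussians to the Sobolev weight\<close>

lemma nn_integral_Gamma_scaled:
  fixes a r :: real
  assumes a: "a > 0" and r: "r > 0"
  shows "(\<integral>\<^sup>+t. ennreal (indicator {0<..} t * t powr (r - 1) * exp (- t * a)) \<partial>lborel) = ennreal (Gamma r * a powr (- r))"
proof -
  have "ennreal (Gamma r) = (\<integral>\<^sup>+t. ennreal (indicator {0..} t * t powr (r - 1) / exp t) \<partial>lborel)"
    using Gamma_conv_nn_integral_real[OF r] by simp
  also have "\<dots> = ennreal a * (\<integral>\<^sup>+t. ennreal (indicator {0..} (0 + a * t) * (0 + a * t) powr (r - 1) / exp (0 + a * t)) \<partial>lborel)"
    using a by (subst nn_integral_real_affine[of _ a 0]) auto
  also have "\<dots> = ennreal a * (\<integral>\<^sup>+t. ennreal (a powr (r - 1)) * ennreal (indicator {0<..} t * t powr (r - 1) * exp (- t * a)) \<partial>lborel)"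
  proof (intro arg_cong[where f = "\<lambda>x. ennreal a * x"] nn_integral_cong)
    fix t :: real
    show "ennreal (indicator {0..} (0 + a * t) * (0 + a * t) powr (r - 1) / exp (0 + a * t)) =
       ennreal (a powr (r - 1)) * ennreal (indicator {0<..} t * t powr (r - 1) * exp (- t * a))"
    proof (cases "t > 0")
      case True
      then show ?thesis using a
        by (simp add: ennreal_mult'[symmetric] powr_mult exp_minus field_simps indicator_def)
    next
      case False
      then have "t = 0 \<or> t < 0" by auto
      then show ?thesis using a by (auto simp: indicator_def zero_le_mult_iff)
    qed
  qed
  also have "\<dots> = ennreal (a powr r) * (\<integral>\<^sup>+t. ennreal (indicator {0<..} t * t powr (r - 1) * exp (- t * a)) \<partial>lborel)"
  proof -
    have "a powr r = a * a powr (r - 1)" using a by (simp add: powr_diff)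
    then show ?thesis using a by (subst nn_integral_cmult) (auto simp: ennreal_mult' mult.assoc)
  qed
  finally have *: "ennreal (Gamma r) = ennreal (a powr r) * (\<integral>\<^sup>+t. ennreal (indicator {0<..} t * t powr (r - 1) * exp (- t * a)) \<partial>lborel)" .
  have "ennreal (Gamma r * a powr (- r)) = ennreal (a powr (- r)) * ennreal (Gamma r)"
    by (simp add: ennreal_mult'' mult.commute)
  also have "\<dots> = ennreal (a powr (- r) * a powr r) * (\<integral>\<^sup>+t. ennreal (indicator {0<..} t * t powr (r - 1) * exp (- t * a)) \<partial>lborel)"
    unfolding * by (simp add: ennreal_mult' mult.assoc)
  also have "a powr (- r) * a powr r = 1" using a by (simp add: powr_add[symmetric])
  finally show ?thesis by simp
qed

text \<open>
  The Sobolev weight is a superposition of Gaussians, by the integral for the Gamma function.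
\<close>

lemma nn_integral_bessel_weight:
  fixes f :: "'a::euclidean_space \<Rightarrow> ennreal"
  assumes [measurable]: "f \<in> borel_measurable borel" and r: "r > 0"
  shows "ennreal (Gamma r) * (\<integral>\<^sup>+\<xi>. f \<xi> * ennreal ((1 + (norm \<xi>)\<^sup>2) powr (- r)) \<partial>lborel) =
    (\<integral>\<^sup>+t. ennreal (indicator {0<..} t * t powr (r - 1) * exp (- t)) * (\<integral>\<^sup>+\<xi>. f \<xi> * ennreal (exp (- t * (norm \<xi>)\<^sup>2)) \<partial>lborel) \<partial>lborel)"
proof -
  have "ennreal (Gamma r) * (\<integral>\<^sup>+\<xi>. f \<xi> * ennreal ((1 + (norm \<xi>)\<^sup>2) powr (- r)) \<partial>lborel) =
      (\<integral>\<^sup>+\<xi>. f \<xi> * ennreal (Gamma r * (1 + (norm \<xi>)\<^sup>2) powr (- r)) \<partial>lborel)"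
    using r by (subst nn_integral_cmult[symmetric]) (auto simp: ennreal_mult' mult_ac)
  also have "\<dots> = (\<integral>\<^sup>+\<xi>. (\<integral>\<^sup>+t. f \<xi> * ennreal (indicator {0<..} t * t powr (r - 1) * exp (- t * (1 + (norm \<xi>)\<^sup>2))) \<partial>lborel) \<partial>lborel)"
  proof (rule nn_integral_cong)
    fix \<xi> :: 'a
    have "1 + (norm \<xi>)\<^sup>2 > 0" by (simp add: add_pos_nonneg)
    then show "f \<xi> * ennreal (Gamma r * (1 + (norm \<xi>)\<^sup>2) powr (- r)) =
        (\<integral>\<^sup>+t. f \<xi> * ennreal (indicator {0<..} t * t powr (r - 1) * exp (- t * (1 + (norm \<xi>)\<^sup>2))) \<partial>lborel)"
      using nn_integral_Gamma_scaled[OF _ r, of "1 + (norm \<xi>)\<^sup>2"] by (subst nn_integral_cmult) auto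
  qed
  also have "\<dots> = (\<integral>\<^sup>+t. (\<integral>\<^sup>+\<xi>. f \<xi> * ennreal (indicator {0<..} t * t powr (r - 1) * exp (- t * (1 + (norm \<xi>)\<^sup>2))) \<partial>lborel) \<partial>lborel)"
    by (rule lborel_pair.Fubini') measurable
  also have "\<dots> = (\<integral>\<^sup>+t. ennreal (indicator {0<..} t * t powr (r - 1) * exp (- t)) * (\<integral>\<^sup>+\<xi>. f \<xi> * ennreal (exp (- t * (norm \<xi>)\<^sup>2)) \<partial>lborel) \<partial>lborel)"
  proof (rule nn_integral_cong)
    fix t :: real
    have "f \<xi> * ennreal (indicator {0<..} t * t powr (r - 1) * exp (- t * (1 + (norm \<xi>)\<^sup>2))) =
       ennreal (indicator {0<..} t * t powr (r - 1) * exp (- t)) * (f \<xi> * ennreal (exp (- t * (norm \<xi>)\<^sup>2)))" for \<xi>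
    proof -
      have "indicator {0<..} t * t powr (r - 1) * exp (- t * (1 + (norm \<xi>)\<^sup>2)) =
          (indicator {0<..} t * t powr (r - 1) * exp (- t)) * exp (- t * (norm \<xi>)\<^sup>2)"
        by (simp add: exp_add[symmetric] algebra_simps)
      then show ?thesis by (simp only: ennreal_mult'' exp_ge_zero) (simp only: mult_ac)
    qed
    then show "(\<integral>\<^sup>+\<xi>. f \<xi> * ennreal (indicator {0<..} t * t powr (r - 1) * exp (- t * (1 + (norm \<xi>)\<^sup>2))) \<partial>lborel) =
       ennreal (indicator {0<..} t * t powr (r - 1) * exp (- t)) * (\<integral>\<^sup>+\<xi>. f \<xi> * ennreal (exp (- t * (norm \<xi>)\<^sup>2)) \<partial>lborel)"
      by (subst nn_integral_cmult[symmetric]) auto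
  qed
  finally show ?thesis .
qed

text \<open>
  In the superposition of Gaussians the integral over \<open>\<xi>\<close> gives \<open>(pi / t) powr (d/2)\<close>, leaving a Gamma integral
  that converges for \<open>r > d/2\<close>.
\<close>

lemma integrable_bessel_weight:
  assumes r: "r > real DIM('a::euclidean_space) / 2"
  shows "integrable lborel (\<lambda>\<xi>::'a. (1 + (norm \<xi>)\<^sup>2) powr (- r))"
proof (rule integrableI_nonneg)
  define d where "d = real DIM('a) / 2"
  have r0: "r > 0" "r - d > 0" using r by (auto simp: d_def intro: le_less_trans[of 0 "real DIM('a) / 2"])
  have "ennreal (Gamma r) * (\<integral>\<^sup>+\<xi>. 1 * ennreal ((1 + (norm \<xi>)\<^sup>2) powr (- r)) \<partial>(lborel :: 'a measure)) =
     (\<integral>\<^sup>+t. ennreal (indicator {0<..} t * t powr (r - 1) * exp (- t)) * (\<integral>\<^sup>+\<xi>. 1 * ennreal (exp (- t * (norm \<xi>)\<^sup>2)) \<partial>(lborel :: 'a measure)) \<partial>lborel)"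
    by (rule nn_integral_bessel_weight) (use r0 in auto)
  also have "\<dots> = (\<integral>\<^sup>+t. ennreal (pi powr d) * ennreal (indicator {0<..} t * t powr ((r - d) - 1) * exp (- t * 1)) \<partial>lborel)"
  proof (rule nn_integral_cong)
    fix t :: real
    show "ennreal (indicator {0<..} t * t powr (r - 1) * exp (- t)) * (\<integral>\<^sup>+\<xi>. 1 * ennreal (exp (- t * (norm \<xi>)\<^sup>2)) \<partial>(lborel :: 'a measure)) =
      ennreal (pi powr d) * ennreal (indicator {0<..} t * t powr ((r - d) - 1) * exp (- t * 1))"
    proof (cases "t > 0")
      case t: True
      have "(\<integral>\<^sup>+\<xi>. 1 * ennreal (exp (- t * (norm \<xi>)\<^sup>2)) \<partial>(lborel :: 'a measure)) = ennreal ((pi / t) powr d)"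
        using nn_integral_eq_integral[OF integrable_gaussian[OF t, where 'a='a]] integral_gaussian[OF t, where 'a='a] by (simp add: d_def)
      moreover have "t powr (r - 1) * (pi / t) powr d = pi powr d * t powr ((r - d) - 1)"
      proof -
        have "t powr ((r - d) - 1) = t powr (r - 1) / t powr d"
          unfolding powr_diff[symmetric] by (simp add: algebra_simps)
        then show ?thesis using t by (simp add: powr_divide)
      qed
      ultimately show ?thesis
        using t by (simp add: ennreal_mult'[symmetric] indicator_def mult_ac)
    qed simp
  qed
  also have "\<dots> = ennreal (pi powr d) * ennreal (Gamma (r - d) * 1 powr (- (r - d)))"
    by (subst nn_integral_cmult, simp) (subst nn_integral_Gamma_scaled[OF less_numeral_extra(1) r0(2)], simp)
  also have "\<dots> < \<infinity>" by (simp add: ennreal_mult_less_top)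
  finally have "ennreal (Gamma r) * (\<integral>\<^sup>+\<xi>. ennreal ((1 + (norm \<xi>)\<^sup>2) powr (- r)) \<partial>(lborel :: 'a measure)) < \<infinity>"
    by simp
  moreover have "Gamma r > 0" using r0 by (simp add: Gamma_real_pos)
  ultimately show "(\<integral>\<^sup>+\<xi>. ennreal ((1 + (norm \<xi>)\<^sup>2) powr (- r)) \<partial>(lborel :: 'a measure)) < \<infinity>"
    by (auto simp: ennreal_mult_less_top)
qed auto

lemma nn_integral_two_powers_le:
  assumes H: "H > 0" and \<alpha>: "\<alpha> > 0" and \<beta>: "\<beta> > 0"
  shows "(\<integral>\<^sup>+t. ennreal (indicator {0<..} t * (if t \<le> H then H powr (-\<alpha>) * t powr (\<alpha> - 1) else H powr \<beta> * t powr (- \<beta> - 1))) \<partial>lborel)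
     \<le> ennreal (1 / \<alpha> + 1 / \<beta>)"
proof -
  have 1: "(\<integral>\<^sup>+t. ennreal (t powr (\<alpha> - 1) * indicator {0..H} t) \<partial>lborel) = ennreal (H powr \<alpha> / \<alpha>)"
  proof -
    have "((\<lambda>t. t powr (\<alpha> - 1)) has_integral (H powr (\<alpha> - 1 + 1) / (\<alpha> - 1 + 1))) {0..H}"
      using H \<alpha> by (intro has_integral_powr_from_0) auto
    then have "((\<lambda>t. if t \<in> {0..H} then t powr (\<alpha> - 1) else 0) has_integral (H powr \<alpha> / \<alpha>)) UNIV"
      unfolding has_integral_restrict_UNIV by simp
    moreover have "(\<lambda>t. if t \<in> {0..H} then t powr (\<alpha> - 1) else 0) = (\<lambda>t. t powr (\<alpha> - 1) * indicator {0..H} t)"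
      by (auto simp: indicator_def)
    ultimately have "((\<lambda>t. t powr (\<alpha> - 1) * indicator {0..H} t) has_integral (H powr \<alpha> / \<alpha>)) UNIV"
      by simp
    then show ?thesis by (intro nn_integral_has_integral_lborel) auto
  qed
  have 2: "(\<integral>\<^sup>+t. ennreal (t powr (- \<beta> - 1) * indicator {H..} t) \<partial>lborel) = ennreal (H powr (- \<beta>) / \<beta>)"
  proof -
    have "((\<lambda>t. t powr (- \<beta> - 1)) has_integral - (H powr (- \<beta> - 1 + 1)) / (- \<beta> - 1 + 1)) {H..}"
      using H \<beta> by (intro has_integral_powr_to_inf) auto
    then have "((\<lambda>t. t powr (- \<beta> - 1)) has_integral (H powr (- \<beta>) / \<beta>)) {H..}" by simp
    then have "((\<lambda>t. if t \<in> {H..} then t powr (- \<beta> - 1) else 0) has_integral (H powr (- \<beta>) / \<beta>)) UNIV"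
      unfolding has_integral_restrict_UNIV by simp
    moreover have "(\<lambda>t. if t \<in> {H..} then t powr (- \<beta> - 1) else 0) = (\<lambda>t. t powr (- \<beta> - 1) * indicator {H..} t)"
      by (auto simp: indicator_def)
    ultimately have "((\<lambda>t. t powr (- \<beta> - 1) * indicator {H..} t) has_integral (H powr (- \<beta>) / \<beta>)) UNIV"
      by simp
    then show ?thesis by (intro nn_integral_has_integral_lborel) auto
  qed
  have "(\<integral>\<^sup>+t. ennreal (indicator {0<..} t * (if t \<le> H then H powr (-\<alpha>) * t powr (\<alpha> - 1) else H powr \<beta> * t powr (- \<beta> - 1))) \<partial>lborel)
    \<le> (\<integral>\<^sup>+t. ennreal (H powr (-\<alpha>)) * ennreal (t powr (\<alpha> - 1) * indicator {0..H} t) + ennreal (H powr \<beta>) * ennreal (t powr (- \<beta> - 1) * indicator {H..} t) \<partial>lborel)"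
    by (intro nn_integral_mono) (auto simp: indicator_def ennreal_mult'[symmetric])
  also have "\<dots> = ennreal (H powr (-\<alpha>)) * ennreal (H powr \<alpha> / \<alpha>) + ennreal (H powr \<beta>) * ennreal (H powr (- \<beta>) / \<beta>)"
    by (subst nn_integral_add, simp, simp) (simp add: nn_integral_cmult 1 2)
  also have "\<dots> = ennreal (1 / \<alpha> + 1 / \<beta>)"
  proof -
    have "H powr (-\<alpha>) * (H powr \<alpha> / \<alpha>) = 1 / \<alpha>" "H powr \<beta> * (H powr (- \<beta>) / \<beta>) = 1 / \<beta>"
      using H by (auto simp: powr_minus field_simps)
    then show ?thesis using \<alpha> \<beta> by (simp add: ennreal_mult'[symmetric] ennreal_plus[symmetric] del: ennreal_plus)
  qed
  finally show ?thesis .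
qed

lemma error_spectrum_nonneg: "error_spectrum p P w \<xi> \<ge> 0"
  by (simp add: error_spectrum_def)

lemma borel_measurable_error_spectrum:
  assumes [measurable]: "p \<in> borel_measurable borel"
  shows "error_spectrum p P w \<in> borel_measurable borel"
  unfolding error_spectrum_def[abs_def] quad_error_def by measurable

lemma quad_error_cmult: "quad_error p P w (\<lambda>x. a * f x) = a * quad_error p P w f"
proof -
  have "(LBINT x. p x * (a * f x)) = (LBINT x. a * (p x * f x))" by (simp add: mult_ac)
  then show ?thesis by (simp add: quad_error_def sum_distrib_left algebra_simps)
qed

lemma abs_quad_error_le_weighted:
  assumes "\<And>x. 0 \<le> p x" and f: "\<And>x. 0 \<le> f x"
  shows "\<bar>quad_error p P w f\<bar> \<le> (LBINT x. p x * f x) + (\<Sum>x\<in>P. \<bar>w x\<bar> * f x)"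
proof -
  have "\<bar>\<Sum>x\<in>P. w x * f x\<bar> \<le> (\<Sum>x\<in>P. \<bar>w x\<bar> * f x)"
    by (rule order.trans[OF sum_abs]) (simp add: abs_mult f)
  moreover have "(LBINT x. p x * f x) \<ge> 0"
    using assms by (intro integral_nonneg_AE) auto
  ultimately show ?thesis by (simp add: quad_error_def)
qed

text \<open>
  The worst-case error in the Sobolev space, from the errors on Gaussians. Here \<open>V t\<close> is the energy of the signed
  measure at scale \<open>\<surd>t\<close>. As a double integral it is at most the total variation times the largest error on a
  translate of one Gaussian. The bounds \<open>(h\<^sup>2 / t) powr (M/2)\<close> for large and \<open>(h\<^sup>2 / t) powr (d/2)\<close> for
  small \<open>t\<close> make \<open>t powr (r - 1) * V t\<close> integrable at both ends.
\<close>

lemma weighted_error_spectrum_le: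
  fixes p :: "'a::euclidean_space \<Rightarrow> real"
  assumes p: "integrable lborel p" "\<And>x. 0 \<le> p x" and P: "finite P" and h: "h > 0"
    and r: "r > real DIM('a) / 2" and M: "real M > 2 * r" and C: "C > 0" and w: "(\<Sum>x\<in>P. \<bar>w x\<bar>) \<le> C"
    and far: "\<And>\<tau> x'. h \<le> \<tau> \<Longrightarrow> \<bar>quad_error p P w (\<lambda>x. gauss (4 * \<tau>\<^sup>2) (x - x'))\<bar>
            \<le> C * (h / \<tau>) ^ M * \<tau> ^ DIM('a)"
    and near: "\<And>x'. (LBINT x. p x * gauss (4 * h\<^sup>2) (x - x'))
            + (\<Sum>x\<in>P. \<bar>w x\<bar> * gauss (4 * h\<^sup>2) (x - x')) \<le> C * h ^ DIM('a)"
  shows "(\<integral>\<^sup>+\<xi>. ennreal (error_spectrum p P w \<xi>) * ennreal ((1 + (norm \<xi>)\<^sup>2) powr (- r)) \<partial>lborel) \<le>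
     ennreal (((LBINT x. p x) + C) * pi powr (DIM('a) / 2) * C * (1 / (r - DIM('a) / 2) + 1 / (M / 2 - r)) / Gamma r * (h\<^sup>2) powr r)"
proof -
  define d where "d = real DIM('a) / 2"
  define I where "I = (LBINT x. p x)"
  define K where "K = (I + C) * pi powr d * C"
  define D where "D = error_spectrum p P w"
  have [measurable]: "p \<in> borel_measurable borel" using p by auto
  have Dm [measurable]: "D \<in> borel_measurable borel" unfolding D_def by (rule borel_measurable_error_spectrum) simp
  have D0: "D \<xi> \<ge> 0" for \<xi> by (simp add: D_def error_spectrum_nonneg)
  have I: "I \<ge> 0" unfolding I_def using p by (intro integral_nonneg_AE) auto
  have K: "K \<ge> 0" using I C by (simp add: K_def)
  have d0: "d > 0" by (simp add: d_def)
  have r0: "r > 0" using r d0 by (simp add: d_def)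
  define V where "V t = (LBINT \<xi>. exp (- t * (norm \<xi>)\<^sup>2) * D \<xi>)" for t
  have V: "V t = quad_error p P w (\<lambda>x. quad_error p P w (\<lambda>y. (pi / t) powr d * gauss (4 * t) (x - y)))"
    and V_int: "integrable lborel (\<lambda>\<xi>. exp (- t * (norm \<xi>)\<^sup>2) * D \<xi>)" if t: "t > 0" for t
  proof -
    have g: "(pi / t) powr d * gauss (4 * t) z = (LBINT \<xi>. exp (- t * (norm \<xi>)\<^sup>2) * cos (\<xi> \<bullet> z))" for z :: 'a
      using integral_gaussian_cos[OF t, of z] by (simp add: d_def inner_commute)
    show "V t = quad_error p P w (\<lambda>x. quad_error p P w (\<lambda>y. (pi / t) powr d * gauss (4 * t) (x - y)))"
      unfolding V_def D_def using quad_error_twice[OF p(1) P integrable_gaussian[OF t] g, of w] by simp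
    show "integrable lborel (\<lambda>\<xi>. exp (- t * (norm \<xi>)\<^sup>2) * D \<xi>)"
      unfolding D_def by (rule integrable_error_spectrum[OF p(1) P integrable_gaussian[OF t] g])
  qed
  have V_le: "V t \<le> (I + C) * S"
    if t: "t > 0" and S: "\<And>x::'a. (pi / t) powr d * \<bar>quad_error p P w (\<lambda>y. gauss (4 * t) (y - x))\<bar> \<le> S" for t S
  proof -
    have S': "\<bar>quad_error p P w (\<lambda>y. (pi / t) powr d * gauss (4 * t) (x - y))\<bar> \<le> S" for x
      unfolding quad_error_cmult using S[of x] by (simp add: abs_mult norm_minus_commute)
    have m: "(\<lambda>x. quad_error p P w (\<lambda>y. (pi / t) powr d * gauss (4 * t) (x - y))) \<in> borel_measurable borel"
      unfolding quad_error_def by measurable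
    have "\<bar>V t\<bar> \<le> (I + (\<Sum>x\<in>P. \<bar>w x\<bar>)) * S"
      unfolding V[OF t] I_def by (rule abs_quad_error_le[OF p S' m])
    also have "\<dots> \<le> (I + C) * S"
      using w order.trans[OF abs_ge_zero S'] by (intro mult_right_mono) auto
    finally show ?thesis by simp
  qed
  have V_far: "V t \<le> K * (h\<^sup>2 / t) powr (M / 2)" if t: "h\<^sup>2 \<le> t" for t
  proof -
    define \<tau> where "\<tau> = sqrt t"
    have t0: "t > 0" using t h by (intro less_le_trans[OF _ t]) simp
    have \<tau>: "\<tau> > 0" "\<tau>\<^sup>2 = t" using t0 by (auto simp: \<tau>_def)
    have h\<tau>: "h \<le> \<tau>" unfolding \<tau>_def using t h by (intro real_le_rsqrt) auto
    have e: "(pi / t) powr d * \<tau> ^ DIM('a) = pi powr d"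
    proof -
      have "\<tau> ^ DIM('a) = t powr d"
        unfolding \<tau>_def d_def using t0 by (simp add: powr_realpow[symmetric] powr_half_sqrt[symmetric] powr_powr)
      then show ?thesis using t0 by (simp add: powr_divide)
    qed
    have e2: "(h / \<tau>) ^ M = (h\<^sup>2 / t) powr (M / 2)"
    proof -
      have "(h\<^sup>2 / t) powr (M / 2) = ((h / \<tau>) powr 2) powr (M / 2)"
        using \<tau> h by (simp add: power_divide)
      also have "\<dots> = (h / \<tau>) ^ M" unfolding powr_powr using \<tau> h by (simp add: powr_realpow)
      finally show ?thesis ..
    qed
    have "V t \<le> (I + C) * (pi powr d * C * (h\<^sup>2 / t) powr (M / 2))"
    proof (rule V_le[OF t0])
      fix x :: 'a
      have "(pi / t) powr d * \<bar>quad_error p P w (\<lambda>y. gauss (4 * t) (y - x))\<bar>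
        \<le> (pi / t) powr d * (C * (h / \<tau>) ^ M * \<tau> ^ DIM('a))"
        using far[OF h\<tau>, of x] by (intro mult_left_mono) (auto simp: \<tau>)
      also have "\<dots> = ((pi / t) powr d * \<tau> ^ DIM('a)) * C * (h / \<tau>) ^ M" by simp
      finally show "(pi / t) powr d * \<bar>quad_error p P w (\<lambda>y. gauss (4 * t) (y - x))\<bar> \<le> pi powr d * C * (h\<^sup>2 / t) powr (M / 2)"
        unfolding e e2 .
    qed
    then show ?thesis by (simp add: K_def mult_ac)
  qed
  have V_near: "V t \<le> K * (h\<^sup>2 / t) powr d" if t: "0 < t" "t \<le> h\<^sup>2" for t
  proof -
    have hd: "h ^ DIM('a) = (h\<^sup>2) powr d"
    proof -
      have "(h\<^sup>2) powr d = (h powr 2) powr d" using h by simp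
      also have "\<dots> = h ^ DIM('a)" unfolding powr_powr using h by (simp add: d_def powr_realpow)
      finally show ?thesis ..
    qed
    have "V t \<le> (I + C) * (pi powr d * C * (h\<^sup>2 / t) powr d)"
    proof (rule V_le[OF t(1)])
      fix x :: 'a
      have mono: "gauss (4 * t) (y - x) \<le> gauss (4 * h\<^sup>2) (y - x)" for y
        using t h by (auto intro!: divide_left_mono)
      have i: "integrable lborel (\<lambda>y. p y * exp (- (norm (y - x))\<^sup>2 / s))" if "s > 0" for s
        by (rule Bochner_Integration.integrable_bound[OF p(1)]) (use that in \<open>auto simp: abs_mult mult_left_le\<close>)
      have "\<bar>quad_error p P w (\<lambda>y. gauss (4 * t) (y - x))\<bar> \<le>
         (LBINT y. p y * gauss (4 * t) (y - x)) + (\<Sum>y\<in>P. \<bar>w y\<bar> * gauss (4 * t) (y - x))"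
        by (rule abs_quad_error_le_weighted) (auto simp: p)
      also have "\<dots> \<le> (LBINT y. p y * gauss (4 * h\<^sup>2) (y - x)) + (\<Sum>y\<in>P. \<bar>w y\<bar> * gauss (4 * h\<^sup>2) (y - x))"
        using t h p(2) by (intro add_mono integral_mono sum_mono i mult_left_mono mono) auto
      also have "\<dots> \<le> C * h ^ DIM('a)" by (rule near)
      finally have "(pi / t) powr d * \<bar>quad_error p P w (\<lambda>y. gauss (4 * t) (y - x))\<bar> \<le> (pi / t) powr d * (C * h ^ DIM('a))"
        by (intro mult_left_mono) auto
      also have "\<dots> = pi powr d * C * (h\<^sup>2 / t) powr d"
        unfolding hd using t h by (simp add: powr_divide)
      finally show "(pi / t) powr d * \<bar>quad_error p P w (\<lambda>y. gauss (4 * t) (y - x))\<bar> \<le> pi powr d * C * (h\<^sup>2 / t) powr d" .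
    qed
    then show ?thesis by (simp add: K_def mult_ac)
  qed
  \<comment> \<open>From here on only \<open>V\<close> matters; the factor \<open>exp (- t)\<close> of the Gamma integral is dropped.\<close>
  define H where "H = h\<^sup>2"
  have H: "H > 0" using h by (simp add: H_def)
  define \<alpha> \<beta> where "\<alpha> = r - d" and "\<beta> = M / 2 - r"
  have ab: "\<alpha> > 0" "\<beta> > 0" using r M by (auto simp: \<alpha>_def \<beta>_def d_def)
  let ?J = "\<integral>\<^sup>+\<xi>. ennreal (D \<xi>) * ennreal ((1 + (norm \<xi>)\<^sup>2) powr (- r)) \<partial>lborel"
  have "ennreal (Gamma r) * ?J =
    (\<integral>\<^sup>+t. ennreal (indicator {0<..} t * t powr (r - 1) * exp (- t)) * (\<integral>\<^sup>+\<xi>. ennreal (D \<xi>) * ennreal (exp (- t * (norm \<xi>)\<^sup>2)) \<partial>lborel) \<partial>lborel)"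
    by (rule nn_integral_bessel_weight) (use r0 in auto)
  also have "\<dots> \<le> (\<integral>\<^sup>+t. ennreal (K * H powr r) * ennreal (indicator {0<..} t * (if t \<le> H then H powr (-\<alpha>) * t powr (\<alpha> - 1) else H powr \<beta> * t powr (- \<beta> - 1))) \<partial>lborel)"
  proof (rule nn_integral_mono)
    fix t :: real
    show "ennreal (indicator {0<..} t * t powr (r - 1) * exp (- t)) * (\<integral>\<^sup>+\<xi>. ennreal (D \<xi>) * ennreal (exp (- t * (norm \<xi>)\<^sup>2)) \<partial>lborel)
      \<le> ennreal (K * H powr r) * ennreal (indicator {0<..} t * (if t \<le> H then H powr (-\<alpha>) * t powr (\<alpha> - 1) else H powr \<beta> * t powr (- \<beta> - 1)))"
    proof (cases "t > 0")
      case t: True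
      have "(\<integral>\<^sup>+\<xi>. ennreal (D \<xi>) * ennreal (exp (- t * (norm \<xi>)\<^sup>2)) \<partial>lborel) = (\<integral>\<^sup>+\<xi>. ennreal (exp (- t * (norm \<xi>)\<^sup>2) * D \<xi>) \<partial>lborel)"
        by (intro nn_integral_cong) (simp add: ennreal_mult'[symmetric] D0 mult.commute)
      also have "\<dots> = ennreal (V t)"
        unfolding V_def by (rule nn_integral_eq_integral[OF V_int[OF t]]) (simp add: D0)
      finally have e: "(\<integral>\<^sup>+\<xi>. ennreal (D \<xi>) * ennreal (exp (- t * (norm \<xi>)\<^sup>2)) \<partial>lborel) = ennreal (V t)" .
      have V0: "V t \<ge> 0" unfolding V_def by (intro integral_nonneg_AE) (auto simp: D0)
      have "t powr (r - 1) * exp (- t) * V t \<le> t powr (r - 1) * 1 * V t"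
        using t V0 by (intro mult_right_mono mult_left_mono) auto
      also have "\<dots> \<le> K * H powr r * (if t \<le> H then H powr (-\<alpha>) * t powr (\<alpha> - 1) else H powr \<beta> * t powr (- \<beta> - 1))"
      proof (cases "t \<le> H")
        case True
        have "t powr (r - 1) * V t \<le> t powr (r - 1) * (K * (H / t) powr d)"
          using V_near[OF t] True by (intro mult_left_mono) (auto simp: H_def)
        also have "\<dots> = K * (H powr d * t powr (r - 1 - d))"
          using t H by (simp add: powr_divide powr_diff)
        also have "H powr d = H powr r * H powr (- \<alpha>)" by (simp add: powr_add[symmetric] \<alpha>_def)
        also have "r - 1 - d = \<alpha> - 1" by (simp add: \<alpha>_def)
        finally show ?thesis using True by (simp add: mult_ac)
      next
        case False
        have "t powr (r - 1) * V t \<le> t powr (r - 1) * (K * (H / t) powr (M / 2))"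
          using V_far[of t] False by (intro mult_left_mono) (auto simp: H_def)
        also have "\<dots> = K * (H powr (M / 2) * t powr (r - 1 - M / 2))"
          using t H by (simp add: powr_divide powr_diff)
        also have "H powr (M / 2) = H powr r * H powr \<beta>" by (simp add: powr_add[symmetric] \<beta>_def)
        also have "r - 1 - M / 2 = - \<beta> - 1" by (simp add: \<beta>_def)
        finally show ?thesis using False by (simp add: mult_ac)
      qed
      finally have "t powr (r - 1) * exp (- t) * V t \<le> K * H powr r * (if t \<le> H then H powr (-\<alpha>) * t powr (\<alpha> - 1) else H powr \<beta> * t powr (- \<beta> - 1))" .
      then show ?thesis
        unfolding e using t K V0 by (simp add: ennreal_mult''[symmetric] ennreal_leI del: ennreal_mult'')
    qed simp
  qed
  also have "\<dots> = ennreal (K * H powr r) * (\<integral>\<^sup>+t. ennreal (indicator {0<..} t * (if t \<le> H then H powr (-\<alpha>) * t powr (\<alpha> - 1) else H powr \<beta> * t powr (- \<beta> - 1))) \<partial>lborel)"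
    by (rule nn_integral_cmult) measurable
  also have "\<dots> \<le> ennreal (K * H powr r) * ennreal (1 / \<alpha> + 1 / \<beta>)"
    by (intro mult_left_mono nn_integral_two_powers_le H ab) auto
  finally have le: "ennreal (Gamma r) * ?J \<le> ennreal (K * H powr r) * ennreal (1 / \<alpha> + 1 / \<beta>)" .
  have G: "Gamma r > 0" using r0 by (simp add: Gamma_real_pos)
  have "?J = ennreal (1 / Gamma r) * (ennreal (Gamma r) * ?J)"
    using G unfolding mult.assoc[symmetric] by (subst ennreal_mult'[symmetric]) auto
  also have "\<dots> \<le> ennreal (1 / Gamma r) * (ennreal (K * H powr r) * ennreal (1 / \<alpha> + 1 / \<beta>))"
    by (intro mult_left_mono le) auto
  also have "\<dots> = ennreal (1 / Gamma r * ((K * H powr r) * (1 / \<alpha> + 1 / \<beta>)))"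
  proof -
    have "0 \<le> 1 / Gamma r" "0 \<le> K * H powr r" "0 \<le> 1 / \<alpha> + 1 / \<beta>" using G K ab by auto
    then show ?thesis by (simp only: ennreal_mult mult_nonneg_nonneg)
  qed
  also have "1 / Gamma r * ((K * H powr r) * (1 / \<alpha> + 1 / \<beta>)) = K * (1 / \<alpha> + 1 / \<beta>) / Gamma r * H powr r" by simp
  finally show ?thesis by (simp only: D_def K_def I_def H_def d_def \<alpha>_def \<beta>_def)
qed

section \<open>Single weights against the spectrum of the error\<close>

lemma integrable_mult_bounded:
  fixes p f :: "'a::euclidean_space \<Rightarrow> real"
  assumes p: "integrable lborel p" and f: "f \<in> borel_measurable borel" "\<And>x. \<bar>f x\<bar> \<le> S"
  shows "integrable lborel (\<lambda>x. p x * f x)"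
proof (rule Bochner_Integration.integrable_bound)
  note [measurable] = f(1)
  have [measurable]: "p \<in> borel_measurable borel" using p by auto
  show "integrable lborel (\<lambda>x. p x * S)" using p by simp
  show "AE x in lborel. norm (p x * f x) \<le> norm (p x * S)"
    by (auto simp: abs_mult intro!: mult_left_mono order.trans[OF f(2) abs_ge_self])
qed (use p f in auto)

text \<open>
  The squared error is a quadratic function of the weights whose derivative vanishes at \<open>w\<close>; the second-order
  term is the positive semidefinite form of the kernel.
\<close>

lemma optimal_quad_error_le:
  fixes p \<Phi> :: "'a::euclidean_space \<Rightarrow> real"
  assumes p: "integrable lborel p" and P: "finite P"
    and \<Phi>: "\<Phi> \<in> borel_measurable borel" "\<And>x. \<bar>\<Phi> x\<bar> \<le> S" "\<And>x. \<Phi> (- x) = \<Phi> x"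
    and psd: "\<And>c. (\<Sum>x\<in>P. \<Sum>y\<in>P. c x * c y * \<Phi> (x - y)) \<ge> 0"
    and opt: "\<And>x. x \<in> P \<Longrightarrow> quad_error p P w (\<lambda>y. \<Phi> (y - x)) = 0"
  shows "quad_error p P w (\<lambda>x. quad_error p P w (\<lambda>y. \<Phi> (x - y))) \<le>
         quad_error p P v (\<lambda>x. quad_error p P v (\<lambda>y. \<Phi> (x - y)))"
proof -
  note [measurable] = \<Phi>(1)
  have [measurable]: "p \<in> borel_measurable borel" using p by auto
  define c where "c x = v x - w x" for x
  define u where "u x = quad_error p P w (\<lambda>y. \<Phi> (x - y))" for x
  have v: "quad_error p P v f = quad_error p P w f - (\<Sum>x\<in>P. c x * f x)" for f
    by (simp add: quad_error_def c_def left_diff_distrib sum_subtractf)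
  have ev: "\<Phi> (x - y) = \<Phi> (y - x)" for x y using \<Phi>(3)[of "x - y"] by simp
  have u0: "u x = 0" if "x \<in> P" for x
    unfolding u_def using opt[OF that] ev[of x] by simp
  have um [measurable]: "u \<in> borel_measurable borel"
    unfolding u_def[abs_def] quad_error_def by measurable
  have pp: "integrable lborel (\<lambda>x. \<bar>p x\<bar>)" using p by simp
  have u_le: "\<bar>u x\<bar> \<le> (LBINT x. \<bar>p x\<bar>) * S + (\<Sum>x\<in>P. \<bar>w x\<bar>) * S" for x
  proof -
    have "\<bar>LBINT y. p y * \<Phi> (x - y)\<bar> \<le> (LBINT y. \<bar>p y\<bar> * S)"
      by (rule integral_abs_bound_integral)
         (use pp \<Phi> in \<open>auto intro!: integrable_mult_bounded[OF p] mult_left_mono simp: abs_mult\<close>)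
    moreover have "\<bar>\<Sum>y\<in>P. w y * \<Phi> (x - y)\<bar> \<le> (\<Sum>y\<in>P. \<bar>w y\<bar> * S)"
      by (intro order.trans[OF sum_abs] sum_mono) (auto simp: abs_mult intro!: mult_left_mono \<Phi>)
    ultimately show ?thesis
      by (simp add: u_def quad_error_def sum_distrib_right[symmetric])
  qed
  have pu: "integrable lborel (\<lambda>x. p x * u x)" by (rule integrable_mult_bounded[OF p um u_le])
  have p\<Phi>: "integrable lborel (\<lambda>x. p x * \<Phi> (x - y))" for y
    by (rule integrable_mult_bounded[OF p _ \<Phi>(2)]) simp
  have lin: "quad_error p P w (\<lambda>x. u x - (\<Sum>y\<in>P. c y * \<Phi> (x - y))) = quad_error p P w u - (\<Sum>y\<in>P. c y * quad_error p P w (\<lambda>x. \<Phi> (x - y)))"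
  proof -
    have "(LBINT x. p x * (u x - (\<Sum>y\<in>P. c y * \<Phi> (x - y)))) =
        (LBINT x. p x * u x - (\<Sum>y\<in>P. c y * (p x * \<Phi> (x - y))))"
      by (simp add: right_diff_distrib sum_distrib_left mult_ac)
    also have "\<dots> = (LBINT x. p x * u x) - (LBINT x. (\<Sum>y\<in>P. c y * (p x * \<Phi> (x - y))))"
      by (intro Bochner_Integration.integral_diff pu Bochner_Integration.integrable_sum integrable_mult_right p\<Phi>)
    also have "(LBINT x. (\<Sum>y\<in>P. c y * (p x * \<Phi> (x - y)))) = (\<Sum>y\<in>P. c y * (LBINT x. p x * \<Phi> (x - y)))"
      by (subst Bochner_Integration.integral_sum) (auto intro: p\<Phi>)
    finally have e1: "(LBINT x. p x * (u x - (\<Sum>y\<in>P. c y * \<Phi> (x - y)))) =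
        (LBINT x. p x * u x) - (\<Sum>y\<in>P. c y * (LBINT x. p x * \<Phi> (x - y)))" .
    have "(\<Sum>x\<in>P. w x * (\<Sum>y\<in>P. c y * \<Phi> (x - y))) = (\<Sum>y\<in>P. c y * (\<Sum>x\<in>P. w x * \<Phi> (x - y)))"
      unfolding sum_distrib_left by (subst sum.swap) (simp add: mult_ac)
    then show ?thesis
      unfolding quad_error_def e1 by (simp add: right_diff_distrib sum_subtractf)
  qed
  have "quad_error p P v (\<lambda>x. quad_error p P v (\<lambda>y. \<Phi> (x - y))) =
      quad_error p P w (\<lambda>x. u x - (\<Sum>y\<in>P. c y * \<Phi> (x - y))) - (\<Sum>x\<in>P. c x * (u x - (\<Sum>y\<in>P. c y * \<Phi> (x - y))))"
    unfolding v u_def ..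
  also have "\<dots> = quad_error p P w u + (\<Sum>x\<in>P. \<Sum>y\<in>P. c x * c y * \<Phi> (x - y))"
    unfolding lin by (simp add: opt u0 sum_distrib_left sum_negf mult_ac)
  also have "\<dots> \<ge> quad_error p P w u" using psd by simp
  finally show ?thesis by (simp add: u_def[abs_def])
qed

text \<open>
  Duality with a bump around \<open>x0\<close> that misses all other nodes. The error functional maps it to its mean minus
  \<open>w x0\<close>. The mean is \<open>O(q ^ d)\<close>, and the error is bounded by the spectrum of the functional and the energy of the bump,
  which scales like \<open>\<rho> powr (d - 2 r)\<close> for \<open>\<rho> \<le> 1\<close>.
\<close>

lemma weight_le_bump:
  fixes p :: "'a::euclidean_space \<Rightarrow> real"
  assumes p: "integrable lborel p" "\<And>x. 0 \<le> p x" "\<And>x. p x \<le> B" and r: "r > real DIM('a) / 2"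
  shows "\<exists>C L. C > 0 \<and> L > 0 \<and> (\<forall>P w x0 q h K. finite P \<longrightarrow> x0 \<in> P \<longrightarrow>
     (\<forall>x\<in>P. x \<noteq> x0 \<longrightarrow> norm (x - x0) \<ge> 2 * q) \<longrightarrow> 0 < q \<longrightarrow> q \<le> L \<longrightarrow> 0 < h \<longrightarrow> 0 \<le> K \<longrightarrow>
     (LBINT \<xi>. (1 + (norm \<xi>)\<^sup>2) powr (- r) * error_spectrum p P w \<xi>) \<le> K * h powr (2 * r) \<longrightarrow>
     \<bar>w x0\<bar> \<le> C * q ^ DIM('a) + C * (1 + K) * (h powr r * q powr (DIM('a) / 2 - r)))"
proof -
  define D where "D = real DIM('a)"
  have D: "D > 0" by (simp add: D_def)
  have r0: "r > 0" using r D by (simp add: D_def)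
  have Bpos: "B \<ge> 0" using p order.trans by blast
  have [measurable]: "p \<in> borel_measurable borel" using p by auto
  obtain \<phi> :: "'a \<Rightarrow> real" and B0 L where bump: "continuous_on UNIV \<phi>" "integrable lborel \<phi>" "\<forall>x. \<bar>\<phi> x\<bar> \<le> B0"
    "\<forall>x. \<phi> (- x) = \<phi> x" "\<phi> 0 = 1" "L > 0" "\<forall>x. norm x \<ge> L \<longrightarrow> \<phi> x = 0"
    and F1: "integrable lborel (\<lambda>\<xi>. LBINT x. \<phi> x * cos (\<xi> \<bullet> x))"
    and F2: "integrable lborel (\<lambda>\<xi>. (LBINT x. \<phi> x * cos (\<xi> \<bullet> x))\<^sup>2 * (1 + (norm \<xi>)\<^sup>2) powr r)"
    using ex_bump[OF less_imp_le[OF r0], where 'a='a] by (elim exE conjE) (erule (8) that)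
  have \<phi>: "continuous_on UNIV \<phi>" "integrable lborel \<phi>" "\<And>x. \<bar>\<phi> x\<bar> \<le> B0"
    "\<And>x. \<phi> (- x) = \<phi> x" "\<phi> 0 = 1" and L: "L > 0" "\<And>x. norm x \<ge> L \<Longrightarrow> \<phi> x = 0"
    using bump by simp_all
  have \<phi>m [measurable]: "\<phi> \<in> borel_measurable borel" using \<phi> by auto
  define F where "F \<xi> = (LBINT x. \<phi> x * cos (\<xi> \<bullet> x)) / (2 * pi) ^ DIM('a)" for \<xi>
  have F_int: "integrable lborel F" unfolding F_def using F1 by simp
  then have [measurable]: "F \<in> borel_measurable borel" by auto
  have F2_int: "integrable lborel (\<lambda>\<xi>. (F \<xi>)\<^sup>2 * (1 + (norm \<xi>)\<^sup>2) powr r)"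
    unfolding F_def power_divide using F2 by simp
  have inv: "\<phi> z = (LBINT \<xi>. F \<xi> * cos (\<xi> \<bullet> z))" for z
    using cos_inversion[OF \<phi>(1-4) F1, of z] by (simp add: F_def)
  define A where "A = (LBINT \<xi>. (F \<xi>)\<^sup>2 * (1 + (norm \<xi>)\<^sup>2) powr r)"
  have A: "A \<ge> 0" unfolding A_def by (intro integral_nonneg_AE) auto
  define A1 where "A1 = (LBINT x. \<bar>\<phi> x\<bar>)"
  have A1: "A1 \<ge> 0" unfolding A1_def by (intro integral_nonneg_AE) auto
  define \<mu> where "\<mu> = 2 / L"
  have \<mu>: "\<mu> > 0" using L by (simp add: \<mu>_def)
  define C where "C = B * \<mu> ^ DIM('a) * A1 + (A + 1) * \<mu> powr (D / 2 - r) + 1"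
  have C: "C > 0" "B * \<mu> ^ DIM('a) * A1 \<le> C" "(A + 1) * \<mu> powr (D / 2 - r) \<le> C"
    using Bpos \<mu> A A1 by (auto simp: C_def intro!: add_nonneg_pos)
  have "\<bar>w x0\<bar> \<le> C * q ^ DIM('a) + C * (1 + K) * (h powr r * q powr (DIM('a) / 2 - r))"
    if P: "finite P" "x0 \<in> P" "\<And>x. x \<in> P \<Longrightarrow> x \<noteq> x0 \<Longrightarrow> norm (x - x0) \<ge> 2 * q"
      and q: "0 < q" "q \<le> L / 2" and h: "0 < h" and K: "0 \<le> K"
      and J: "(LBINT \<xi>. (1 + (norm \<xi>)\<^sup>2) powr (- r) * error_spectrum p P w \<xi>) \<le> K * h powr (2 * r)"
    for P w x0 q h K
  proof -
    define \<rho> where "\<rho> = \<mu> * q"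
    have \<rho>: "0 < \<rho>" "\<rho> \<le> 1" using q \<mu> L by (auto simp: \<rho>_def \<mu>_def field_simps)
    define g where "g z = \<phi> ((1 / \<rho>) *\<^sub>R z)" for z
    define \<psi> where "\<psi> \<eta> = \<rho> ^ DIM('a) * F (0 + \<rho> *\<^sub>R \<eta>)" for \<eta>
    have \<psi>_int: "integrable lborel \<psi>"
      unfolding \<psi>_def using \<rho> by (intro integrable_mult_right integrable_lborel_affine F_int) auto
    then have [measurable]: "\<psi> \<in> borel_measurable borel" by auto
    have g: "g z = (LBINT \<eta>. \<psi> \<eta> * cos (\<eta> \<bullet> z))" for z
    proof -
      have "g z = (LBINT \<xi>. F \<xi> * cos (\<xi> \<bullet> ((1 / \<rho>) *\<^sub>R z)))" unfolding g_def by (rule inv)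
      also have "\<dots> = \<bar>\<rho>\<bar> ^ DIM('a) *\<^sub>R (LBINT \<eta>. F (0 + \<rho> *\<^sub>R \<eta>) * cos ((0 + \<rho> *\<^sub>R \<eta>) \<bullet> ((1 / \<rho>) *\<^sub>R z)))"
        using \<rho> by (intro integral_lborel_affine) auto
      also have "\<dots> = (LBINT \<eta>. \<psi> \<eta> * cos (\<eta> \<bullet> z))"
        using \<rho> by (simp add: \<psi>_def mult.assoc)
      finally show ?thesis .
    qed
    define G where "G = error_spectrum p P w"
    have Gm [measurable]: "G \<in> borel_measurable borel"
      unfolding G_def error_spectrum_def[abs_def] quad_error_def by measurable
    have G0: "G \<xi> \<ge> 0" for \<xi> by (simp add: G_def error_spectrum_def)
    define W where "W \<xi> = (1 + (norm \<xi>)\<^sup>2) powr (- r)" for \<xi> :: 'a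
    have W_int: "integrable lborel W" unfolding W_def using r by (rule integrable_bessel_weight)
    have W0: "W \<xi> > 0" for \<xi> unfolding W_def by (simp add: add_nonneg_eq_0_iff)
    have [measurable]: "W \<in> borel_measurable borel" using W_int by auto
    have WG_int: "integrable lborel (\<lambda>\<xi>. W \<xi> * G \<xi>)"
      unfolding G_def by (rule integrable_error_spectrum[OF p(1) P(1) W_int refl])
    have iW: "1 / W \<xi> = (1 + (norm \<xi>)\<^sup>2) powr r" for \<xi>
      by (simp add: W_def powr_minus_divide)
    \<comment> \<open>Shrinking by \<open>\<rho> \<le> 1\<close> raises the Sobolev weight at most by the factor \<open>\<rho> powr (- 2 * r)\<close>.\<close>
    have \<psi>_le: "(\<psi> \<eta>)\<^sup>2 / W \<eta> \<le> \<rho> ^ DIM('a) * \<rho> ^ DIM('a) * \<rho> powr (- 2 * r) *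
        ((F (0 + \<rho> *\<^sub>R \<eta>))\<^sup>2 * (1 + (norm (0 + \<rho> *\<^sub>R \<eta>))\<^sup>2) powr r)" for \<eta>
    proof -
      have "1 + (norm \<eta>)\<^sup>2 \<le> \<rho> powr (- 2) * (1 + (norm (\<rho> *\<^sub>R \<eta>))\<^sup>2)"
      proof -
        have "\<rho>\<^sup>2 \<le> 1" using \<rho> by (simp add: power_le_one)
        then show ?thesis using \<rho> by (simp add: power_mult_distrib powr_minus_divide field_simps)
      qed
      then have "(1 + (norm \<eta>)\<^sup>2) powr r \<le> (\<rho> powr (- 2) * (1 + (norm (\<rho> *\<^sub>R \<eta>))\<^sup>2)) powr r"
        using r0 by (intro powr_mono2) auto
      also have "\<dots> = \<rho> powr (- 2 * r) * (1 + (norm (\<rho> *\<^sub>R \<eta>))\<^sup>2) powr r"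
        by (simp add: powr_mult powr_powr)
      finally have "(\<psi> \<eta>)\<^sup>2 * (1 + (norm \<eta>)\<^sup>2) powr r \<le> (\<psi> \<eta>)\<^sup>2 * (\<rho> powr (- 2 * r) * (1 + (norm (\<rho> *\<^sub>R \<eta>))\<^sup>2) powr r)"
        by (intro mult_left_mono) auto
      moreover have "(\<psi> \<eta>)\<^sup>2 / W \<eta> = (\<psi> \<eta>)\<^sup>2 * (1 + (norm \<eta>)\<^sup>2) powr r"
        using iW[of \<eta>] by (metis divide_inverse inverse_eq_divide)
      ultimately show ?thesis by (simp add: \<psi>_def power2_eq_square mult_ac)
    qed
    have bound_int: "integrable lborel (\<lambda>\<eta>. \<rho> ^ DIM('a) * \<rho> ^ DIM('a) * \<rho> powr (- 2 * r) *
        ((F (0 + \<rho> *\<^sub>R \<eta>))\<^sup>2 * (1 + (norm (0 + \<rho> *\<^sub>R \<eta>))\<^sup>2) powr r))"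
      using \<rho> by (intro integrable_mult_right integrable_lborel_affine[OF _ F2_int]) auto
    have E_int: "integrable lborel (\<lambda>\<eta>. (\<psi> \<eta>)\<^sup>2 / W \<eta>)"
    proof (rule Bochner_Integration.integrable_bound[OF bound_int _ AE_I2])
      fix \<eta>
      have nn: "0 \<le> (\<psi> \<eta>)\<^sup>2 / W \<eta>" using W0[of \<eta>] by (intro divide_nonneg_pos) auto
      show "norm ((\<psi> \<eta>)\<^sup>2 / W \<eta>) \<le> norm (\<rho> ^ DIM('a) * \<rho> ^ DIM('a) * \<rho> powr (- 2 * r) *
        ((F (0 + \<rho> *\<^sub>R \<eta>))\<^sup>2 * (1 + (norm (0 + \<rho> *\<^sub>R \<eta>))\<^sup>2) powr r))"
        unfolding real_norm_def abs_of_nonneg[OF nn] by (rule order.trans[OF \<psi>_le abs_ge_self])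
    qed measurable
    have E: "(LBINT \<eta>. (\<psi> \<eta>)\<^sup>2 / W \<eta>) \<le> A * \<rho> powr (D - 2 * r)"
    proof -
      have "A = \<bar>\<rho>\<bar> ^ DIM('a) *\<^sub>R (LBINT \<eta>. (F (0 + \<rho> *\<^sub>R \<eta>))\<^sup>2 * (1 + (norm (0 + \<rho> *\<^sub>R \<eta>))\<^sup>2) powr r)"
        unfolding A_def using \<rho> by (intro integral_lborel_affine) auto
      then have Aeq: "\<rho> ^ DIM('a) * (LBINT \<eta>. (F (0 + \<rho> *\<^sub>R \<eta>))\<^sup>2 * (1 + (norm (0 + \<rho> *\<^sub>R \<eta>))\<^sup>2) powr r) = A"
        using \<rho> by simp
      have "(LBINT \<eta>. (\<psi> \<eta>)\<^sup>2 / W \<eta>) \<le> (\<integral>\<eta>. \<rho> ^ DIM('a) * \<rho> ^ DIM('a) * \<rho> powr (- 2 * r) *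
        ((F (0 + \<rho> *\<^sub>R \<eta>))\<^sup>2 * (1 + (norm (0 + \<rho> *\<^sub>R \<eta>))\<^sup>2) powr r) \<partial>lborel)"
        by (intro integral_mono E_int bound_int \<psi>_le)
      also have "\<dots> = (\<rho> ^ DIM('a) * \<rho> powr (- 2 * r)) * (\<rho> ^ DIM('a) * (LBINT \<eta>. (F (0 + \<rho> *\<^sub>R \<eta>))\<^sup>2 * (1 + (norm (0 + \<rho> *\<^sub>R \<eta>))\<^sup>2) powr r))"
        by simp
      also have "\<dots> = (\<rho> ^ DIM('a) * \<rho> powr (- 2 * r)) * A" unfolding Aeq ..
      also have "\<rho> ^ DIM('a) * \<rho> powr (- 2 * r) = \<rho> powr (D - 2 * r)"
        using \<rho> by (simp add: D_def powr_realpow[symmetric] powr_add[symmetric])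
      finally show ?thesis by (simp add: mult.commute)
    qed
    \<comment> \<open>A weighted arithmetic-geometric mean inequality replaces the Cauchy-Schwarz inequality;
      this weight makes both terms equal in size.\<close>
    define l where "l = h powr r * \<rho> powr (r - D / 2)"
    have l: "l > 0" using h \<rho> by (simp add: l_def)
    define N where "N \<xi> = \<psi> \<xi> * (quad_error p P w (\<lambda>x. cos (\<xi> \<bullet> x)) * cos (\<xi> \<bullet> x0)
                 + quad_error p P w (\<lambda>x. sin (\<xi> \<bullet> x)) * sin (\<xi> \<bullet> x0))" for \<xi>
    have Nm [measurable]: "N \<in> borel_measurable borel"
      unfolding N_def[abs_def] quad_error_def by measurable
    have N_le: "\<bar>N \<xi>\<bar> \<le> l / 2 * ((\<psi> \<xi>)\<^sup>2 / W \<xi>) + 1 / (2 * l) * (W \<xi> * G \<xi>)" for \<xi>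
    proof -
      define a b where "a = quad_error p P w (\<lambda>x. cos (\<xi> \<bullet> x))" and "b = quad_error p P w (\<lambda>x. sin (\<xi> \<bullet> x))"
      have cs: "(a * X + b * Y)\<^sup>2 \<le> (a\<^sup>2 + b\<^sup>2) * (X\<^sup>2 + Y\<^sup>2)" for X Y :: real
        using zero_le_power2[of "a * Y - b * X"] by (simp add: power2_eq_square algebra_simps)
      have ab: "(a * cos (\<xi> \<bullet> x0) + b * sin (\<xi> \<bullet> x0))\<^sup>2 \<le> G \<xi>"
        using cs[of "cos (\<xi> \<bullet> x0)" "sin (\<xi> \<bullet> x0)"]
        by (simp add: G_def error_spectrum_def a_def b_def)
      define t where "t = a * cos (\<xi> \<bullet> x0) + b * sin (\<xi> \<bullet> x0)"
      have "\<bar>\<psi> \<xi> * t\<bar> \<le> l / 2 * ((\<psi> \<xi>)\<^sup>2 / W \<xi>) + 1 / (2 * l) * (W \<xi> * t\<^sup>2)"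
        using zero_le_power2[of "l * \<bar>\<psi> \<xi>\<bar> - W \<xi> * \<bar>t\<bar>"] l W0[of \<xi>]
        by (simp add: field_simps power2_eq_square abs_mult)
      also have "\<dots> \<le> l / 2 * ((\<psi> \<xi>)\<^sup>2 / W \<xi>) + 1 / (2 * l) * (W \<xi> * G \<xi>)"
        using ab l W0[of \<xi>] by (intro add_left_mono mult_left_mono) (auto simp: t_def)
      finally show ?thesis by (simp add: N_def t_def a_def b_def)
    qed
    have bnd_int: "integrable lborel (\<lambda>\<xi>. l / 2 * ((\<psi> \<xi>)\<^sup>2 / W \<xi>) + 1 / (2 * l) * (W \<xi> * G \<xi>))"
      by (intro Bochner_Integration.integrable_add integrable_mult_right E_int WG_int)
    have N_int: "integrable lborel N"
    proof (rule Bochner_Integration.integrable_bound[OF bnd_int _ AE_I2])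
      show "norm (N \<xi>) \<le> norm (l / 2 * ((\<psi> \<xi>)\<^sup>2 / W \<xi>) + 1 / (2 * l) * (W \<xi> * G \<xi>))" for \<xi>
        unfolding real_norm_def by (rule order.trans[OF N_le abs_ge_self])
    qed measurable
    have err: "\<bar>quad_error p P w (\<lambda>x. g (x - x0))\<bar> \<le> (A + K) * (h powr r * \<rho> powr (D / 2 - r))"
    proof -
      have "\<bar>quad_error p P w (\<lambda>x. g (x - x0))\<bar> = \<bar>LBINT \<xi>. N \<xi>\<bar>"
        unfolding quad_error_translate[OF p(1) P(1) \<psi>_int g] N_def ..
      also have "\<dots> \<le> (LBINT \<xi>. l / 2 * ((\<psi> \<xi>)\<^sup>2 / W \<xi>) + 1 / (2 * l) * (W \<xi> * G \<xi>))"
        by (rule integral_abs_bound_integral[OF N_int bnd_int N_le])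
      also have "\<dots> = l / 2 * (LBINT \<xi>. (\<psi> \<xi>)\<^sup>2 / W \<xi>) + 1 / (2 * l) * (LBINT \<xi>. W \<xi> * G \<xi>)"
        unfolding Bochner_Integration.integral_add[OF integrable_mult_right[OF E_int] integrable_mult_right[OF WG_int]]
          integral_mult_right_zero ..
      also have "\<dots> \<le> l / 2 * (A * \<rho> powr (D - 2 * r)) + 1 / (2 * l) * (K * h powr (2 * r))"
        using l E J by (intro add_mono mult_left_mono) (auto simp: W_def G_def)
      also have "\<dots> = (A + K) / 2 * (h powr r * \<rho> powr (D / 2 - r))"
      proof -
        have e1: "l * \<rho> powr (D - 2 * r) = h powr r * \<rho> powr (D / 2 - r)"
          by (simp add: l_def mult.assoc powr_add[symmetric])
        have e2: "h powr (2 * r) / l = h powr r * \<rho> powr (D / 2 - r)"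
        proof -
          have "h powr (2 * r) = h powr r * h powr r" by (simp add: powr_add[symmetric])
          then have "h powr (2 * r) / l = h powr r * (1 / \<rho> powr (r - D / 2))"
            using h by (simp add: l_def)
          also have "1 / \<rho> powr (r - D / 2) = \<rho> powr (D / 2 - r)"
            by (simp add: powr_minus_divide[symmetric])
          finally show ?thesis .
        qed
        have "l / 2 * (A * \<rho> powr (D - 2 * r)) + 1 / (2 * l) * (K * h powr (2 * r)) =
            A / 2 * (l * \<rho> powr (D - 2 * r)) + K / 2 * (h powr (2 * r) / l)" by simp
        also have "\<dots> = (A + K) / 2 * (h powr r * \<rho> powr (D / 2 - r))"
          unfolding e1 e2 by (simp add: add_divide_distrib distrib_right)
        finally show ?thesis .
      qed
      also have "\<dots> \<le> (A + K) * (h powr r * \<rho> powr (D / 2 - r))"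
        using A K h \<rho> by (intro mult_right_mono) auto
      finally show ?thesis .
    qed
    have gm [measurable]: "g \<in> borel_measurable borel" unfolding g_def[abs_def] by measurable
    have g_abs_int: "integrable lborel (\<lambda>x. \<bar>g (x - x0)\<bar>)" and g_abs: "(LBINT x. \<bar>g (x - x0)\<bar>) = \<rho> ^ DIM('a) * A1"
    proof -
      have \<phi>a: "integrable lborel (\<lambda>x. \<bar>\<phi> x\<bar>)" using \<phi>(2) by simp
      have e: "\<bar>g (x - x0)\<bar> = \<bar>\<phi> (- (1 / \<rho>) *\<^sub>R x0 + (1 / \<rho>) *\<^sub>R x)\<bar>" for x
        by (simp add: g_def scaleR_diff_right)
      show "integrable lborel (\<lambda>x. \<bar>g (x - x0)\<bar>)"
        unfolding e using \<rho> by (intro integrable_lborel_affine[OF _ \<phi>a]) auto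
      have "A1 = \<bar>1 / \<rho>\<bar> ^ DIM('a) *\<^sub>R (LBINT x. \<bar>\<phi> (- (1 / \<rho>) *\<^sub>R x0 + (1 / \<rho>) *\<^sub>R x)\<bar>)"
        unfolding A1_def using \<rho> by (intro integral_lborel_affine) auto
      then show "(LBINT x. \<bar>g (x - x0)\<bar>) = \<rho> ^ DIM('a) * A1"
        unfolding e using \<rho> by (simp add: power_one_over)
    qed
    have mean: "\<bar>LBINT x. p x * g (x - x0)\<bar> \<le> B * (\<rho> ^ DIM('a) * A1)"
    proof -
      have "\<bar>LBINT x. p x * g (x - x0)\<bar> \<le> (LBINT x. B * \<bar>g (x - x0)\<bar>)"
      proof (rule integral_abs_bound_integral)
        show "integrable lborel (\<lambda>x. p x * g (x - x0))"
          by (rule integrable_mult_bounded[OF p(1), of _ B0]) (simp, simp add: g_def \<phi>)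
      qed (use p g_abs_int in \<open>auto simp: abs_mult intro!: mult_right_mono\<close>)
      then show ?thesis by (simp add: g_abs)
    qed
    have node: "(\<Sum>x\<in>P. w x * g (x - x0)) = w x0"
    proof -
      have "g (x - x0) = (if x = x0 then 1 else 0)" if "x \<in> P" for x
      proof (cases "x = x0")
        case False
        have "L = (1 / \<rho>) * (2 * q)" using q L by (simp add: \<rho>_def \<mu>_def)
        also have "\<dots> \<le> (1 / \<rho>) * norm (x - x0)" using P(3)[OF that False] \<rho> by (intro mult_left_mono) auto
        also have "\<dots> = norm ((1 / \<rho>) *\<^sub>R (x - x0))" using \<rho> by simp
        finally show ?thesis using False L(2) by (simp add: g_def)
      qed (simp add: g_def \<phi>)
      then have "(\<Sum>x\<in>P. w x * g (x - x0)) = (\<Sum>x\<in>P. if x = x0 then w x0 else 0)"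
        by (intro sum.cong) auto
      then show ?thesis using P by simp
    qed
    have "\<bar>w x0\<bar> \<le> \<bar>LBINT x. p x * g (x - x0)\<bar> + \<bar>quad_error p P w (\<lambda>x. g (x - x0))\<bar>"
      unfolding quad_error_def node by linarith
    also have "\<dots> \<le> B * (\<rho> ^ DIM('a) * A1) + (A + K) * (h powr r * \<rho> powr (D / 2 - r))"
      by (intro add_mono mean err)
    also have "\<dots> = (B * \<mu> ^ DIM('a) * A1) * q ^ DIM('a) + ((A + K) * \<mu> powr (D / 2 - r)) * (h powr r * q powr (D / 2 - r))"
      by (simp add: \<rho>_def power_mult_distrib powr_mult mult_ac)
    also have "\<dots> \<le> C * q ^ DIM('a) + (C * (1 + K)) * (h powr r * q powr (D / 2 - r))"
    proof (intro add_mono mult_right_mono)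
      have "A + K \<le> (A + 1) * (1 + K)" using A K by (simp add: algebra_simps)
      then have "(A + K) * \<mu> powr (D / 2 - r) \<le> ((A + 1) * (1 + K)) * \<mu> powr (D / 2 - r)"
        by (intro mult_right_mono) auto
      also have "\<dots> = ((A + 1) * \<mu> powr (D / 2 - r)) * (1 + K)" by simp
      also have "\<dots> \<le> C * (1 + K)" using C K by (intro mult_right_mono) auto
      finally show "(A + K) * \<mu> powr (D / 2 - r) \<le> C * (1 + K)" .
    qed (use C q h in auto)
    finally show ?thesis by (simp add: D_def)
  qed
  note main = this
  show ?thesis
  proof (rule exI[of _ C], rule exI[of _ "L / 2"], intro conjI allI impI)
    show "L / 2 > 0" using L by simp
  next
    fix P w x0 q h K
    assume "finite P" "x0 \<in> P" "\<forall>x\<in>P. x \<noteq> x0 \<longrightarrow> norm (x - x0) \<ge> 2 * q" "0 < q" "q \<le> L / 2" "0 < h" "0 \<le> K"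
      "(LBINT \<xi>. (1 + (norm \<xi>)\<^sup>2) powr (- r) * error_spectrum p P w \<xi>) \<le> K * h powr (2 * r)"
    then show "\<bar>w x0\<bar> \<le> C * q ^ DIM('a) + C * (1 + K) * (h powr r * q powr (DIM('a) / 2 - r))"
      by (intro main) auto
  qed (rule C)
qed

section \<open>Weights of the optimal rule\<close>

text \<open>
  The weight bound for a rule satisfying the optimality conditions. Its spectrum, integrated against the transform of
  \<open>\<Phi>\<close>, is at most that of the rule made from local rules; the two-sided bounds on the transform
  carry this over to the Sobolev weight at the price of a factor \<open>a2 / a1\<close>.
\<close>

lemma optimal_weights_bounded:
  fixes \<Omega> :: "'a::euclidean_space set" and p \<Phi> :: "'a \<Rightarrow> real"
  assumes \<kappa>: "0 < \<kappa>" "\<kappa> < 1" and T0: "T0 > 0"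
    and balls: "\<forall>x\<in>\<Omega>. \<forall>T. 0 < T \<and> T \<le> T0 \<longrightarrow> (\<exists>y. norm (y - x) = T \<and> cball y (\<kappa> * T) \<subseteq> \<Omega>)"
    and p: "integrable lborel p" "\<And>x. 0 \<le> p x" "\<And>x. p x \<le> B" and supp: "\<forall>x. x \<notin> \<Omega> \<longrightarrow> p x = 0"
    and \<Phi>: "continuous_on UNIV \<Phi>" "integrable lborel \<Phi>" "\<And>x. \<bar>\<Phi> x\<bar> \<le> S" "\<And>x. \<Phi> (- x) = \<Phi> x"
    and psd: "\<forall>P c. finite P \<longrightarrow> (\<Sum>x\<in>P. \<Sum>y\<in>P. c x * c y * \<Phi> (x - y)) \<ge> 0"
    and r: "r > real DIM('a) / 2" and a: "a1 > 0" "a2 > 0"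
    and low: "\<And>\<xi>. a1 * (1 + (norm \<xi>)\<^sup>2) powr (- r) \<le> (LBINT x. \<Phi> x * cos (\<xi> \<bullet> x))"
    and upp: "\<And>\<xi>. (LBINT x. \<Phi> x * cos (\<xi> \<bullet> x)) \<le> a2 * (1 + (norm \<xi>)\<^sup>2) powr (- r)"
  shows "\<exists>C h0. C > 0 \<and> h0 > 0 \<and> (\<forall>P w q h. finite P \<longrightarrow> P \<subseteq> \<Omega> \<longrightarrow> 0 < q \<longrightarrow> q \<le> h \<longrightarrow> h \<le> h0 \<longrightarrow>
     (\<forall>x\<in>\<Omega>. \<exists>y\<in>P. norm (x - y) \<le> h) \<longrightarrow> (\<forall>x\<in>P. \<forall>y\<in>P. x \<noteq> y \<longrightarrow> norm (x - y) \<ge> 2 * q) \<longrightarrow>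
     (\<forall>x\<in>P. quad_error p P w (\<lambda>y. \<Phi> (y - x)) = 0) \<longrightarrow>
     (\<forall>x\<in>P. \<bar>w x\<bar> \<le> C * (h / q) powr (r - DIM('a) / 2) * h powr (DIM('a) / 2)))"
proof -
  define D where "D = real DIM('a)"
  have D: "D > 0" by (simp add: D_def)
  have r0: "r > 0" using r D by (simp add: D_def)
  \<comment> \<open>The order of exactness; above \<open>2 r\<close> it makes the energies at large scales integrable against \<open>t powr (r - 1)\<close>.\<close>
  define M where "M = nat \<lfloor>2 * r\<rfloor> + 1"
  have M: "real M > 2 * r" using r0 by (simp add: M_def) linarith
  define F where "F \<xi> = (LBINT x. \<Phi> x * cos (\<xi> \<bullet> x))" for \<xi>
  define W where "W \<xi> = (1 + (norm \<xi>)\<^sup>2) powr (- r)" for \<xi> :: 'a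
  have W_int: "integrable lborel W" unfolding W_def using r by (rule integrable_bessel_weight)
  have W0: "W \<xi> \<ge> 0" for \<xi> by (simp add: W_def)
  have F_low: "a1 * W \<xi> \<le> F \<xi>" and F_upp: "F \<xi> \<le> a2 * W \<xi>" for \<xi>
    using low upp by (auto simp: F_def W_def)
  have [measurable]: "\<Phi> \<in> borel_measurable borel" using \<Phi> by auto
  have Fm [measurable]: "F \<in> borel_measurable borel" unfolding F_def[abs_def] by measurable
  have F_int: "integrable lborel F"
  proof (rule Bochner_Integration.integrable_bound[OF _ _ AE_I2])
    show "integrable lborel (\<lambda>\<xi>. a2 * W \<xi>)" using W_int by simp
    show "norm (F \<xi>) \<le> norm (a2 * W \<xi>)" for \<xi>
    proof -
      have "0 \<le> a1 * W \<xi>" using a W0 by simp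
      then show ?thesis using F_low[of \<xi>] F_upp[of \<xi>] by simp
    qed
  qed measurable
  define \<psi> where "\<psi> \<xi> = F \<xi> / (2 * pi) ^ DIM('a)" for \<xi>
  have \<psi>_int: "integrable lborel \<psi>" unfolding \<psi>_def using F_int by simp
  have \<Phi>_eq: "\<Phi> z = (LBINT \<xi>. \<psi> \<xi> * cos (\<xi> \<bullet> z))" for z
    using cos_inversion[OF \<Phi> F_int[unfolded F_def[abs_def]], of z] by (simp add: \<psi>_def F_def)
  obtain C1 h1 where C1: "C1 > 0" and h1: "h1 > 0" and quad: "\<forall>P h. finite P \<longrightarrow> P \<subseteq> \<Omega> \<longrightarrow> 0 < h \<longrightarrow> h \<le> h1 \<longrightarrow>
     (\<forall>x\<in>\<Omega>. \<exists>y\<in>P. norm (x - y) \<le> h) \<longrightarrow>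
     (\<exists>w. gauss_rule p P M C1 h w)"
    using quadrature_for_gaussians[OF \<kappa> T0 balls p supp, of M] by (elim exE conjE) (erule (2) that)
  obtain C2 L where C2: "C2 > 0" and L: "L > 0" and bump: "\<forall>P w x0 q h K. finite P \<longrightarrow> x0 \<in> P \<longrightarrow>
     (\<forall>x\<in>P. x \<noteq> x0 \<longrightarrow> norm (x - x0) \<ge> 2 * q) \<longrightarrow> 0 < q \<longrightarrow> q \<le> L \<longrightarrow> 0 < h \<longrightarrow> 0 \<le> K \<longrightarrow>
     (LBINT \<xi>. (1 + (norm \<xi>)\<^sup>2) powr (- r) * error_spectrum p P w \<xi>) \<le> K * h powr (2 * r) \<longrightarrow>
     \<bar>w x0\<bar> \<le> C2 * q ^ DIM('a) + C2 * (1 + K) * (h powr r * q powr (DIM('a) / 2 - r))"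
    using weight_le_bump[OF p r] by (elim exE conjE) (erule (2) that)
  define K1 where "K1 = ((LBINT x. p x) + C1) * pi powr (DIM('a) / 2) * C1 * (1 / (r - DIM('a) / 2) + 1 / (M / 2 - r)) / Gamma r"
  have I: "(LBINT x. p x) \<ge> 0" using p by (intro integral_nonneg_AE) auto
  have K1: "K1 \<ge> 0"
    unfolding K1_def using I C1 r M r0 by (intro divide_nonneg_pos mult_nonneg_nonneg add_nonneg_nonneg) (auto simp: Gamma_real_pos)
  define K where "K = a2 / a1 * K1"
  have K: "K \<ge> 0" using a K1 by (simp add: K_def)
  define C where "C = C2 + C2 * (1 + K)"
  have C: "C > 0" using C2 K by (simp add: C_def add_pos_nonneg)
  \<comment> \<open>\<open>h \<le> 1\<close> serves to absorb \<open>q ^ d\<close> into \<open>h powr (d/2)\<close>.\<close>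
  define h0 where "h0 = min (min h1 L) 1"
  have h0: "h0 > 0" using h1 L by (simp add: h0_def)
  have "\<bar>w x0\<bar> \<le> C * (h / q) powr (r - DIM('a) / 2) * h powr (DIM('a) / 2)"
    if P: "finite P" "P \<subseteq> \<Omega>" and q: "0 < q" "q \<le> h" and h: "h \<le> h0" and fill: "\<forall>x\<in>\<Omega>. \<exists>y\<in>P. norm (x - y) \<le> h"
      and sep: "\<forall>x\<in>P. \<forall>y\<in>P. x \<noteq> y \<longrightarrow> norm (x - y) \<ge> 2 * q"
      and opt: "\<forall>x\<in>P. quad_error p P w (\<lambda>y. \<Phi> (y - x)) = 0" and x0: "x0 \<in> P" for P w q h x0
  proof -
    have hpos: "0 < h" "h \<le> h1" "h \<le> L" "h \<le> 1" using q h by (auto simp: h0_def)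
    obtain v where v: "(\<Sum>x\<in>P. \<bar>v x\<bar>) \<le> C1"
        "\<And>\<tau> x'. h \<le> \<tau> \<Longrightarrow> \<bar>quad_error p P v (\<lambda>x. gauss (4 * \<tau>\<^sup>2) (x - x'))\<bar>
            \<le> C1 * (h / \<tau>) ^ M * \<tau> ^ DIM('a)"
        "\<And>x'. (LBINT x. p x * gauss (4 * h\<^sup>2) (x - x'))
            + (\<Sum>x\<in>P. \<bar>v x\<bar> * gauss (4 * h\<^sup>2) (x - x')) \<le> C1 * h ^ DIM('a)"
    proof -
      from quad[THEN spec, THEN spec, THEN mp, THEN mp, THEN mp, THEN mp, THEN mp, OF P hpos(1,2) fill]
      show ?thesis by (elim exE conjE) (rule that, assumption, blast, blast)
    qed
    have WD_int: "integrable lborel (\<lambda>\<xi>. W \<xi> * error_spectrum p P u \<xi>)" for u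
      by (rule integrable_error_spectrum[OF p(1) P(1) W_int refl])
    have \<psi>D_int: "integrable lborel (\<lambda>\<xi>. \<psi> \<xi> * error_spectrum p P u \<xi>)" for u
      by (rule integrable_error_spectrum[OF p(1) P(1) \<psi>_int \<Phi>_eq])
    have Jv: "(LBINT \<xi>. W \<xi> * error_spectrum p P v \<xi>) \<le> K1 * (h\<^sup>2) powr r"
    proof -
      have "ennreal (LBINT \<xi>. W \<xi> * error_spectrum p P v \<xi>) = (\<integral>\<^sup>+\<xi>. ennreal (W \<xi> * error_spectrum p P v \<xi>) \<partial>lborel)"
        by (rule nn_integral_eq_integral[OF WD_int, symmetric]) (simp add: W0 error_spectrum_nonneg)
      also have "\<dots> = (\<integral>\<^sup>+\<xi>. ennreal (error_spectrum p P v \<xi>) * ennreal ((1 + (norm \<xi>)\<^sup>2) powr (- r)) \<partial>lborel)"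
        by (intro nn_integral_cong) (simp add: W_def ennreal_mult'[symmetric] error_spectrum_nonneg mult.commute)
      also have "\<dots> \<le> ennreal (K1 * (h\<^sup>2) powr r)"
        unfolding K1_def by (rule weighted_error_spectrum_le[OF p(1,2) P(1) hpos(1) r M C1 v])
      finally show ?thesis using K1 by (simp add: ennreal_le_iff)
    qed
    have le: "(LBINT \<xi>. \<psi> \<xi> * error_spectrum p P w \<xi>) \<le> (LBINT \<xi>. \<psi> \<xi> * error_spectrum p P v \<xi>)"
      unfolding quad_error_twice[OF p(1) P(1) \<psi>_int \<Phi>_eq, symmetric]
      by (rule optimal_quad_error_le[OF p(1) P(1) _ \<Phi>(3,4) psd[THEN spec, THEN spec, THEN mp, OF P(1)]]) (use opt in auto)
    define b where "b = (2 * pi) ^ DIM('a)"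
    have b: "b > 0" by (simp add: b_def)
    have "a1 / b * (LBINT \<xi>. W \<xi> * error_spectrum p P w \<xi>) = (LBINT \<xi>. a1 / b * (W \<xi> * error_spectrum p P w \<xi>))"
      by (simp only: integral_mult_right_zero)
    also have "\<dots> \<le> (LBINT \<xi>. \<psi> \<xi> * error_spectrum p P w \<xi>)"
    proof (intro integral_mono integrable_mult_right WD_int \<psi>D_int)
      fix \<xi>
      have "a1 * W \<xi> / b * error_spectrum p P w \<xi> \<le> F \<xi> / b * error_spectrum p P w \<xi>"
        using b F_low by (intro mult_right_mono divide_right_mono) (auto simp: error_spectrum_nonneg)
      then show "a1 / b * (W \<xi> * error_spectrum p P w \<xi>) \<le> \<psi> \<xi> * error_spectrum p P w \<xi>"
        by (simp add: \<psi>_def b_def)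
    qed
    also note le
    also have "(LBINT \<xi>. \<psi> \<xi> * error_spectrum p P v \<xi>) \<le> (LBINT \<xi>. a2 / b * (W \<xi> * error_spectrum p P v \<xi>))"
    proof (intro integral_mono integrable_mult_right WD_int \<psi>D_int)
      fix \<xi>
      have "F \<xi> / b * error_spectrum p P v \<xi> \<le> a2 * W \<xi> / b * error_spectrum p P v \<xi>"
        using b F_upp by (intro mult_right_mono divide_right_mono) (auto simp: error_spectrum_nonneg)
      then show "\<psi> \<xi> * error_spectrum p P v \<xi> \<le> a2 / b * (W \<xi> * error_spectrum p P v \<xi>)"
        by (simp add: \<psi>_def b_def)
    qed
    also have "\<dots> = a2 / b * (LBINT \<xi>. W \<xi> * error_spectrum p P v \<xi>)"
      by (simp only: integral_mult_right_zero)
    also have "\<dots> \<le> a2 / b * (K1 * (h\<^sup>2) powr r)"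
      using a b Jv by (intro mult_left_mono) auto
    finally have "a1 / b * (LBINT \<xi>. W \<xi> * error_spectrum p P w \<xi>) \<le> a1 / b * (K * (h\<^sup>2) powr r)"
      using a by (simp add: K_def)
    moreover have "a1 / b > 0" using a b by simp
    ultimately have "(LBINT \<xi>. W \<xi> * error_spectrum p P w \<xi>) \<le> K * (h\<^sup>2) powr r"
      by (rule mult_left_le_imp_le)
    also have "(h\<^sup>2) powr r = h powr (2 * r)"
    proof -
      have "(h\<^sup>2) powr r = (h powr 2) powr r" using hpos by simp
      then show ?thesis by (simp add: powr_powr)
    qed
    finally have Jw: "(LBINT \<xi>. (1 + (norm \<xi>)\<^sup>2) powr (- r) * error_spectrum p P w \<xi>) \<le> K * h powr (2 * r)"
      by (simp add: W_def)
    have "\<bar>w x0\<bar> \<le> C2 * q ^ DIM('a) + C2 * (1 + K) * (h powr r * q powr (DIM('a) / 2 - r))"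
    proof (rule bump[THEN spec, THEN spec, THEN spec, THEN spec, THEN spec, THEN spec, THEN mp, THEN mp,
          THEN mp, THEN mp, THEN mp, THEN mp, THEN mp, THEN mp, OF P(1) x0 _ q(1) _ hpos(1) K Jw])
      show "\<forall>x\<in>P. x \<noteq> x0 \<longrightarrow> norm (x - x0) \<ge> 2 * q" using sep x0 by blast
      show "q \<le> L" using q hpos by linarith
    qed
    also have "h powr r * q powr (DIM('a) / 2 - r) = (h / q) powr (r - D / 2) * h powr (D / 2)"
    proof -
      have "(h / q) powr (r - D / 2) = h powr (r - D / 2) * q powr (D / 2 - r)"
      proof -
        have "(h / q) powr (r - D / 2) = h powr (r - D / 2) * (1 / q powr (r - D / 2))"
          using q hpos by (simp add: powr_divide)
        also have "1 / q powr (r - D / 2) = q powr (D / 2 - r)"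
          by (simp add: powr_minus_divide[symmetric])
        finally show ?thesis .
      qed
      moreover have "h powr (r - D / 2) * h powr (D / 2) = h powr r" by (simp add: powr_add[symmetric])
      ultimately show ?thesis by (simp add: D_def mult_ac)
    qed
    also have "C2 * q ^ DIM('a) \<le> C2 * ((h / q) powr (r - D / 2) * h powr (D / 2))"
    proof (rule mult_left_mono)
      have "q ^ DIM('a) = q powr D" using q by (simp add: D_def powr_realpow)
      also have "\<dots> \<le> h powr D" using q D by (intro powr_mono2) auto
      also have "\<dots> \<le> h powr (D / 2)" using hpos D by (intro powr_mono') auto
      also have "\<dots> = 1 * h powr (D / 2)" by simp
      also have "\<dots> \<le> (h / q) powr (r - D / 2) * h powr (D / 2)"
        using q r by (intro mult_right_mono ge_one_powr_ge_zero) (auto simp: D_def)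
      finally show "q ^ DIM('a) \<le> (h / q) powr (r - D / 2) * h powr (D / 2)" .
    qed (use C2 in simp)
    finally show ?thesis by (simp add: C_def D_def algebra_simps)
  qed
  note main = this
  show ?thesis
  proof (rule exI[of _ C], rule exI[of _ h0], intro conjI allI impI ballI C h0)
    fix P w q h x
    assume "finite P" "P \<subseteq> \<Omega>" "0 < q" "q \<le> h" "h \<le> h0" "\<forall>x\<in>\<Omega>. \<exists>y\<in>P. norm (x - y) \<le> h"
      "\<forall>x\<in>P. \<forall>y\<in>P. x \<noteq> y \<longrightarrow> norm (x - y) \<ge> 2 * q"
      "\<forall>x\<in>P. quad_error p P w (\<lambda>y. \<Phi> (y - x)) = 0" "x \<in> P"
    then show "\<bar>w x\<bar> \<le> C * (h / q) powr (r - DIM('a) / 2) * h powr (DIM('a) / 2)"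
      by (rule main)
  qed
qed

section \<open>Gram systems, point sets and densities\<close>

lemma bij_betw_nth_set: "distinct xs \<Longrightarrow> bij_betw ((!) xs) {..<length xs} (set xs)"
  by (rule bij_betw_nth) auto

lemma sum_set_conv_nth: "distinct xs \<Longrightarrow> (\<Sum>x\<in>set xs. f x) = (\<Sum>i<length xs. f (xs ! i))"
  using sum.reindex_bij_betw[OF bij_betw_nth_set, of xs f] by simp

lemma gram_mat_mult_vec:
  assumes "v \<in> carrier_vec (length xs)" "i < length xs"
  shows "vec_index (gram_mat k xs *\<^sub>v v) i = (\<Sum>j<length xs. k (xs ! j) (xs ! i) * vec_index v j)"
  using assms unfolding gram_mat_def
  by (simp add: scalar_prod_def atLeast0LessThan)

text \<open>
  A vector in the kernel of the Gram matrix would make the positive definite form vanish, so the Gram matrix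
  is invertible and \<open>bq_weights\<close> solves the linear system.
\<close>

lemma bq_weight_system:
  fixes \<Phi> :: "'a::real_vector \<Rightarrow> real"
  assumes pd: "positive_definite_function \<Phi>" and k: "\<And>x x'. k x x' = \<Phi> (x - x')"
    and xs: "distinct xs" and i: "i < length xs"
  shows "(\<Sum>j<length xs. bq_weight k \<nu> xs j * k (xs ! j) (xs ! i)) = kernel_mean k \<nu> (xs ! i)"
proof -
  let ?n = "length xs" and ?A = "gram_mat k xs"
  have A: "?A \<in> carrier_mat ?n ?n" by (simp add: gram_mat_def)
  have "det ?A \<noteq> 0"
  proof
    assume "det ?A = 0"
    then obtain v where v: "v \<in> carrier_vec ?n" "v \<noteq> 0\<^sub>v ?n" "?A *\<^sub>v v = 0\<^sub>v ?n"
      using det_0_iff_vec_prod_zero_field[OF A] by blast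
    define c where "c x = vec_index v (inv_into {..<?n} ((!) xs) x)" for x
    have c: "c (xs ! j) = vec_index v j" if "j < ?n" for j
      unfolding c_def using that bij_betw_inv_into_left[OF bij_betw_nth_set[OF xs], of j] by simp
    have "\<exists>j<?n. vec_index v j \<noteq> 0"
    proof (rule ccontr)
      assume "\<not> (\<exists>j<?n. vec_index v j \<noteq> 0)"
      then have "v = 0\<^sub>v ?n" using v(1) by (intro eq_vecI) auto
      then show False using v(2) by simp
    qed
    then have "\<exists>x\<in>set xs. c x \<noteq> 0" using c by (metis nth_mem)
    then have "0 < (\<Sum>x\<in>set xs. \<Sum>y\<in>set xs. c x * c y * \<Phi> (x - y))"
      using pd unfolding positive_definite_function_def by blast
    also have "\<dots> = (\<Sum>y\<in>set xs. \<Sum>x\<in>set xs. c x * c y * \<Phi> (x - y))" by (rule sum.swap)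
    also have "\<dots> = (\<Sum>l<?n. vec_index v l * (\<Sum>j<?n. k (xs ! j) (xs ! l) * vec_index v j))"
      unfolding sum_set_conv_nth[OF xs] by (simp add: c k sum_distrib_left mult_ac)
    also have "\<dots> = (\<Sum>l<?n. vec_index v l * vec_index (?A *\<^sub>v v) l)"
      by (intro sum.cong refl) (simp add: gram_mat_mult_vec[OF v(1)])
    also have "\<dots> = 0" unfolding v(3) by simp
    finally show False by simp
  qed
  then have "?A \<in> Units (ring_mat TYPE(real) ?n ())" by (rule det_non_zero_imp_unit[OF A])
  then obtain B where B: "mat_inverse ?A = Some B"
    using mat_inverse(1)[OF A, where b = "()"] by (cases "mat_inverse ?A") auto
  have AB: "?A * B = 1\<^sub>m ?n" and Bc: "B \<in> carrier_mat ?n ?n" using mat_inverse(2)[OF A B] by auto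
  let ?b = "kernel_mean_vec k \<nu> xs"
  have b: "?b \<in> carrier_vec ?n" by (simp add: kernel_mean_vec_def)
  have w: "bq_weights k \<nu> xs = B *\<^sub>v ?b" by (simp add: bq_weights_def B)
  have wc: "bq_weights k \<nu> xs \<in> carrier_vec ?n" unfolding w using Bc b by auto
  have "?A *\<^sub>v bq_weights k \<nu> xs = (?A * B) *\<^sub>v ?b" unfolding w using A Bc b by (simp add: assoc_mult_mat_vec)
  also have "\<dots> = ?b" unfolding AB using b by simp
  finally have "vec_index (?A *\<^sub>v bq_weights k \<nu> xs) i = vec_index ?b i" by simp
  then show ?thesis
    using i by (simp add: gram_mat_mult_vec[OF wc i] kernel_mean_vec_def bq_weight_def mult.commute)
qed

lemma fill_distance_cover:
  assumes \<Omega>: "bounded \<Omega>" and P: "finite P" "P \<noteq> {}" and x: "x \<in> \<Omega>"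
  shows "\<exists>y\<in>P. norm (x - y) \<le> fill_distance P \<Omega>"
proof -
  let ?m = "\<lambda>x. Min ((\<lambda>y. norm (x - y)) ` P)"
  obtain y0 where y0: "y0 \<in> P" using P by blast
  obtain R where R: "\<And>x. x \<in> \<Omega> \<Longrightarrow> norm x \<le> R" using \<Omega> by (auto simp: bounded_iff)
  have "bdd_above (?m ` \<Omega>)"
  proof (rule bdd_aboveI2)
    fix z assume "z \<in> \<Omega>"
    have "?m z \<le> norm (z - y0)" using P y0 by (intro Min_le) auto
    also have "\<dots> \<le> norm z + norm y0" by (rule norm_triangle_ineq4)
    also have "\<dots> \<le> R + norm y0" using R[OF \<open>z \<in> \<Omega>\<close>] by simp
    finally show "?m z \<le> R + norm y0" .
  qed
  then have "?m x \<le> fill_distance P \<Omega>"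
    unfolding fill_distance_def using x by (intro cSUP_upper)
  moreover have "?m x \<in> (\<lambda>y. norm (x - y)) ` P" using P by (intro Min_in) auto
  ultimately show ?thesis by auto
qed

lemma separation_distance_properties:
  assumes P: "finite P" "card P \<ge> 2"
  shows "separation_distance P > 0"
    and "\<And>x y. x \<in> P \<Longrightarrow> y \<in> P \<Longrightarrow> x \<noteq> y \<Longrightarrow> 2 * separation_distance P \<le> norm (x - y)"
proof -
  let ?S = "{norm (x - y) |x y. x \<in> P \<and> y \<in> P \<and> x \<noteq> y}"
  have "?S \<subseteq> (\<lambda>(x, y). norm (x - y)) ` (P \<times> P)" by auto
  then have fin: "finite ?S" using P(1) by (meson finite_SigmaI finite_imageI finite_subset)
  obtain x where x: "x \<in> P" using P(2) by (cases "P = {}") auto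
  have "P \<noteq> {x}" using P(2) by auto
  then obtain y where y: "y \<in> P" "y \<noteq> x" using x by blast
  then have ne: "?S \<noteq> {}" using x by blast
  show "separation_distance P > 0"
    unfolding separation_distance_def using Min_in[OF fin ne] by auto
  show "2 * separation_distance P \<le> norm (x - y)" if "x \<in> P" "y \<in> P" "x \<noteq> y" for x y
  proof -
    have "Min ?S \<le> norm (x - y)" using that by (intro Min_le fin) blast
    then show ?thesis by (simp add: separation_distance_def)
  qed
qed

text \<open>
  A point of \<open>\<Omega>\<close> at distance \<open>min q T0\<close> from the node \<open>x\<close> is at least that far from every node.
\<close>

lemma separation_le_cover_radius:
  fixes \<Omega> :: "'a::real_normed_vector set"
  assumes T0: "T0 > 0" and ring: "\<And>T. 0 < T \<Longrightarrow> T \<le> T0 \<Longrightarrow> \<exists>y\<in>\<Omega>. norm (y - x) = T"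
    and sep: "\<And>z. z \<in> P \<Longrightarrow> z \<noteq> x \<Longrightarrow> norm (x - z) \<ge> 2 * q" and q: "q > 0"
    and cover: "\<And>y. y \<in> \<Omega> \<Longrightarrow> \<exists>z\<in>P. norm (y - z) \<le> h" and h: "h < T0"
  shows "q \<le> h"
proof -
  define T where "T = min q T0"
  have T: "0 < T" "T \<le> T0" "T \<le> q" using q T0 by (auto simp: T_def)
  obtain y where y: "y \<in> \<Omega>" "norm (y - x) = T" using ring[OF T(1,2)] by blast
  obtain z where z: "z \<in> P" "norm (y - z) \<le> h" using cover[OF y(1)] by blast
  have "T \<le> norm (y - z)"
  proof (cases "z = x")
    case False
    have "norm (x - z) \<le> norm (y - z) + norm (y - x)"
      using norm_triangle_ineq4[of "y - z" "y - x"] by simp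
    then show ?thesis using sep[OF z(1) False] y(2) T by linarith
  qed (simp add: y)
  then show ?thesis using z h by (auto simp: T_def min_def split: if_splits)
qed

text \<open>
  The balls of radius \<open>q\<close> around the points are disjoint and lie in the ball of radius \<open>2 R\<close>.
\<close>

lemma card_separated_le:
  fixes P :: "'a::euclidean_space set"
  assumes P: "finite P" "\<And>x. x \<in> P \<Longrightarrow> norm x \<le> R" and q: "0 < q" "q \<le> R"
    and sep: "\<And>x y. x \<in> P \<Longrightarrow> y \<in> P \<Longrightarrow> x \<noteq> y \<Longrightarrow> 2 * q \<le> norm (x - y)"
  shows "real (card P) * q ^ DIM('a) \<le> (2 * R) ^ DIM('a)"
proof -
  define V where "V = unit_ball_vol (real DIM('a))"
  have V: "V > 0" by (simp add: V_def)
  have disj: "disjnt (ball x q) (ball y q)" if "x \<in> P" "y \<in> P" "x \<noteq> y" for x y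
    unfolding disjnt_iff
  proof (intro allI notI)
    fix z assume "z \<in> ball x q \<and> z \<in> ball y q"
    then have "norm (x - z) < q" "norm (y - z) < q" by (auto simp: dist_norm)
    then show False using norm_triangle_ineq4[of "x - z" "y - z"] sep[OF that] by simp
  qed
  have fm: "ball x s \<in> fmeasurable lborel" for x :: 'a and s
    using emeasure_bounded_finite[OF bounded_ball] by (intro fmeasurableI) auto
  have "real (card P) * (V * q ^ DIM('a)) = (\<Sum>x\<in>P. measure lborel (ball x q))"
    using q by (simp add: V_def content_ball)
  also have "\<dots> = measure lborel (\<Union>x\<in>P. ball x q)"
    by (rule measure_UNION'[symmetric]) (use P disj fm in \<open>auto simp: pairwise_def\<close>)
  also have "\<dots> \<le> measure lborel (ball (0::'a) (2 * R))"
  proof (rule measure_mono_fmeasurable)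
    show "(\<Union>x\<in>P. ball x q) \<subseteq> ball 0 (2 * R)"
    proof
      fix z assume "z \<in> (\<Union>x\<in>P. ball x q)"
      then obtain x where x: "x \<in> P" "norm (x - z) < q" by (auto simp: dist_norm)
      have "norm z \<le> norm x + norm (x - z)" using norm_triangle_ineq4[of x "x - z"] by simp
      then show "z \<in> ball 0 (2 * R)" using P(2)[OF x(1)] x(2) q by simp
    qed
  qed (use fm in \<open>auto intro!: borel_open open_UN\<close>)
  also have "\<dots> = V * (2 * R) ^ DIM('a)" using q by (simp add: V_def content_ball)
  finally have "V * (real (card P) * q ^ DIM('a)) \<le> V * (2 * R) ^ DIM('a)" by (simp add: mult_ac)
  then show ?thesis using V by simp
qed

lemma Re_fourier_transform:
  fixes f :: "real ^ 'd \<Rightarrow> real"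
  assumes f: "integrable lborel f"
  shows "Re (fourier_transform f \<xi>) = (2 * pi) powr (- (real CARD('d) / 2)) * (LBINT x. f x * cos (\<xi> \<bullet> x))"
proof -
  have [measurable]: "f \<in> borel_measurable borel" using f by auto
  have [measurable]: "(\<lambda>x. cis (- (\<xi> \<bullet> x))) \<in> borel_measurable borel"
    by (intro borel_measurable_continuous_onI continuous_intros)
  have e: "of_real (f x) * exp (- (\<i> * of_real (\<xi> \<bullet> x))) = of_real (f x) * cis (- (\<xi> \<bullet> x))" for x
    by (simp add: cis_conv_exp)
  have i: "integrable lborel (\<lambda>x. of_real (f x) * cis (- (\<xi> \<bullet> x)))"
    by (rule Bochner_Integration.integrable_bound[OF f]) (auto simp: norm_mult)
  have "(LBINT x. f x * cos (\<xi> \<bullet> x)) = (LBINT x. Re (of_real (f x) * cis (- (\<xi> \<bullet> x))))"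
    by simp
  also have "\<dots> = Re (LBINT x. of_real (f x) * cis (- (\<xi> \<bullet> x)))" by (rule integral_Re[OF i])
  finally have "Re (LBINT x. of_real (f x) * cis (- (\<xi> \<bullet> x))) = (LBINT x. f x * cos (\<xi> \<bullet> x))" ..
  then show ?thesis unfolding fourier_transform_def e by simp
qed

lemma bounded_density_extension:
  fixes \<nu> :: "'a::euclidean_space measure"
  assumes \<Omega>: "open \<Omega>" "bounded \<Omega>" and \<nu>: "has_bounded_density_on \<nu> \<Omega>"
  shows "\<exists>(p :: 'a \<Rightarrow> real) B. integrable lborel p \<and> (\<forall>x. 0 \<le> p x) \<and> (\<forall>x. p x \<le> B) \<and> (\<forall>x. x \<notin> \<Omega> \<longrightarrow> p x = 0) \<and>
     (\<forall>f \<in> borel_measurable borel. (\<integral>x. f x \<partial>\<nu>) = (LBINT x. p x * f x))"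
proof -
  obtain \<pi> B where \<pi>: "\<pi> \<in> borel_measurable (restrict_space lborel \<Omega>)" "\<And>x. x \<in> \<Omega> \<Longrightarrow> 0 \<le> \<pi> x \<and> \<pi> x \<le> B"
      and \<nu>_eq: "\<nu> = density (restrict_space lborel \<Omega>) (\<lambda>x. ennreal (\<pi> x))"
    using \<nu> unfolding has_bounded_density_on_def by blast
  have \<Omega>s [measurable]: "\<Omega> \<in> sets borel" using \<Omega> by simp
  define p where "p x = indicator \<Omega> x * \<pi> x" for x
  have pm [measurable]: "p \<in> borel_measurable borel"
    using \<pi>(1) unfolding p_def
    by (subst (asm) borel_measurable_restrict_space_iff) (auto simp: mult.commute)
  have p0: "0 \<le> p x" and pB: "p x \<le> \<bar>B\<bar>" for x
    using \<pi>(2)[of x] by (auto simp: p_def indicator_def)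
  have "integrable lborel p"
  proof (rule Bochner_Integration.integrable_bound)
    show "integrable lborel (\<lambda>x. indicator \<Omega> x * \<bar>B\<bar>)"
      using emeasure_bounded_finite[OF \<Omega>(2)] by (intro integrable_mult_left integrable_real_indicator) auto
    have "norm (p x) \<le> norm (indicator \<Omega> x * \<bar>B\<bar>)" for x
      using \<pi>(2)[of x] by (auto simp: p_def indicator_def)
    then show "AE x in lborel. norm (p x) \<le> norm (indicator \<Omega> x * \<bar>B\<bar>)" by simp
  qed simp
  moreover have "(\<integral>x. f x \<partial>\<nu>) = (LBINT x. p x * f x)" if f [measurable]: "f \<in> borel_measurable borel" for f :: "'a \<Rightarrow> real"
  proof -
    have fr: "f \<in> borel_measurable (restrict_space lborel \<Omega>)"
      by (rule measurable_restrict_space1) simp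
    have "(\<integral>x. f x \<partial>\<nu>) = (\<integral>x. \<pi> x *\<^sub>R f x \<partial>restrict_space lborel \<Omega>)"
      unfolding \<nu>_eq
      by (rule integral_density[OF fr \<pi>(1)]) (use \<pi>(2) in \<open>auto simp: AE_restrict_space_iff\<close>)
    also have "\<dots> = (LBINT x. indicator \<Omega> x *\<^sub>R (\<pi> x *\<^sub>R f x))"
      by (rule integral_restrict_space) simp
    finally show ?thesis by (simp add: p_def mult.assoc)
  qed
  ultimately show ?thesis
    using p0 pB by (intro exI[of _ p] exI[of _ "\<bar>B\<bar>"]) (auto simp: p_def)
qed

section \<open>Bayesian quadrature weights\<close>

theorem theorem5:
  fixes \<Omega> :: "(real ^ 'd) set"
    and \<nu> :: "(real ^ 'd) measure"
    and \<Phi> :: "real ^ 'd \<Rightarrow> real"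
    and k :: "real ^ 'd \<Rightarrow> real ^ 'd \<Rightarrow> real"
    and r c1 c2 :: real
    and X :: "nat \<Rightarrow> (real ^ 'd) list"
  assumes "bounded \<Omega>" and "open \<Omega>"
    and "interior_cone_condition \<Omega>" and "lipschitz_boundary \<Omega>"
    and "prob_space \<nu>" and "sets \<nu> = sets (restrict_space borel \<Omega>)"
    and "has_bounded_density_on \<nu> \<Omega>"
    and "\<And>x x'. k x x' = \<Phi> (x - x')"
    and "continuous_on UNIV \<Phi>" and "integrable lborel \<Phi>"
    and "positive_definite_function \<Phi>"
    and "r > real CARD('d) / 2" and "c1 > 0" and "c2 > 0"
    and "\<And>\<xi>. fourier_transform \<Phi> \<xi> \<in> \<real>"
    and "\<And>\<xi>. c1 * (1 + (norm \<xi>)\<^sup>2) powr (- r) \<le> Re (fourier_transform \<Phi> \<xi>)"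
    and "\<And>\<xi>. Re (fourier_transform \<Phi> \<xi>) \<le> c2 * (1 + (norm \<xi>)\<^sup>2) powr (- r)"
    and "\<And>n. n \<ge> 2 \<Longrightarrow> length (X n) = n \<and> distinct (X n) \<and> set (X n) \<subseteq> \<Omega>"
  shows "(\<exists>C>0. \<exists>h0>0. \<forall>n\<ge>2. fill_distance (set (X n)) \<Omega> \<le> h0 \<longrightarrow>
            (\<forall>i<n. \<bar>bq_weight k \<nu> (X n) i\<bar> \<le>
               C * (fill_distance (set (X n)) \<Omega> / separation_distance (set (X n)))
                     powr (r - real CARD('d) / 2)
                 * fill_distance (set (X n)) \<Omega> powr (real CARD('d) / 2))) \<and>
         (quasi_uniform (\<lambda>n. set (X n)) \<Omega> \<longrightarrow>
            (\<exists>C'>0. \<exists>n0::nat. \<forall>n\<ge>n0. \<forall>i<n. \<bar>bq_weight k \<nu> (X n) i\<bar> \<le> C' * real n powr (- 1 / 2)))"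
proof -
  define D where "D = real CARD('d)"
  have D: "D > 0" by (simp add: D_def)
  have DIM: "DIM(real ^ 'd) = CARD('d)" by simp
  obtain \<theta> R where cone: "0 < \<theta>" "\<theta> < pi / 2" "R > 0"
    "\<forall>x\<in>\<Omega>. \<exists>\<xi>. norm \<xi> = 1 \<and>
           {x + t *\<^sub>R y | y t. norm y = 1 \<and> y \<bullet> \<xi> \<ge> cos \<theta> \<and> 0 \<le> t \<and> t \<le> R} \<subseteq> \<Omega>"
    using assms(3) unfolding interior_cone_condition_def by (elim exE conjE) (erule (3) that)
  obtain \<kappa> T0 where \<kappa>: "0 < \<kappa>" "\<kappa> < 1" and T0: "T0 > 0" and
    balls: "\<forall>x\<in>\<Omega>. \<forall>T. 0 < T \<and> T \<le> T0 \<longrightarrow> (\<exists>y. norm (y - x) = T \<and> cball y (\<kappa> * T) \<subseteq> \<Omega>)"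
    using cone_contains_balls[OF cone] by (elim exE conjE) (erule (3) that)
  obtain p :: "real ^ 'd \<Rightarrow> real" and B where p_int: "integrable lborel p" and p0: "\<forall>x. 0 \<le> p x" and pB: "\<forall>x. p x \<le> B"
    and supp: "\<forall>x. x \<notin> \<Omega> \<longrightarrow> p x = 0"
    and mean: "\<forall>f\<in>borel_measurable borel. (\<integral>x. f x \<partial>\<nu>) = (LBINT x. p x * f x)"
    using bounded_density_extension[OF assms(2,1,7)] by (elim exE conjE) (erule (4) that)
  note p = p_int p0[THEN spec] pB[THEN spec]
  have pd: "(\<Sum>x\<in>P. \<Sum>y\<in>P. c x * c y * \<Phi> (x - y)) > 0" if "finite P" "\<exists>x\<in>P. c x \<noteq> 0" for P c
    using assms(11) that unfolding positive_definite_function_def by blast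
  have even: "\<Phi> (- x) = \<Phi> x" for x
    using assms(11) unfolding positive_definite_function_def by blast
  have psd: "(\<Sum>x\<in>P. \<Sum>y\<in>P. c x * c y * \<Phi> (x - y)) \<ge> 0" if "finite P" for P c
  proof (cases "\<exists>x\<in>P. c x \<noteq> 0")
    case True
    then show ?thesis using pd[OF that] by (simp add: less_imp_le)
  qed simp
  then have psd': "\<forall>P c. finite P \<longrightarrow> (\<Sum>x\<in>P. \<Sum>y\<in>P. c x * c y * \<Phi> (x - y)) \<ge> 0"
    by blast
  have \<Phi>_le: "\<bar>\<Phi> x\<bar> \<le> \<Phi> 0" for x
  proof (cases "x = 0")
    case True
    have "\<Phi> 0 \<ge> 0" using psd[of "{0}" "\<lambda>_. 1"] by simp
    then show ?thesis using True by simp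
  next
    case False
    have "0 \<le> 2 * \<Phi> 0 + 2 * \<Phi> x"
      using psd[of "{0, x}" "\<lambda>_. 1"] False even[of x] by simp
    moreover have "0 \<le> 2 * \<Phi> 0 - 2 * \<Phi> x"
      using psd[of "{0, x}" "\<lambda>z. if z = 0 then 1 else - 1"] False even[of x] by simp
    ultimately show ?thesis by linarith
  qed
  have \<Phi>m: "\<Phi> \<in> borel_measurable borel" using assms(10) by auto
  define \<gamma> where "\<gamma> = (2 * pi) powr (D / 2)"
  have \<gamma>: "\<gamma> > 0" by (simp add: \<gamma>_def)
  have FT: "(LBINT x. \<Phi> x * cos (\<xi> \<bullet> x)) = \<gamma> * Re (fourier_transform \<Phi> \<xi>)" for \<xi>
  proof -
    have "\<gamma> * (2 * pi) powr (- (D / 2)) = 1" unfolding \<gamma>_def powr_add[symmetric] by simp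
    then show ?thesis
      unfolding Re_fourier_transform[OF assms(10)] D_def[symmetric] mult.assoc[symmetric] by simp
  qed
  obtain C h0 where C: "C > 0" and h0: "h0 > 0" and
    key: "\<forall>P w q h. finite P \<longrightarrow> P \<subseteq> \<Omega> \<longrightarrow> 0 < q \<longrightarrow> q \<le> h \<longrightarrow> h \<le> h0 \<longrightarrow>
     (\<forall>x\<in>\<Omega>. \<exists>y\<in>P. norm (x - y) \<le> h) \<longrightarrow> (\<forall>x\<in>P. \<forall>y\<in>P. x \<noteq> y \<longrightarrow> norm (x - y) \<ge> 2 * q) \<longrightarrow>
     (\<forall>x\<in>P. quad_error p P w (\<lambda>y. \<Phi> (y - x)) = 0) \<longrightarrow>
     (\<forall>x\<in>P. \<bar>w x\<bar> \<le> C * (h / q) powr (r - DIM(real ^ 'd) / 2) * h powr (DIM(real ^ 'd) / 2))"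
  proof -
    have rD: "r > real DIM(real ^ 'd) / 2" using assms(12) by simp
    have pos: "\<gamma> * c1 > 0" "\<gamma> * c2 > 0" using \<gamma> assms(13,14) by simp_all
    have low: "\<gamma> * c1 * (1 + (norm \<xi>)\<^sup>2) powr (- r) \<le> (LBINT x. \<Phi> x * cos (\<xi> \<bullet> x))" for \<xi>
      unfolding FT mult.assoc using \<gamma> by (intro mult_left_mono assms(16)) auto
    have upp: "(LBINT x. \<Phi> x * cos (\<xi> \<bullet> x)) \<le> \<gamma> * c2 * (1 + (norm \<xi>)\<^sup>2) powr (- r)" for \<xi>
      unfolding FT mult.assoc using \<gamma> by (intro mult_left_mono assms(17)) auto
    show ?thesis
      using optimal_weights_bounded[OF \<kappa> T0 balls p supp assms(9,10) \<Phi>_le even psd' rD pos low upp]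
      by (elim exE conjE) (erule (2) that)
  qed
  obtain R0 where R0: "\<And>x. x \<in> \<Omega> \<Longrightarrow> norm x \<le> R0" using assms(1) by (auto simp: bounded_iff)
  let ?h = "\<lambda>n. fill_distance (set (X n)) \<Omega>" and ?q = "\<lambda>n. separation_distance (set (X n))"
  define h1 where "h1 = min h0 (T0 / 2)"
  have h1: "h1 > 0" "h1 < T0" using h0 T0 by (auto simp: h1_def)
  have card: "card (set (X n)) = n" "finite (set (X n))" "set (X n) \<subseteq> \<Omega>" if "n \<ge> 2" for n
    using assms(18)[OF that] by (auto simp: distinct_card)
  have q0: "?q n > 0" if "n \<ge> 2" for n
    using separation_distance_properties(1)[of "set (X n)"] card[OF that] that by simp
  have sep: "2 * ?q n \<le> norm (x - y)" if "n \<ge> 2" "x \<in> set (X n)" "y \<in> set (X n)" "x \<noteq> y" for n x y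
    using separation_distance_properties(2)[of "set (X n)" x y] card[OF that(1)] that by simp
  have cover: "\<exists>y\<in>set (X n). norm (x - y) \<le> ?h n" if "n \<ge> 2" "x \<in> \<Omega>" for n x
    by (rule fill_distance_cover[OF assms(1)]) (use card[OF that(1)] that in auto)
  have qh: "?q n \<le> ?h n" if n: "n \<ge> 2" and h: "?h n \<le> h1" for n
  proof -
    have "X n \<noteq> []" using assms(18)[OF n] n by auto
    then obtain x where x: "x \<in> set (X n)" by (cases "X n") auto
    then have x\<Omega>: "x \<in> \<Omega>" using card[OF n] by blast
    show ?thesis
    proof (rule separation_le_cover_radius[OF T0, of \<Omega> x "set (X n)"])
      fix T assume T: "0 < T" "T \<le> T0"
      then obtain y where "norm (y - x) = T" "cball y (\<kappa> * T) \<subseteq> \<Omega>" using balls x\<Omega> by blast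
      moreover have "y \<in> cball y (\<kappa> * T)" using \<kappa> T by simp
      ultimately show "\<exists>y\<in>\<Omega>. norm (y - x) = T" by blast
    qed (use h h1 q0[OF n] sep[OF n x] cover[OF n] in auto)
  qed
  have main: "\<bar>bq_weight k \<nu> (X n) i\<bar> \<le> C * (?h n / ?q n) powr (r - D / 2) * ?h n powr (D / 2)"
    if n: "n \<ge> 2" and h: "?h n \<le> h1" and i: "i < n" for n i
  proof -
    have len: "length (X n) = n" "distinct (X n)" using assms(18)[OF n] by auto
    \<comment> \<open>The weights as a function on the nodes instead of on their indices.\<close>
    define w where "w x = bq_weight k \<nu> (X n) (inv_into {..<n} ((!) (X n)) x)" for x
    have w: "w (X n ! j) = bq_weight k \<nu> (X n) j" if "j < n" for j
      unfolding w_def using that bij_betw_inv_into_left[OF bij_betw_nth_set[OF len(2)], of j] len(1) by simp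
    have opt: "quad_error p (set (X n)) w (\<lambda>y. \<Phi> (y - x)) = 0" if x: "x \<in> set (X n)" for x
    proof -
      obtain l where l: "l < n" "x = X n ! l" using x len by (auto simp: in_set_conv_nth)
      have "(\<Sum>y\<in>set (X n). w y * \<Phi> (y - x)) = (\<Sum>j<n. bq_weight k \<nu> (X n) j * k (X n ! j) (X n ! l))"
        unfolding sum_set_conv_nth[OF len(2)] len(1) by (intro sum.cong) (auto simp: w l assms(8))
      also have "\<dots> = kernel_mean k \<nu> x"
        using bq_weight_system[OF assms(11,8) len(2), of l] l len(1) by simp
      also have "\<dots> = (LBINT y. p y * \<Phi> (y - x))"
        unfolding kernel_mean_def assms(8)
        by (rule mean[THEN bspec]) (use \<Phi>m in \<open>auto intro: measurable_compose[OF _ \<Phi>m]\<close>)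
      finally show ?thesis by (simp add: quad_error_def)
    qed
    have "\<forall>x\<in>set (X n). \<bar>w x\<bar> \<le> C * (?h n / ?q n) powr (r - DIM(real ^ 'd) / 2) * ?h n powr (DIM(real ^ 'd) / 2)"
    proof (rule key[THEN spec, THEN spec, THEN spec, THEN spec, THEN mp, THEN mp, THEN mp, THEN mp,
          THEN mp, THEN mp, THEN mp, THEN mp])
      show "\<forall>x\<in>\<Omega>. \<exists>y\<in>set (X n). norm (x - y) \<le> ?h n" using cover[OF n] by blast
      show "\<forall>x\<in>set (X n). \<forall>y\<in>set (X n). x \<noteq> y \<longrightarrow> norm (x - y) \<ge> 2 * ?q n" using sep[OF n] by blast
      show "\<forall>x\<in>set (X n). quad_error p (set (X n)) w (\<lambda>y. \<Phi> (y - x)) = 0" using opt by blast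
    qed (use card[OF n] q0[OF n] qh[OF n h] h in \<open>auto simp: h1_def\<close>)
    moreover have "X n ! i \<in> set (X n)" using i len by simp
    ultimately have "\<bar>w (X n ! i)\<bar> \<le> C * (?h n / ?q n) powr (r - DIM(real ^ 'd) / 2) * ?h n powr (DIM(real ^ 'd) / 2)" by blast
    then show ?thesis unfolding w[OF i] DIM D_def .
  qed
  have part2: "\<exists>C'>0. \<exists>n0::nat. \<forall>n\<ge>n0. \<forall>i<n. \<bar>bq_weight k \<nu> (X n) i\<bar> \<le> C' * real n powr (- 1 / 2)"
    if qu: "quasi_uniform (\<lambda>n. set (X n)) \<Omega>"
  proof -
    obtain c where c: "c > 0" "\<And>n. n \<ge> 2 \<Longrightarrow> ?h n \<le> c * ?q n"
      using qu unfolding quasi_uniform_def by blast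
    have pack: "real n * ?q n powr D \<le> (2 * R0) powr D" and R0_pos: "R0 > 0" if n: "n \<ge> 2" for n
    proof -
      have "X n ! 0 \<noteq> X n ! 1" "X n ! 0 \<in> set (X n)" "X n ! 1 \<in> set (X n)"
        using assms(18)[OF n] n by (auto simp: nth_eq_iff_index_eq)
      then obtain x y where xy: "x \<in> set (X n)" "y \<in> set (X n)" "x \<noteq> y" by blast
      have in\<Omega>: "norm z \<le> R0" if "z \<in> set (X n)" for z using card[OF n] R0 that by blast
      have "2 * ?q n \<le> norm x + norm y" using sep[OF n xy] norm_triangle_ineq4[of x y] by linarith
      then have qR: "?q n \<le> R0" using in\<Omega>[OF xy(1)] in\<Omega>[OF xy(2)] by linarith
      show "R0 > 0" using qR q0[OF n] by linarith
      then show "real n * ?q n powr D \<le> (2 * R0) powr D"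
        using card_separated_le[of "set (X n)" R0 "?q n"] card[OF n] in\<Omega> q0[OF n] qR sep[OF n]
        by (simp add: D_def powr_realpow)
    qed
    have R0: "R0 > 0" using R0_pos[of 2] by simp
    define C' where "C' = C * c powr (r - D / 2) * (c * (2 * R0)) powr (D / 2)"
    have C': "C' > 0" using C c R0 by (simp add: C'_def)
    \<comment> \<open>From this index on \<open>n q\<^sup>d \<le> (2 R0)\<^sup>d\<close> forces \<open>c q \<le> h1\<close>.\<close>
    define n0 where "n0 = max 2 (nat \<lceil>(c * (2 * R0) / h1) powr D\<rceil>)"
    have "\<bar>bq_weight k \<nu> (X n) i\<bar> \<le> C' * real n powr (- 1 / 2)" if n: "n \<ge> n0" and i: "i < n" for n i
    proof -
      have n2: "n \<ge> 2" and nb: "(c * (2 * R0) / h1) powr D \<le> real n"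
        using n by (auto simp: n0_def)
      have npos: "real n > 0" using n2 by simp
      have qpow: "?q n powr D \<le> (2 * R0) powr D / real n"
        using pack[OF n2] npos by (simp add: field_simps)
      have "(c * ?q n) powr D \<le> h1 powr D"
      proof -
        have "(c * ?q n) powr D \<le> c powr D * ((2 * R0) powr D / real n)"
          unfolding powr_mult[of c "?q n"] by (rule mult_left_mono[OF qpow]) simp
        also have "\<dots> = (c * (2 * R0) / h1) powr D * h1 powr D / real n"
          using c R0 h1 by (simp add: powr_mult powr_divide)
        also have "\<dots> \<le> real n * h1 powr D / real n"
          using nb by (intro divide_right_mono mult_right_mono) auto
        also have "\<dots> = h1 powr D" using npos by simp
        finally show ?thesis .
      qed
      then have "c * ?q n \<le> h1"
        using D c q0[OF n2] h1 by (meson powr_less_mono2 not_le less_imp_le)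
      then have h: "?h n \<le> h1" using c(2)[OF n2] by linarith
      have hpos: "?h n > 0" using qh[OF n2 h] q0[OF n2] by linarith
      have s: "r - D / 2 \<ge> 0" using assms(12) by (simp add: D_def)
      have "\<bar>bq_weight k \<nu> (X n) i\<bar> \<le> C * (?h n / ?q n) powr (r - D / 2) * ?h n powr (D / 2)"
        by (rule main[OF n2 h i])
      also have "\<dots> \<le> C * c powr (r - D / 2) * (c * ?q n) powr (D / 2)"
        using C c(1) c(2)[OF n2] q0[OF n2] hpos s D
        by (intro mult_mono mult_left_mono powr_mono2) (auto simp: divide_le_eq)
      also have "(c * ?q n) powr (D / 2) \<le> (c * (2 * R0)) powr (D / 2) * real n powr (- 1 / 2)"
      proof -
        have "?q n powr (D / 2) = (?q n powr D) powr (1 / 2)" by (simp add: powr_powr)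
        also have "\<dots> \<le> ((2 * R0) powr D / real n) powr (1 / 2)" using qpow by (intro powr_mono2) auto
        also have "\<dots> = (2 * R0) powr (D / 2) * real n powr (- 1 / 2)"
          by (simp add: powr_divide powr_powr powr_minus_divide)
        finally have "c powr (D / 2) * ?q n powr (D / 2) \<le> c powr (D / 2) * ((2 * R0) powr (D / 2) * real n powr (- 1 / 2))"
          by (intro mult_left_mono) auto
        then show ?thesis by (simp only: powr_mult mult.assoc)
      qed
      finally show ?thesis using C by (simp add: C'_def mult_left_mono mult.assoc)
    qed
    then show ?thesis using C' by blast
  qed
  have part1: "\<exists>C>0. \<exists>h0>0. \<forall>n\<ge>2. ?h n \<le> h0 \<longrightarrow> (\<forall>i<n. \<bar>bq_weight k \<nu> (X n) i\<bar> \<le>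
               C * (?h n / ?q n) powr (r - real CARD('d) / 2) * ?h n powr (real CARD('d) / 2))"
    using main C h1(1) unfolding D_def by blast
  show ?thesis using part1 part2 by blast
qed

end
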